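(* Let $G(\lambda)\in\mathbb F(\lambda)^{p\times m}$ be any rational matrix of rank $r$, let $d=\deg D(\lambda)$ if the polynomial part $D(\lambda)$ of $G$ is nonzero and $d=0$ otherwise, and let $L(\lambda)=\begin{bmatrix} A_1\lambda+A_0 & B_1\lambda+B_0\\ -(C_1\lambda+C_0) & D_1\lambda+D_0\end{bmatrix}\in\mathbb F[\lambda]^{(n+(p+s))\times(n+(m+s))}$ be any strong linearization of $G(\lambda)$. Then $\mu(G)=\mu(L)+dr-(r+s)$ if $D_1+C_1A_1^{-1}B_1\ne 0$; $\mu(G)=\mu(L)+dr$ if $n>0$ and $D_1+C_1A_1^{-1}B_1=0$; and $\mu(G)=dr$ if $n=0$ and $D_1=0$.
   Context: $\mathbb F$ is an arbitrary field. $G=D+G_{sp}$ uniquely with $D$ polynomial and $G_{sp}$ strictly proper. $\mu(\cdot)$ denotes the sum of all right and left minimal indices of a rational matrix (minimal indices: degrees of the vectors of a polynomial basis of least total degree of $\mathcal N_r(G)=\{x:Gx=0\}$, resp. $\mathcal N_\ell(G)=\{x:x^TG=0\}$). A square rational matrix is biproper if it and its inverse are proper; invariant orders at infinity $q_1\le\dots\le q_r$ of $G$ are defined by biproper $B_1,B_2$ with $B_1GB_2=\operatorname{Diag}(\lambda^{-q_1},\dots,\lambda^{-q_r},0)$. $\nu(G)$ is the least order ($\deg\det A$) of a polynomial system matrix $\begin{bmatrix}A&B\\-C&D\end{bmatrix}$ ($A$ regular) with $G=D+CA^{-1}B$. Strong linearization: with $n=\nu(G)$ and $g=\min(0,q_1)$,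 a pencil $L$ of the shape in the claim is a strong linearization of $G$ if $\det(A_1\lambda+A_0)\not\equiv0$ when $n>0$ and, with $\widehat G=(D_1\lambda+D_0)+(C_1\lambda+C_0)(A_1\lambda+A_0)^{-1}(B_1\lambda+B_0)$ and $\widehat g=\min(0,\widehat q_1)$ ($\widehat q_1$ first invariant order at infinity of $\widehat G$), there exist unimodular $U_1,U_2$ with $U_1\operatorname{Diag}(G,I_s)U_2=\widehat G$ and biproper $B_1,B_2$ with $B_1\operatorname{Diag}(\lambda^gG,I_s)B_2=\lambda^{\widehat g}\widehat G$. For strong linearizations with $n>0$, $A_1$ is nonsingular; for $n=0$, $D_1+C_1A_1^{-1}B_1$ means $D_1$. *)

theory Defs
  imports "Jordan_Normal_Form.DL_Rank" "HOL-Computational_Algebra.Polynomial"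
    "HOL-Computational_Algebra.Fraction_Field"
begin

definition lam :: "'a::field poly fract" where
  "lam = to_fract [:0, 1:]"

definition proper_rf :: "'a::field poly fract \<Rightarrow> bool" where
  "proper_rf x \<longleftrightarrow> (\<exists>a b. b \<noteq> 0 \<and> x = Fract a b \<and> degree a \<le> degree b)"

definition strictly_proper_rf :: "'a::field poly fract \<Rightarrow> bool" where
  "strictly_proper_rf x \<longleftrightarrow> x = 0 \<or> (\<exists>a b. b \<noteq> 0 \<and> x = Fract a b \<and> degree a < degree b)"

text \<open>Polynomial part of a rational function (unique q with x - q strictly proper).\<close>
definition poly_part_rf :: "'a::field poly fract \<Rightarrow> 'a poly" where
  "poly_part_rf x = (SOME q. strictly_proper_rf (x - to_fract q))"

definition poly_part_mat :: "'a::field poly fract mat \<Rightarrow> 'a poly mat" where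
  "poly_part_mat G = map_mat poly_part_rf G"

definition mat_degree :: "'a::zero poly mat \<Rightarrow> nat" where
  "mat_degree P = Max (insert 0 {degree (P $$ (i, j)) | i j. i < dim_row P \<and> j < dim_col P})"

definition poly_vec_degree :: "'a::zero poly vec \<Rightarrow> nat" where
  "poly_vec_degree v = Max (insert 0 {degree (v $ j) | j. j < dim_vec v})"

definition rf_rank :: "'a::field poly fract mat \<Rightarrow> nat" where
  "rf_rank G = vec_space.rank (dim_row G) G"

definition lincomb_rf :: "nat \<Rightarrow> (nat \<Rightarrow> 'a::field poly fract) \<Rightarrow> 'a poly fract vec list \<Rightarrow> 'a poly fract vec" where
  "lincomb_rf k c fs = vec k (\<lambda>j. \<Sum>i<length fs. c i * (fs ! i) $ j)"

definition right_null :: "'a::field poly fract mat \<Rightarrow> 'a poly fract vec set" where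
  "right_null G = {x \<in> carrier_vec (dim_col G). G *\<^sub>v x = 0\<^sub>v (dim_row G)}"

definition is_poly_basis_right :: "'a::field poly fract mat \<Rightarrow> 'a poly vec list \<Rightarrow> bool" where
  "is_poly_basis_right G bs \<longleftrightarrow>
     (\<forall>b\<in>set bs. b \<in> carrier_vec (dim_col G)) \<and>
     (let fs = map (map_vec to_fract) bs in
        set fs \<subseteq> right_null G \<and>
        (\<forall>c. lincomb_rf (dim_col G) c fs = 0\<^sub>v (dim_col G) \<longrightarrow> (\<forall>i<length fs. c i = 0)) \<and>
        (\<forall>x\<in>right_null G. \<exists>c. x = lincomb_rf (dim_col G) c fs))"

definition right_min_indices_sum :: "'a::field poly fract mat \<Rightarrow> nat" where
  "right_min_indices_sum G =
     (LEAST t. \<exists>bs. is_poly_basis_right G bs \<and> t = (\<Sum>b\<leftarrow>bs. poly_vec_degree b))"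

text \<open>mu: sum of all right and left minimal indices (left null space of G = right null space of G^T).\<close>
definition mu :: "'a::field poly fract mat \<Rightarrow> nat" where
  "mu G = right_min_indices_sum G + right_min_indices_sum (transpose_mat G)"

definition mat_inv_sq :: "'b::comm_ring_1 mat \<Rightarrow> 'b mat" where
  "mat_inv_sq A = (SOME Ai. Ai \<in> carrier_mat (dim_row A) (dim_row A) \<and>
      A * Ai = 1\<^sub>m (dim_row A) \<and> Ai * A = 1\<^sub>m (dim_row A))"

definition biproper :: "'a::field poly fract mat \<Rightarrow> bool" where
  "biproper B \<longleftrightarrow> (\<exists>k. B \<in> carrier_mat k k \<and> (\<exists>Bi \<in> carrier_mat k k.
     B * Bi = 1\<^sub>m k \<and> Bi * B = 1\<^sub>m k \<and>
     (\<forall>i j. i < k \<and> j < k \<longrightarrow> proper_rf (B $$ (i, j)) \<and> proper_rf (Bi $$ (i, j)))))"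

definition unimodular :: "'a::field poly fract mat \<Rightarrow> bool" where
  "unimodular U \<longleftrightarrow> (\<exists>k. U \<in> carrier_mat k k \<and> (\<exists>Ui \<in> carrier_mat k k.
     U * Ui = 1\<^sub>m k \<and> Ui * U = 1\<^sub>m k \<and>
     (\<forall>i j. i < k \<and> j < k \<longrightarrow> U $$ (i, j) \<in> range to_fract \<and> Ui $$ (i, j) \<in> range to_fract)))"

definition inv_orders_inf :: "'a::field poly fract mat \<Rightarrow> int list \<Rightarrow> bool" where
  "inv_orders_inf G qs \<longleftrightarrow> length qs = rf_rank G \<and> sorted qs \<and>
     (\<exists>B1 B2. biproper B1 \<and> biproper B2 \<and>
        B1 \<in> carrier_mat (dim_row G) (dim_row G) \<and> B2 \<in> carrier_mat (dim_col G) (dim_col G) \<and>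
        B1 * G * B2 = mat (dim_row G) (dim_col G)
           (\<lambda>(i, j). if i = j \<and> i < length qs then lam powi (- (qs ! i)) else 0))"

definition first_inv_order :: "'a::field poly fract mat \<Rightarrow> int" where
  "first_inv_order G = (SOME q. \<exists>qs. inv_orders_inf G qs \<and> qs \<noteq> [] \<and> hd qs = q)"

definition gexp :: "'a::field poly fract mat \<Rightarrow> int" where
  "gexp G = min 0 (first_inv_order G)"

text \<open>Polynomial system matrix [A B; -C D] (A regular) realizing G = D + C A^{-1} B.\<close>
definition is_realization :: "'a::field poly fract mat \<Rightarrow> 'a poly mat \<Rightarrow> 'a poly mat \<Rightarrow> 'a poly mat \<Rightarrow> 'a poly mat \<Rightarrow> bool" where
  "is_realization G A B C D \<longleftrightarrow> (\<exists>k. A \<in> carrier_mat k k \<and> B \<in> carrier_mat k (dim_col G) \<and>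
     C \<in> carrier_mat (dim_row G) k \<and> D \<in> carrier_mat (dim_row G) (dim_col G) \<and> det A \<noteq> 0 \<and>
     G = map_mat to_fract D + map_mat to_fract C * mat_inv_sq (map_mat to_fract A) * map_mat to_fract B)"

definition nu :: "'a::field poly fract mat \<Rightarrow> nat" where
  "nu G = (LEAST t. \<exists>A B C D. is_realization G A B C D \<and> t = degree (det A))"

definition pencil :: "'a::field mat \<Rightarrow> 'a mat \<Rightarrow> 'a poly fract mat" where
  "pencil X1 X0 = mat (dim_row X1) (dim_col X1) (\<lambda>(i, j). to_fract [:X0 $$ (i, j), X1 $$ (i, j):])"

definition diag_I :: "'a::field poly fract mat \<Rightarrow> nat \<Rightarrow> 'a poly fract mat" where
  "diag_I G s = four_block_mat G (0\<^sub>m (dim_row G) s) (0\<^sub>m s (dim_col G)) (1\<^sub>m s)"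

definition transfer :: "'a::field mat \<Rightarrow> 'a mat \<Rightarrow> 'a mat \<Rightarrow> 'a mat \<Rightarrow> 'a mat \<Rightarrow> 'a mat \<Rightarrow> 'a mat \<Rightarrow> 'a mat \<Rightarrow> 'a poly fract mat" where
  "transfer A1 A0 B1 B0 C1 C0 D1 D0 =
     pencil D1 D0 + pencil C1 C0 * mat_inv_sq (pencil A1 A0) * pencil B1 B0"

definition strong_lin :: "'a::field poly fract mat \<Rightarrow> nat \<Rightarrow> 'a mat \<Rightarrow> 'a mat \<Rightarrow> 'a mat \<Rightarrow> 'a mat \<Rightarrow> 'a mat \<Rightarrow> 'a mat \<Rightarrow> 'a mat \<Rightarrow> 'a mat \<Rightarrow> bool" where
  "strong_lin G s A1 A0 B1 B0 C1 C0 D1 D0 \<longleftrightarrow>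
    (let n = nu G; p = dim_row G; m = dim_col G;
         Gh = transfer A1 A0 B1 B0 C1 C0 D1 D0 in
     A1 \<in> carrier_mat n n \<and> A0 \<in> carrier_mat n n \<and>
     B1 \<in> carrier_mat n (m + s) \<and> B0 \<in> carrier_mat n (m + s) \<and>
     C1 \<in> carrier_mat (p + s) n \<and> C0 \<in> carrier_mat (p + s) n \<and>
     D1 \<in> carrier_mat (p + s) (m + s) \<and> D0 \<in> carrier_mat (p + s) (m + s) \<and>
     (n > 0 \<longrightarrow> det (pencil A1 A0) \<noteq> 0) \<and>
     (\<exists>U1 U2. unimodular U1 \<and> unimodular U2 \<and>
        U1 \<in> carrier_mat (p + s) (p + s) \<and> U2 \<in> carrier_mat (m + s) (m + s) \<and>
        U1 * diag_I G s * U2 = Gh) \<and>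
     (\<exists>E1 E2. biproper E1 \<and> biproper E2 \<and>
        E1 \<in> carrier_mat (p + s) (p + s) \<and> E2 \<in> carrier_mat (m + s) (m + s) \<and>
        E1 * diag_I ((lam powi gexp G) \<cdot>\<^sub>m G) s * E2 = (lam powi gexp Gh) \<cdot>\<^sub>m Gh))"

definition lin_pencil :: "'a::field mat \<Rightarrow> 'a mat \<Rightarrow> 'a mat \<Rightarrow> 'a mat \<Rightarrow> 'a mat \<Rightarrow> 'a mat \<Rightarrow> 'a mat \<Rightarrow> 'a mat \<Rightarrow> 'a poly fract mat" where
  "lin_pencil A1 A0 B1 B0 C1 C0 D1 D0 =
     four_block_mat (pencil A1 A0) (pencil B1 B0) (- pencil C1 C0) (pencil D1 D0)"

end

theory Submission
  imports Defs
begin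

text \<open>
  Polynomials and proper functions are two Euclidean subrings of the field of rational functions, with norms
  the degree and its negative. Over each of them a matrix \<open>H\<close> is equivalent to \<open>0 \<oplus> C\<close> with
  \<open>C\<close> nonsingular. Comparing the two transformations block by block, the sum of the minimal
  indices of \<open>H\<close> is \<open>deg det C\<^sub>\<infinity> - deg det C\<^sub>f\<close>, where \<open>C\<^sub>f\<close> and \<open>C\<^sub>\<infinity>\<close>
  are the two cores: the right minimal indices measure the degree of the change of basis
  between the two lattices of the null space. A strong linearization leaves \<open>C\<^sub>f\<close> unchanged (up to adding
  an identity block) and only rescales the core at infinity by powers of \<open>\<lambda>\<close>; this gives the difference
  between the indices of \<open>G\<close> and those of the transfer function of \<open>L\<close>. Finally, since \<open>n = \<nu>(G)\<close> is
  the least order, \<open>A\<^sub>1\<close> is nonsingular and the pencil is coprime, so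
  \<open>y \<mapsto> (-A\<^sup>-\<^sup>1By, y)\<close> preserves polynomial null vectors and their degrees.
\<close>

section \<open>Equivalence of matrices over a Euclidean subring of a field\<close>

text \<open>An index sum is a minimum over all polynomial bases, so it must be bounded below for
  every basis and attained for one. For a basis B of the null space, let L be diagonal with entries
  lambda to the negative column degrees, X the coordinates of B in the polynomial lattice and Y
  those of B L in the proper one. The degree sum of B is deg det X - deg det Y plus a term
  independent of B; deg det X and - deg det Y are nonnegative, and both vanish for a suitable B. A
  Smith form enters only to identify the first invariant order at infinity. Constants: scaling an r
  x r core by lambda^g changes the degree of its determinant by g r. With g = -d this is the term
  dr. The transfer function has rank r + s and exponent -1 or 0, according to whether its leading
  coefficient D1 + C1 A1^{-1} B1 is nonzero; this gives r + s or nothing. That A1 is nonsingular is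
  a degree count: a realization of the transfer function yields one of G with the same A, so deg det
  (A1 lambda + A0) is at least n, while the determinant of an n x n pencil has degree at most n,
  with det A1 as the coefficient of lambda^n.\<close>

definition mat_over :: "'b set \<Rightarrow> 'b mat \<Rightarrow> bool" where
  "mat_over R P \<longleftrightarrow> (\<forall>i < dim_row P. \<forall>j < dim_col P. P $$ (i, j) \<in> R)"

section \<open>Block diagonal sums and inverses\<close>

definition dsum :: "'b::zero mat \<Rightarrow> 'b mat \<Rightarrow> 'b mat" where
  "dsum X Y = four_block_mat X (0\<^sub>m (dim_row X) (dim_col Y)) (0\<^sub>m (dim_row Y) (dim_col X)) Y"

lemma dsum_dim [simp]:
  "dim_row (dsum X Y) = dim_row X + dim_row Y" "dim_col (dsum X Y) = dim_col X + dim_col Y"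
  by (auto simp: dsum_def)

lemma dsum_carrier [simp, intro]:
  "X \<in> carrier_mat a b \<Longrightarrow> Y \<in> carrier_mat c d \<Longrightarrow> dsum X Y \<in> carrier_mat (a + c) (b + d)"
  by (auto simp: dsum_def)

lemma dsum_index:
  assumes "i < dim_row X + dim_row Y" "j < dim_col X + dim_col Y"
  shows "dsum X Y $$ (i, j) = (if i < dim_row X \<and> j < dim_col X then X $$ (i, j)
      else if \<not> i < dim_row X \<and> \<not> j < dim_col X then Y $$ (i - dim_row X, j - dim_col X) else 0)"
  using assms by (auto simp: dsum_def)

lemma dsum_assoc: "dsum X (dsum Y Z) = dsum (dsum X Y) Z"
  using assoc_four_block_mat[of X Y Z] by (simp add: dsum_def)

lemma dsum_mult:
  fixes X1 :: "'b::comm_ring_1 mat"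
  assumes "X1 \<in> carrier_mat a b" "X2 \<in> carrier_mat b c" "Y1 \<in> carrier_mat a' b'" "Y2 \<in> carrier_mat b' c'"
  shows "dsum X1 Y1 * dsum X2 Y2 = dsum (X1 * X2) (Y1 * Y2)"
  using assms unfolding dsum_def by (subst mult_four_block_mat) auto

lemma dsum_one [simp]: "dsum (1\<^sub>m a) (1\<^sub>m b) = (1\<^sub>m (a + b) :: 'b::comm_ring_1 mat)"
  by (simp add: dsum_def)

lemma dsum_zero [simp]: "dsum (0\<^sub>m a b) (0\<^sub>m c d) = 0\<^sub>m (a + c) (b + d)"
  by (simp add: dsum_def)

lemma dsum_transpose: "transpose_mat (dsum X Y) = dsum (X\<^sup>T) (Y\<^sup>T)"
  unfolding dsum_def by (subst transpose_four_block_mat) auto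

lemma dsum_det:
  fixes X :: "'b::idom mat"
  assumes "X \<in> carrier_mat a a" "Y \<in> carrier_mat b b"
  shows "det (dsum X Y) = det X * det Y"
  using assms unfolding dsum_def by (subst det_four_block_mat_upper_right_zero) auto

lemma dsum_smult: "c \<cdot>\<^sub>m dsum X Y = dsum (c \<cdot>\<^sub>m X) (c \<cdot>\<^sub>m Y)" for c :: "'b::comm_ring_1"
  by (rule eq_matI) (auto simp: dsum_index)

lemma mat_over_dsum:
  assumes "mat_over R X" "mat_over R Y" "0 \<in> R"
  shows "mat_over R (dsum X Y)"
  using assms by (auto simp: mat_over_def dsum_index)

lemma mat_assoc:
  fixes A :: "'b::semiring_0 mat"
  shows "dim_col A = dim_row B \<Longrightarrow> dim_col B = dim_row C \<Longrightarrow> A * B * C = A * (B * C)"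
  by (rule assoc_mult_mat[of A "dim_row A" "dim_col A" B "dim_col B" C "dim_col C"]) auto

lemma mat_cancel:
  fixes A :: "'b::comm_ring_1 mat"
  assumes "B * A = 1\<^sub>m n" "B \<in> carrier_mat n k" "A \<in> carrier_mat k n" "dim_row X = n"
  shows "B * (A * X) = X"
  using assms mat_assoc[of B A X] by simp

lemma square_inverse_unique:
  fixes A :: "'b::comm_ring_1 mat"
  assumes "A \<in> carrier_mat n n" "B \<in> carrier_mat n n" "C \<in> carrier_mat n n" "B * A = 1\<^sub>m n" "A * C = 1\<^sub>m n"
  shows "B = C"
proof -
  have "B = B * (A * C)" using assms by simp
  also have "\<dots> = C" using mat_cancel[OF assms(4,2,1), of C] assms(3) by simp
  finally show ?thesis .
qed

lemma inverse_adj_mat: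
  fixes A :: "'b::field mat"
  assumes A: "A \<in> carrier_mat n n" and nz: "det A \<noteq> 0"
  shows "A * ((1 / det A) \<cdot>\<^sub>m adj_mat A) = 1\<^sub>m n" "(1 / det A) \<cdot>\<^sub>m adj_mat A * A = 1\<^sub>m n"
proof -
  note adj = adj_mat[OF A]
  have "A * ((1 / det A) \<cdot>\<^sub>m adj_mat A) = (1 / det A) \<cdot>\<^sub>m (A * adj_mat A)"
    by (rule mult_smult_distrib[OF A adj(1)])
  also have "\<dots> = 1\<^sub>m n" unfolding adj(2) using nz by (intro eq_matI) auto
  finally show "A * ((1 / det A) \<cdot>\<^sub>m adj_mat A) = 1\<^sub>m n" .
  have "(1 / det A) \<cdot>\<^sub>m adj_mat A * A = (1 / det A) \<cdot>\<^sub>m (adj_mat A * A)"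
    by (rule mult_smult_assoc_mat[OF adj(1) A])
  also have "\<dots> = 1\<^sub>m n" unfolding adj(3) using nz by (intro eq_matI) auto
  finally show "(1 / det A) \<cdot>\<^sub>m adj_mat A * A = 1\<^sub>m n" .
qed

lemma det_nonzero_inverse:
  fixes A :: "'b::field mat"
  assumes "A \<in> carrier_mat n n" "det A \<noteq> 0"
  obtains B where "B \<in> carrier_mat n n" "A * B = 1\<^sub>m n" "B * A = 1\<^sub>m n"
  using that[OF _ inverse_adj_mat[OF assms]] adj_mat(1)[OF assms(1)] by simp

lemma det_mult_inverse:
  fixes A :: "'b::comm_ring_1 mat"
  assumes "A \<in> carrier_mat n n" "B \<in> carrier_mat n n" "A * B = 1\<^sub>m n"
  shows "det A * det B = 1"
  using assms det_mult[of A n B] by simp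

text \<open>The norm lives on the whole field, and \<open>division\<close> divides arbitrary field
  elements with a quotient in \<open>R\<close>. Elimination can thus be run on a rational matrix
  itself, while \<open>denominator\<close> serves to bound the norms of its entries from
  below.\<close>

locale euclidean_subring =
  fixes R :: "'k::field set" and N :: "'k \<Rightarrow> int"
  assumes zero_in [simp, intro]: "0 \<in> R" and one_in [simp, intro]: "1 \<in> R"
    and add_in [intro]: "x \<in> R \<Longrightarrow> y \<in> R \<Longrightarrow> x + y \<in> R"
    and uminus_in [intro]: "x \<in> R \<Longrightarrow> - x \<in> R"
    and mult_in [intro]: "x \<in> R \<Longrightarrow> y \<in> R \<Longrightarrow> x * y \<in> R"
    and N_mult: "x \<noteq> 0 \<Longrightarrow> y \<noteq> 0 \<Longrightarrow> N (x * y) = N x + N y"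
    and N_nonneg: "x \<in> R \<Longrightarrow> x \<noteq> 0 \<Longrightarrow> 0 \<le> N x"
    and division: "b \<noteq> 0 \<Longrightarrow> \<exists>q\<in>R. a - q * b = 0 \<or> N (a - q * b) < N b"
    and denominator: "\<exists>d\<in>R. d \<noteq> 0 \<and> d * x \<in> R"
begin

lemma sum_in [intro]: "(\<And>i. i \<in> I \<Longrightarrow> f i \<in> R) \<Longrightarrow> sum f I \<in> R"
  by (induction I rule: infinite_finite_induct) auto

lemma prod_in [intro]: "(\<And>i. i \<in> I \<Longrightarrow> f i \<in> R) \<Longrightarrow> prod f I \<in> R"
  by (induction I rule: infinite_finite_induct) auto

lemma N_1: "N 1 = 0"
  using N_mult[of 1 1] by simp

text \<open>Otherwise the remainder of 1 modulo \<open>x\<close> would be a nonzero element of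
  \<open>R\<close> of negative norm.\<close>

lemma N_0_unit:
  assumes "x \<in> R" "x \<noteq> 0" "N x = 0"
  shows "1 / x \<in> R"
proof -
  obtain q where q: "q \<in> R" "1 - q * x = 0 \<or> N (1 - q * x) < N x"
    using division[OF assms(2)] by blast
  have "1 - q * x = 0"
  proof (rule ccontr)
    assume *: "1 - q * x \<noteq> 0"
    have "1 - q * x \<in> R" using q assms by (metis add_in uminus_in mult_in one_in diff_conv_add_uminus)
    with * q assms N_nonneg show False by fastforce
  qed
  hence "1 / x = q" using assms by (simp add: field_simps)
  thus ?thesis using q by simp
qed

lemma mat_over_mult [intro]:
  assumes "mat_over R A" "mat_over R B" "dim_col A = dim_row B"
  shows "mat_over R (A * B)"
  using assms by (auto simp: mat_over_def scalar_prod_def intro!: sum_in mult_in)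

lemma mat_over_one [intro, simp]: "mat_over R (1\<^sub>m n)"
  by (auto simp: mat_over_def)

lemma mat_over_zero [intro, simp]: "mat_over R (0\<^sub>m m n)"
  by (auto simp: mat_over_def)

lemma mat_over_add [intro]:
  "mat_over R A \<Longrightarrow> mat_over R B \<Longrightarrow> dim_row A = dim_row B \<Longrightarrow> dim_col A = dim_col B \<Longrightarrow> mat_over R (A + B)"
  by (auto simp: mat_over_def)

lemma mat_over_transpose [intro]: "mat_over R A \<Longrightarrow> mat_over R (A\<^sup>T)"
  by (auto simp: mat_over_def)

lemma det_in:
  assumes "mat_over R A"
  shows "det A \<in> R"
proof (cases "dim_row A = dim_col A")
  case True
  have "signof p * (\<Prod>i = 0..<dim_row A. A $$ (i, p i)) \<in> R" if p: "p permutes {0..<dim_row A}" for p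
  proof (intro mult_in prod_in)
    have "(signof p :: 'k) = 1 \<or> (signof p :: 'k) = - 1" by (cases p rule: sign_cases) auto
    thus "(signof p :: 'k) \<in> R" using one_in uminus_in[OF one_in] by metis
  next
    fix i assume "i \<in> {0..<dim_row A}"
    moreover hence "p i \<in> {0..<dim_row A}" using p by (simp add: permutes_in_image)
    ultimately show "A $$ (i, p i) \<in> R" using assms True by (simp add: mat_over_def)
  qed
  hence "(\<Sum>p | p permutes {0..<dim_row A}. signof p * (\<Prod>i = 0..<dim_row A. A $$ (i, p i))) \<in> R"
    by (intro sum_in) simp
  thus ?thesis using True by (simp add: det_def)
qed (auto simp: det_def)

section \<open>Invertible matrices and equivalence over the subring\<close>

definition gl :: "nat \<Rightarrow> 'k mat \<Rightarrow> bool" where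
  "gl n P \<longleftrightarrow> P \<in> carrier_mat n n \<and> mat_over R P \<and>
     (\<exists>Q\<in>carrier_mat n n. mat_over R Q \<and> P * Q = 1\<^sub>m n \<and> Q * P = 1\<^sub>m n)"

lemma gl_carrier: "gl n P \<Longrightarrow> P \<in> carrier_mat n n"
  by (simp add: gl_def)

lemma gl_inverse:
  assumes "gl n P"
  obtains Q where "gl n Q" "P * Q = 1\<^sub>m n" "Q * P = 1\<^sub>m n"
  using assms unfolding gl_def by blast

lemma gl_one [intro, simp]: "gl n (1\<^sub>m n)"
  unfolding gl_def by (intro conjI bexI[of _ "1\<^sub>m n"]) auto

lemma gl_mult:
  assumes "gl n P" "gl n Q"
  shows "gl n (P * Q)"
proof -
  obtain P' where P': "gl n P'" "P * P' = 1\<^sub>m n" "P' * P = 1\<^sub>m n" using gl_inverse[OF assms(1)] .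
  obtain Q' where Q': "gl n Q'" "Q * Q' = 1\<^sub>m n" "Q' * Q = 1\<^sub>m n" using gl_inverse[OF assms(2)] .
  have c: "P \<in> carrier_mat n n" "P' \<in> carrier_mat n n" "Q \<in> carrier_mat n n" "Q' \<in> carrier_mat n n"
    using assms P' Q' gl_carrier by auto
  have 1: "P * Q * (Q' * P') = 1\<^sub>m n" 
    using c P' Q' mat_cancel[OF Q'(2) c(3,4)] by (simp add: mat_assoc)
  have 2: "Q' * P' * (P * Q) = 1\<^sub>m n"
    using c P' Q' mat_cancel[OF P'(3) c(2,1)] by (simp add: mat_assoc)
  show ?thesis unfolding gl_def
    using c 1 2 assms P' Q' by (intro conjI bexI[of _ "Q' * P'"]) (auto simp: gl_def)
qed

lemma gl_transpose:
  assumes "gl n P"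
  shows "gl n (P\<^sup>T)"
proof -
  obtain P' where P': "gl n P'" "P * P' = 1\<^sub>m n" "P' * P = 1\<^sub>m n" using gl_inverse[OF assms(1)] .
  have c: "P \<in> carrier_mat n n" "P' \<in> carrier_mat n n" using assms P' gl_carrier by auto
  have "P\<^sup>T * P'\<^sup>T = 1\<^sub>m n" "P'\<^sup>T * P\<^sup>T = 1\<^sub>m n"
    using P' c by (metis transpose_mult transpose_one)+
  thus ?thesis using c assms P' unfolding gl_def
    by (intro conjI bexI[of _ "P'\<^sup>T"]) auto
qed

lemma gl_dsum:
  assumes "gl m P" "gl n Q"
  shows "gl (m + n) (dsum P Q)"
proof -
  obtain P' where P': "gl m P'" "P * P' = 1\<^sub>m m" "P' * P = 1\<^sub>m m" using gl_inverse[OF assms(1)] .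
  obtain Q' where Q': "gl n Q'" "Q * Q' = 1\<^sub>m n" "Q' * Q = 1\<^sub>m n" using gl_inverse[OF assms(2)] .
  have c: "P \<in> carrier_mat m m" "P' \<in> carrier_mat m m" "Q \<in> carrier_mat n n" "Q' \<in> carrier_mat n n"
    using assms P' Q' gl_carrier by auto
  show ?thesis unfolding gl_def
    using c assms P' Q' 
    by (intro conjI bexI[of _ "dsum P' Q'"]) (auto simp: gl_def dsum_mult[OF c(1,2) c(3,4)] dsum_mult[OF c(2,1) c(4,3)] intro: mat_over_dsum)
qed

text \<open>The determinants of \<open>P\<close> and of its inverse lie in \<open>R\<close>, so both
  norms are nonnegative, and they add up to \<open>N 1 = 0\<close>.\<close>

lemma gl_det:
  assumes "gl n P"
  shows "det P \<noteq> 0" "N (det P) = 0"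
proof -
  obtain P' where P': "gl n P'" "P * P' = 1\<^sub>m n" "P' * P = 1\<^sub>m n" using gl_inverse[OF assms(1)] .
  have d: "det P * det P' = 1" using det_mult_inverse[of P n P'] assms P' gl_carrier by auto
  show nz: "det P \<noteq> 0" using d by auto
  have nz': "det P' \<noteq> 0" using d by auto
  have "N (det P) + N (det P') = 0" using N_mult[OF nz nz'] d N_1 by simp
  moreover have "det P \<in> R" "det P' \<in> R" using assms P' by (auto simp: gl_def intro: det_in)
  ultimately show "N (det P) = 0" using N_nonneg[of "det P"] N_nonneg[of "det P'"] nz nz' by linarith
qed

text \<open>The adjugate is over \<open>R\<close>, and a determinant of norm 0 is a unit of
  \<open>R\<close>. Through this converse of \<open>gl_det\<close>, degree counts yield unimodular
  and biproper matrices.\<close>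

lemma gl_of_det:
  assumes "P \<in> carrier_mat n n" "mat_over R P" "det P \<noteq> 0" "N (det P) = 0"
  shows "gl n P"
proof -
  note adj = adj_mat[OF assms(1)]
  let ?Q = "(1 / det P) \<cdot>\<^sub>m adj_mat P"
  have u: "1 / det P \<in> R" using N_0_unit assms det_in by blast
  have 1: "?Q \<in> carrier_mat n n" using adj by auto
  note 2 = inverse_adj_mat[OF assms(1,3)]
  have sg: "(-1) ^ k \<in> R" for k by (induction k) auto
  have "mat_over R (mat_delete P i j)" if "i < n" "j < n" for i j
    using assms(1,2) that unfolding mat_over_def mat_delete_def by auto
  hence "mat_over R (adj_mat P)" 
    using assms(1,2) unfolding mat_over_def[of _ "adj_mat P"] by (auto simp: adj_mat_def cofactor_def intro!: mult_in det_in sg)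
  hence "mat_over R ?Q" using mult_in[OF u] by (auto simp: mat_over_def)
  thus ?thesis unfolding gl_def using assms 1 2 by blast
qed

text \<open>Only the transforming matrices are over \<open>R\<close>; the matrices compared may have
  arbitrary entries in the field.\<close>

definition eqv :: "'k mat \<Rightarrow> 'k mat \<Rightarrow> bool" where
  "eqv A B \<longleftrightarrow> (\<exists>P Q. gl (dim_row A) P \<and> gl (dim_col A) Q \<and> B = P * A * Q)"

lemma eqvI: "A \<in> carrier_mat m n \<Longrightarrow> gl m P \<Longrightarrow> gl n Q \<Longrightarrow> B = P * A * Q \<Longrightarrow> eqv A B"
  by (auto simp: eqv_def)

lemma eqvE:
  assumes "eqv A B" "A \<in> carrier_mat m n"
  obtains P Q where "gl m P" "gl n Q" "B = P * A * Q"
  using assms by (auto simp: eqv_def)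

lemma eqv_dim: "eqv A B \<Longrightarrow> dim_row B = dim_row A \<and> dim_col B = dim_col A"
  by (auto simp: eqv_def dest!: gl_carrier)

lemma eqv_carrier: "eqv A B \<Longrightarrow> A \<in> carrier_mat m n \<Longrightarrow> B \<in> carrier_mat m n"
  using eqv_dim by (metis carrier_matI carrier_matD)

lemma eqv_refl [simp, intro]: "eqv A A"
  unfolding eqv_def by (intro exI[of _ "1\<^sub>m _"]) auto

lemma eqv_sym:
  assumes "eqv A B"
  shows "eqv B A"
proof -
  define m n where mn: "m = dim_row A" "n = dim_col A"
  obtain P Q where PQ: "gl m P" "gl n Q" "B = P * A * Q" using assms by (auto simp: eqv_def mn)
  obtain P' where P': "gl m P'" "P * P' = 1\<^sub>m m" "P' * P = 1\<^sub>m m" using gl_inverse[OF PQ(1)] .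
  obtain Q' where Q': "gl n Q'" "Q * Q' = 1\<^sub>m n" "Q' * Q = 1\<^sub>m n" using gl_inverse[OF PQ(2)] .
  have c: "P \<in> carrier_mat m m" "P' \<in> carrier_mat m m" "Q \<in> carrier_mat n n" "Q' \<in> carrier_mat n n"
      "A \<in> carrier_mat m n"
    using assms P' Q' gl_carrier PQ by (auto simp: mn)
  have "A = P' * B * Q'" unfolding PQ using c P' Q' mat_cancel[OF P'(3) c(2,1)]
    by (simp add: mat_assoc)
  moreover have "B \<in> carrier_mat m n" using PQ c by auto
  ultimately show ?thesis using P' Q' by (intro eqvI[of B m n]) auto
qed

lemma eqv_trans:
  assumes "eqv A B" "eqv B C"
  shows "eqv A C"
proof -
  define m n where mn: "m = dim_row A" "n = dim_col A"
  have A: "A \<in> carrier_mat m n" by (auto simp: mn)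
  obtain P Q where PQ: "gl m P" "gl n Q" "B = P * A * Q" using assms eqvE A by blast
  have B: "B \<in> carrier_mat m n" using eqv_carrier A assms by blast
  obtain P' Q' where PQ': "gl m P'" "gl n Q'" "C = P' * B * Q'" using assms eqvE B by blast
  have c: "P \<in> carrier_mat m m" "P' \<in> carrier_mat m m" "Q \<in> carrier_mat n n" "Q' \<in> carrier_mat n n"
    using PQ PQ' gl_carrier by auto
  have "C = (P' * P) * A * (Q * Q')" unfolding PQ PQ' using c A by (simp add: mat_assoc)
  thus ?thesis using gl_mult PQ PQ' A by (intro eqvI[of A m n]) auto
qed

lemma eqv_transpose:
  assumes "eqv A B"
  shows "eqv (A\<^sup>T) (B\<^sup>T)"
proof -
  define m n where mn: "m = dim_row A" "n = dim_col A"
  have A: "A \<in> carrier_mat m n" by (auto simp: mn)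
  obtain P Q where PQ: "gl m P" "gl n Q" "B = P * A * Q" using assms eqvE A by blast
  have c: "P \<in> carrier_mat m m" "Q \<in> carrier_mat n n" using PQ gl_carrier by auto
  have "B\<^sup>T = Q\<^sup>T * (A\<^sup>T * P\<^sup>T)"
    unfolding PQ using transpose_mult[of "P * A" m n Q n] transpose_mult[of P m m A n] c A by simp
  also have "\<dots> = Q\<^sup>T * A\<^sup>T * P\<^sup>T"
    using c A by simp
  finally show ?thesis using gl_transpose PQ A by (intro eqvI[of _ n m]) auto
qed

lemma eqv_dsum:
  assumes "eqv A B" "eqv C D"
  shows "eqv (dsum A C) (dsum B D)"
proof -
  define m n m' n' where mn: "m = dim_row A" "n = dim_col A" "m' = dim_row C" "n' = dim_col C"
  have A: "A \<in> carrier_mat m n" "C \<in> carrier_mat m' n'" by (auto simp: mn)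
  obtain P Q where PQ: "gl m P" "gl n Q" "B = P * A * Q" using assms eqvE A by blast
  obtain P' Q' where PQ': "gl m' P'" "gl n' Q'" "D = P' * C * Q'" using assms eqvE A by blast
  have c: "P \<in> carrier_mat m m" "Q \<in> carrier_mat n n" "P' \<in> carrier_mat m' m'" "Q' \<in> carrier_mat n' n'"
    using PQ PQ' gl_carrier by auto
  have "dsum P P' * dsum A C * dsum Q Q' = dsum (P * A) (P' * C) * dsum Q Q'"
    using dsum_mult c A by metis
  also have "\<dots> = dsum B D" unfolding PQ PQ' 
    by (rule dsum_mult[of _ m n _ n _ m' n' _ n']) (use c A in auto)
  finally show ?thesis using PQ PQ' gl_dsum A
    by (intro eqvI[of "dsum A C" "m + m'" "n + n'" "dsum P P'" "dsum Q Q'"]) auto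
qed

definition swap_block :: "nat \<Rightarrow> nat \<Rightarrow> 'k mat" where
  "swap_block a b = four_block_mat (0\<^sub>m a b) (1\<^sub>m a) (1\<^sub>m b) (0\<^sub>m b a)"

lemma swap_block_gl: "gl (a + b) (swap_block a b)"
proof -
  have c: "swap_block a b \<in> carrier_mat (a + b) (a + b)" for a b
    unfolding swap_block_def carrier_mat_def by auto
  have o: "mat_over R (swap_block a b)" for a b
    unfolding swap_block_def mat_over_def by auto
  have m: "swap_block a b * swap_block b a = 1\<^sub>m (a + b)" for a b
    unfolding swap_block_def by (subst mult_four_block_mat[of _ a b _ a _ b _ _ a _ b]) auto
  have c': "swap_block b a \<in> carrier_mat (a + b) (a + b)" using c[of b a] by (simp add: add.commute)
  have m': "swap_block b a * swap_block a b = 1\<^sub>m (a + b)" using m[of b a] by (simp add: add.commute)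
  show ?thesis unfolding gl_def using c o m c' m' by blast
qed

text \<open>Block permutations on both sides. They let pivots be collected in the lower right corner
  while the zero block stays in the upper left.\<close>

lemma eqv_dsum_swap: "eqv (dsum X Y) (dsum Y X)"
proof -
  define a b c d where abcd: "a = dim_row X" "b = dim_col X" "c = dim_row Y" "d = dim_col Y"
  have X: "X \<in> carrier_mat a b" "Y \<in> carrier_mat c d" by (auto simp: abcd)
  have "swap_block c a * dsum X Y = four_block_mat (0\<^sub>m c b) Y X (0\<^sub>m a d)"
    unfolding swap_block_def dsum_def using X
    by (subst mult_four_block_mat[of _ c a _ c _ a _ _ b _ d]) auto
  also have "\<dots> * swap_block b d = dsum Y X"
    unfolding swap_block_def dsum_def using X
    by (subst mult_four_block_mat[of _ c b _ d _ a _ _ d _ b]) auto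
  finally have "dsum Y X = swap_block c a * dsum X Y * swap_block b d" by simp
  moreover have "gl (a + c) (swap_block c a)" using swap_block_gl[of c a] by (simp add: add.commute)
  moreover have "gl (b + d) (swap_block b d)" by (rule swap_block_gl)
  ultimately show ?thesis using X by (intro eqvI[of "dsum X Y" "a + c" "b + d"]) auto
qed

section \<open>Elementary operations, pivots and the nonsingular core\<close>

lemma swaprows_gl:
  assumes "k < n" "l < n"
  shows "gl n (swaprows_mat n k l)"
  unfolding gl_def
  using swaprows_mat_inv[OF assms]
  by (intro conjI bexI[of _ "swaprows_mat n k l"]) (auto simp: mat_over_def swaprows_mat_def)

lemma addrow_gl:
  assumes "k < n" "l < n" "k \<noteq> l" "a \<in> R"
  shows "gl n (addrow_mat n a k l)"
  unfolding gl_def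
  using addrow_mat_inv[OF assms(1,2,3)] addrow_mat_inv[OF assms(1,2,3), of "- a"] assms
  by (intro conjI bexI[of _ "addrow_mat n (- a) k l"]) (auto simp: mat_over_def addrow_mat_def)

lemma eqv_swaprows:
  assumes "k < dim_row A" "l < dim_row A"
  shows "eqv A (swaprows k l A)"
  using assms swaprows_mat[of A "dim_row A" "dim_col A" k l] swaprows_gl
  by (intro eqvI[of _ "dim_row A" "dim_col A" "swaprows_mat (dim_row A) k l" "1\<^sub>m (dim_col A)"]) auto

lemma eqv_addrow:
  assumes "k < dim_row A" "l < dim_row A" "k \<noteq> l" "a \<in> R"
  shows "eqv A (addrow a k l A)"
  using assms addrow_mat[of A "dim_row A" "dim_col A" l a k] addrow_gl
  by (intro eqvI[of _ "dim_row A" "dim_col A" "addrow_mat (dim_row A) a k l" "1\<^sub>m (dim_col A)"]) auto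

lemma common_denominator:
  assumes "finite X"
  shows "\<exists>d\<in>R. d \<noteq> 0 \<and> (\<forall>x\<in>X. d * x \<in> R)"
  using assms
proof (induction X)
  case empty
  show ?case using one_in by (metis empty_iff one_neq_zero)
next
  case (insert x X)
  then obtain d e where "d \<in> R" "d \<noteq> 0" "\<forall>x\<in>X. d * x \<in> R" "e \<in> R" "e \<noteq> 0" "e * x \<in> R"
    using denominator[of x] by blast
  moreover have "e * d * x = d * (e * x)" by simp
  moreover have "e * d * y = e * (d * y)" for y by simp
  ultimately have "e * d \<in> R \<and> e * d \<noteq> 0 \<and> (\<forall>y\<in>insert x X. e * d * y \<in> R)"
    by (metis insert_iff mult_eq_0_iff mult_in)
  thus ?case by blast
qed

lemma mat_common_denominator: "\<exists>d\<in>R. d \<noteq> 0 \<and> mat_over R (d \<cdot>\<^sub>m A)"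
proof -
  have "finite {A $$ (i, j) | i j. i < dim_row A \<and> j < dim_col A}"
    by (rule finite_image_set2) auto
  from common_denominator[OF this] obtain d
    where "d \<in> R" "d \<noteq> 0" "\<forall>x\<in>{A $$ (i, j) | i j. i < dim_row A \<and> j < dim_col A}. d * x \<in> R"
    by blast
  thus ?thesis by (intro bexI[of _ d]) (auto simp: mat_over_def)
qed

text \<open>An entry of least norm among all equivalent matrices divides its row and its column.\<close>

lemma pivot:
  assumes A: "A \<in> carrier_mat m n" and nz: "A \<noteq> 0\<^sub>m m n"
  obtains a C where "a \<noteq> 0" "m \<noteq> 0" "n \<noteq> 0" "C \<in> carrier_mat (m - 1) (n - 1)"
    "eqv A (dsum (mat 1 1 (\<lambda>_. a)) C)"
    "\<And>B i j. eqv A B \<Longrightarrow> i < m \<Longrightarrow> j < n \<Longrightarrow> B $$ (i, j) \<noteq> 0 \<Longrightarrow> N a \<le> N (B $$ (i, j))"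
proof -
  obtain d where d: "d \<in> R" "d \<noteq> 0" "mat_over R (d \<cdot>\<^sub>m A)" using mat_common_denominator by blast
  define S where "S = {B $$ (i, j) | B i j. eqv A B \<and> i < m \<and> j < n \<and> B $$ (i, j) \<noteq> 0}"
  \<comment> \<open>A common denominator \<open>d\<close> of \<open>A\<close> still clears
    \<open>P * A * Q\<close>, so no nonzero entry of an equivalent matrix has norm below
    \<open>- N d\<close>. Shifted by \<open>N d\<close> the norms are natural numbers, and a least
    one exists.\<close>
  have bound: "0 \<le> N x + N d" if "x \<in> S" for x
  proof -
    obtain B i j where B: "eqv A B" "i < m" "j < n" "x = B $$ (i, j)" "x \<noteq> 0" 
      using \<open>x \<in> S\<close> by (auto simp: S_def)
    obtain P Q where PQ: "gl m P" "gl n Q" "B = P * A * Q" using eqvE[OF B(1) A] .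
    have c: "P \<in> carrier_mat m m" "Q \<in> carrier_mat n n" using PQ gl_carrier by auto
    have "d \<cdot>\<^sub>m B = P * (d \<cdot>\<^sub>m A) * Q" unfolding PQ using c A
      by (simp add: mult_smult_assoc_mat[of _ m n _ n] mult_smult_distrib[of _ m m _ n])
    moreover have "mat_over R (P * (d \<cdot>\<^sub>m A) * Q)"
      using PQ(1,2) d(3) A c by (intro mat_over_mult) (auto simp: gl_def)
    ultimately have "mat_over R (d \<cdot>\<^sub>m B)" by simp
    hence "d * x \<in> R" using B eqv_carrier[OF B(1) A] by (auto simp: mat_over_def)
    thus ?thesis using N_nonneg[of "d * x"] N_mult[of d x] B d by simp
  qed
  obtain x0 where "x0 \<in> S"
  proof -
    obtain i j where "i < m" "j < n" "A $$ (i, j) \<noteq> 0" 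
      using nz A by (metis (no_types, lifting) carrier_matD eq_matI index_zero_mat)
    hence "A $$ (i, j) \<in> S" unfolding S_def using eqv_refl[of A] by blast
    thus ?thesis by (rule that)
  qed
  then obtain a where a: "a \<in> S" "\<And>y. y \<in> S \<Longrightarrow> nat (N a + N d) \<le> nat (N y + N d)"
    using ex_has_least_nat[of "\<lambda>x. x \<in> S" x0 "\<lambda>x. nat (N x + N d)"] by blast
  have least: "N a \<le> N y" if "y \<in> S" for y using a(2)[OF that] bound[OF that] bound[OF a(1)] by linarith
  obtain B i j where B: "eqv A B" "i < m" "j < n" "a = B $$ (i, j)" "a \<noteq> 0" using a(1) by (auto simp: S_def)
  have mn: "0 < m" "0 < n" using B by auto
  have Bc: "B \<in> carrier_mat m n" using eqv_carrier[OF B(1) A] .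
  have "\<exists>M. eqv A M \<and> M $$ (0, 0) = a"
  proof -
    define B1 where "B1 = swaprows i 0 B"
    have B1: "eqv A B1" using eqv_trans[OF B(1) eqv_swaprows[of i B 0]] B(2) mn Bc by (auto simp: B1_def)
    have B1c: "B1 \<in> carrier_mat m n" using eqv_carrier[OF B1 A] .
    have B1j: "B1 $$ (0, j) = a" using Bc mn B by (auto simp: B1_def)
    define B2 where "B2 = transpose_mat (swaprows j 0 (B1\<^sup>T))"
    have "eqv (B1\<^sup>T) (swaprows j 0 (B1\<^sup>T))"
      using B1c mn B by (intro eqv_swaprows) auto
    from eqv_transpose[OF this] have "eqv B1 B2" by (simp add: B2_def)
    moreover have "B2 $$ (0, 0) = a" using B1c B1j mn B by (auto simp: B2_def)
    ultimately show ?thesis using eqv_trans[OF B1] by blast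
  qed
  then obtain M where M: "eqv A M" "M $$ (0, 0) = a" by blast
  have Mc: "M \<in> carrier_mat m n" using eqv_carrier[OF M(1) A] .
  \<comment> \<open>Subtracting \<open>q\<close> times row 0 puts the remainder into an equivalent
    matrix. Its norm would be below \<open>N a\<close>, so it is 0.\<close>
  have col0: "M $$ (k, 0) / a \<in> R" if "0 < k" "k < m" for k
  proof -
    obtain q where q: "q \<in> R" "M $$ (k, 0) - q * a = 0 \<or> N (M $$ (k, 0) - q * a) < N a"
      using division[OF B(5)] by blast
    let ?M = "addrow (- q) k 0 M"
    have "eqv A ?M" using eqv_trans[OF M(1) eqv_addrow[of k M 0 "- q"]] that Mc q by auto
    moreover have e: "?M $$ (k, 0) = M $$ (k, 0) - q * a" using that Mc mn M by auto
    ultimately have "M $$ (k, 0) - q * a \<noteq> 0 \<Longrightarrow> M $$ (k, 0) - q * a \<in> S"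
      using that mn by (force simp: S_def)
    hence "M $$ (k, 0) - q * a = 0" using q least by fastforce
    hence "M $$ (k, 0) / a = q" using B by (simp add: field_simps)
    thus ?thesis using q by simp
  qed
  have row0: "M $$ (0, k) / a \<in> R" if "0 < k" "k < n" for k
  proof -
    obtain q where q: "q \<in> R" "M $$ (0, k) - q * a = 0 \<or> N (M $$ (0, k) - q * a) < N a"
      using division[OF B(5)] by blast
    let ?M = "transpose_mat (addrow (- q) k 0 (M\<^sup>T))"
    have "eqv (M\<^sup>T) (addrow (- q) k 0 (M\<^sup>T))"
      using that Mc q by (intro eqv_addrow) auto
    from eqv_transpose[OF this] have "eqv A ?M" using eqv_trans[OF M(1)] by simp
    moreover have e: "?M $$ (0, k) = M $$ (0, k) - q * a" using that Mc mn M by auto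
    ultimately have "M $$ (0, k) - q * a \<noteq> 0 \<Longrightarrow> M $$ (0, k) - q * a \<in> S"
      using that mn by (force simp: S_def)
    hence "M $$ (0, k) - q * a = 0" using q least by fastforce
    hence "M $$ (0, k) / a = q" using B by (simp add: field_simps)
    thus ?thesis using q by simp
  qed
  define a11 where "a11 = mat 1 1 (\<lambda>_. a)"
  define b where "b = mat 1 (n - 1) (\<lambda>(i, j). M $$ (0, Suc j))"
  define c where "c = mat (m - 1) 1 (\<lambda>(i, j). M $$ (Suc i, 0))"
  define D where "D = mat (m - 1) (n - 1) (\<lambda>(i, j). M $$ (Suc i, Suc j))"
  define b' where "b' = (1 / a) \<cdot>\<^sub>m b"
  define c' where "c' = (1 / a) \<cdot>\<^sub>m c"
  have Mb: "M = four_block_mat a11 b c D"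
    using Mc mn M(2) by (intro eq_matI) (auto simp: a11_def b_def c_def D_def)
  have cs: "a11 \<in> carrier_mat 1 1" "b \<in> carrier_mat 1 (n - 1)" "c \<in> carrier_mat (m - 1) 1"
    "D \<in> carrier_mat (m - 1) (n - 1)" "b' \<in> carrier_mat 1 (n - 1)" "c' \<in> carrier_mat (m - 1) 1"
    by (auto simp: a11_def b_def c_def D_def b'_def c'_def)
  have bo: "mat_over R b'" "mat_over R c'" using row0 col0
    by (auto simp: mat_over_def b'_def c'_def b_def c_def)
  let ?P = "four_block_mat (1\<^sub>m 1) (0\<^sub>m 1 (m - 1)) (- c') (1\<^sub>m (m - 1))"
  let ?P' = "four_block_mat (1\<^sub>m 1) (0\<^sub>m 1 (m - 1)) c' (1\<^sub>m (m - 1))"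
  let ?Q = "four_block_mat (1\<^sub>m 1) (- b') (0\<^sub>m (n - 1) 1) (1\<^sub>m (n - 1))"
  let ?Q' = "four_block_mat (1\<^sub>m 1) b' (0\<^sub>m (n - 1) 1) (1\<^sub>m (n - 1))"
  have neg0 [simp]: "- 0\<^sub>m k l = (0\<^sub>m k l :: 'k mat)" for k l by (intro eq_matI) auto
  have uminus_c: "- c' + c' = 0\<^sub>m (m - 1) 1" "c' + - c' = 0\<^sub>m (m - 1) 1"
    "- b' + b' = 0\<^sub>m 1 (n - 1)" "b' + - b' = 0\<^sub>m 1 (n - 1)"
    using cs by (auto intro!: eq_matI)
  have 1: "?P * ?P' = 1\<^sub>m m" "?P' * ?P = 1\<^sub>m m"
    using cs mn uminus_c four_block_one_mat[of 1 "m - 1"]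
    by (subst mult_four_block_mat[of _ 1 1 _ "m - 1" _ "m - 1" _ _ 1 _ "m - 1"]; simp)+
  have 2: "?Q * ?Q' = 1\<^sub>m n" "?Q' * ?Q = 1\<^sub>m n"
    using cs mn uminus_c four_block_one_mat[of 1 "n - 1"]
    by (subst mult_four_block_mat[of _ 1 1 _ "n - 1" _ "n - 1" _ _ 1 _ "n - 1"]; simp)+
  have glP: "gl m ?P" unfolding gl_def
  proof (intro conjI bexI[of _ ?P'])
    show "?P * ?P' = 1\<^sub>m m" "?P' * ?P = 1\<^sub>m m" by fact+
    show "?P \<in> carrier_mat m m" "?P' \<in> carrier_mat m m" using mn by (auto intro!: carrier_matI)
    show "mat_over R ?P" "mat_over R ?P'" using bo cs mn by (auto simp: mat_over_def)
  qed
  have glQ: "gl n ?Q" unfolding gl_def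
  proof (intro conjI bexI[of _ ?Q'])
    show "?Q * ?Q' = 1\<^sub>m n" "?Q' * ?Q = 1\<^sub>m n" by fact+
    show "?Q \<in> carrier_mat n n" "?Q' \<in> carrier_mat n n" using mn by (auto intro!: carrier_matI)
    show "mat_over R ?Q" "mat_over R ?Q'" using bo cs mn by (auto simp: mat_over_def)
  qed
  have ac: "c' * a11 = c" using \<open>a \<noteq> 0\<close> cs
    by (intro eq_matI) (auto simp: a11_def c'_def c_def scalar_prod_def)
  have ab: "a11 * b' = b" using \<open>a \<noteq> 0\<close> cs
    by (intro eq_matI) (auto simp: a11_def b'_def b_def scalar_prod_def)
  \<comment> \<open>The Schur complement that remains after \<open>?P\<close> and \<open>?Q\<close>
    clear the first column and row. Both have their off-diagonal blocks over \<open>R\<close> by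
    \<open>col0\<close> and \<open>row0\<close>.\<close>
  define C where "C = D - c' * b"
  have Cc: "C \<in> carrier_mat (m - 1) (n - 1)" using cs by (auto simp: C_def)
  have "?P * M = four_block_mat a11 b (- c' * a11 + c) (- c' * b + D)"
    unfolding Mb using cs
    by (subst mult_four_block_mat[of _ 1 1 _ "m - 1" _ "m - 1" _ _ 1 _ "n - 1"]) auto
  also have "- c' * a11 + c = 0\<^sub>m (m - 1) 1" using cs ac by (auto intro!: eq_matI)
  also have "- c' * b + D = C" unfolding C_def using cs by (intro eq_matI) auto
  finally have "?P * M * ?Q = four_block_mat a11 (a11 * (- b') + b) (0\<^sub>m (m - 1) 1) C"
    using cs Cc by (simp only:, subst mult_four_block_mat[of _ 1 1 _ "n - 1" _ "m - 1" _ _ 1 _ "n - 1"]) auto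
  also have "a11 * (- b') + b = 0\<^sub>m 1 (n - 1)" using cs ab by (auto intro!: eq_matI)
  finally have "?P * M * ?Q = dsum a11 C" using cs Cc by (simp add: dsum_def)
  hence "eqv M (dsum a11 C)" using Mc glP glQ by (intro eqvI[of M m n ?P ?Q]) auto
  hence "eqv A (dsum a11 C)" using eqv_trans M by blast
  moreover have "N a \<le> N (B $$ (i, j))" if "eqv A B" "i < m" "j < n" "B $$ (i, j) \<noteq> 0" for B i j
    using that by (intro least) (auto simp: S_def)
  ultimately show ?thesis using that[of a C] mn B(5) Cc by (auto simp: a11_def)
qed

text \<open>Induction on the number of rows: split off a pivot, compress the rest, and swap the
  pivot behind the core. Only the determinant of the core will matter, so it stays an arbitrary
  nonsingular matrix and is not diagonalized.\<close>

lemma compression: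
  assumes "A \<in> carrier_mat m n"
  obtains r C where "r \<le> m" "r \<le> n" "C \<in> carrier_mat r r" "det C \<noteq> 0" "eqv A (dsum (0\<^sub>m (m - r) (n - r)) C)"
proof -
  have "\<exists>r C. r \<le> m \<and> r \<le> n \<and> C \<in> carrier_mat r r \<and> det C \<noteq> 0 \<and> eqv A (dsum (0\<^sub>m (m - r) (n - r)) C)"
    using assms
  proof (induction m arbitrary: n A)
    case (0 n A)
    have "A = dsum (0\<^sub>m 0 n) (1\<^sub>m 0)" using 0 by (intro eq_matI) auto
    thus ?case by (intro exI[of _ 0] exI[of _ "1\<^sub>m 0"]) auto
  next
    case (Suc m n A)
    show ?case
    proof (cases "A = 0\<^sub>m (Suc m) n")
      case True
      \<comment> \<open>A zero matrix has the empty core, whose determinant is 1.\<close>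
      hence "A = dsum (0\<^sub>m (Suc m) n) (1\<^sub>m 0)" by (intro eq_matI) (auto simp: dsum_index)
      thus ?thesis by (intro exI[of _ 0] exI[of _ "1\<^sub>m 0"]) auto
    next
      case False
      obtain a C where a: "a \<noteq> 0" "n \<noteq> 0" "C \<in> carrier_mat m (n - 1)" "eqv A (dsum (mat 1 1 (\<lambda>_. a)) C)"
        using pivot[OF Suc.prems False] by (metis diff_Suc_1)
      obtain r C' where r: "r \<le> m" "r \<le> n - 1" "C' \<in> carrier_mat r r" "det C' \<noteq> 0" 
          "eqv C (dsum (0\<^sub>m (m - r) (n - 1 - r)) C')"
        using Suc.IH[OF a(3)] by blast
      have "eqv A (dsum (dsum (0\<^sub>m (m - r) (n - 1 - r)) C') (mat 1 1 (\<lambda>_. a)))"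
        by (rule eqv_trans[OF eqv_trans[OF a(4) eqv_dsum_swap] eqv_dsum[OF r(5) eqv_refl]])
      hence "eqv A (dsum (0\<^sub>m (m - r) (n - 1 - r)) (dsum C' (mat 1 1 (\<lambda>_. a))))"
        by (simp add: dsum_assoc)
      moreover have "det (dsum C' (mat 1 1 (\<lambda>_. a))) \<noteq> 0"
        using r a by (subst dsum_det[OF r(3)]) (auto simp: det_single)
      moreover have "dsum C' (mat 1 1 (\<lambda>_. a)) \<in> carrier_mat (Suc r) (Suc r)"
        using dsum_carrier[OF r(3), of "mat 1 1 (\<lambda>_. a)" 1 1] by simp
      ultimately show ?thesis using r a
        by (intro exI[of _ "Suc r"] exI[of _ "dsum C' (mat 1 1 (\<lambda>_. a))"]) auto
    qed
  qed
  thus ?thesis using that by metis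
qed

declare add_in [rule del] uminus_in [rule del] mult_in [rule del] sum_in [rule del] prod_in [rule del]
  mat_over_mult [rule del] mat_over_add [rule del] mat_over_transpose [rule del]

end

section \<open>Degree of rational functions\<close>

interpretation to_fract_hom: inj_idom_hom "to_fract :: 'a::idom \<Rightarrow> 'a fract"
  by unfold_locales auto

text \<open>Minus the valuation at infinity. The value at 0 is unspecified, which is why degree
  bounds carry the alternative \<open>x = 0\<close>.\<close>

definition rdeg :: "'a::field poly fract \<Rightarrow> int" where
  "rdeg x = (SOME z. \<exists>a b. a \<noteq> 0 \<and> b \<noteq> 0 \<and> x = Fract a b \<and> z = int (degree a) - int (degree b))"

lemma rdeg_Fract:
  assumes "a \<noteq> 0" "b \<noteq> 0"
  shows "rdeg (Fract a b) = int (degree a) - int (degree b)"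
  unfolding rdeg_def
proof (rule some_equality)
  fix z assume "\<exists>a' b'. a' \<noteq> 0 \<and> b' \<noteq> 0 \<and> Fract a b = Fract a' b' \<and> z = int (degree a') - int (degree b')"
  then obtain a' b' where ab: "a' \<noteq> 0" "b' \<noteq> 0" "a * b' = a' * b" "z = int (degree a') - int (degree b')"
    using assms by (auto simp: eq_fract)
  have "degree a + degree b' = degree a' + degree b"
    using arg_cong[OF ab(3), of degree] ab(1,2) assms by (simp add: degree_mult_eq)
  thus "z = int (degree a) - int (degree b)" using ab(4) by linarith
qed (use assms in blast)

lemma fract_nonzero_cases:
  assumes "x \<noteq> 0"
  obtains a b where "x = Fract a b" "a \<noteq> 0" "b \<noteq> 0"
  using assms by (cases x rule: Fract_cases_nonzero) auto

lemma Fract_eq_0_iff: "b \<noteq> 0 \<Longrightarrow> Fract a b = 0 \<longleftrightarrow> a = 0"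
  by (simp add: Zero_fract_def eq_fract)

lemma rdeg_mult:
  assumes "x \<noteq> 0" "y \<noteq> 0"
  shows "rdeg (x * y) = rdeg x + rdeg y"
  using assms by (elim fract_nonzero_cases) (simp add: rdeg_Fract degree_mult_eq)

lemma rdeg_to_fract: "a \<noteq> 0 \<Longrightarrow> rdeg (to_fract a) = int (degree a)"
  by (simp add: to_fract_def rdeg_Fract)

lemma rdeg_1 [simp]: "rdeg 1 = 0"
  using rdeg_mult[of "1 :: 'a poly fract" 1] by simp

lemma rdeg_inverse: "x \<noteq> 0 \<Longrightarrow> rdeg (inverse x) = - rdeg x"
  using rdeg_mult[of x "inverse x"] by simp

lemma rdeg_uminus [simp]: "rdeg (- x) = rdeg x"
proof (cases "x = 0")
  case False
  thus ?thesis by (elim fract_nonzero_cases) (simp add: rdeg_Fract)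
qed simp

lemma rdeg_prod: "(\<And>i. i \<in> I \<Longrightarrow> f i \<noteq> 0) \<Longrightarrow> rdeg (prod f I) = (\<Sum>i\<in>I. rdeg (f i))"
  by (induction I rule: infinite_finite_induct) (auto simp: rdeg_mult)

lemma lam_nonzero [simp]: "lam \<noteq> (0 :: 'a::field poly fract)"
  by (simp add: lam_def)

lemma rdeg_lam_powi [simp]: "rdeg (lam powi k :: 'a::field poly fract) = k"
proof -
  have l: "rdeg (lam :: 'a poly fract) = 1" by (simp add: lam_def rdeg_to_fract)
  have p: "rdeg (lam ^ n :: 'a poly fract) = int n" for n
    by (induction n) (auto simp: rdeg_mult l)
  show ?thesis
  proof (cases "k \<ge> 0")
    case True thus ?thesis using p[of "nat k"] by (simp add: power_int_def)
  next
    case False thus ?thesis using p[of "nat (- k)"] rdeg_inverse[of "(lam :: 'a poly fract) ^ nat (- k)"]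
      by (simp add: power_int_def flip: power_inverse)
  qed
qed

lemma proper_iff: "proper_rf x \<longleftrightarrow> x = 0 \<or> rdeg x \<le> 0"
proof
  assume "proper_rf x"
  then obtain a b where "b \<noteq> 0" "x = Fract a b" "degree a \<le> degree b" unfolding proper_rf_def by blast
  thus "x = 0 \<or> rdeg x \<le> 0" by (cases "a = 0") (auto simp: rdeg_Fract Fract_eq_0_iff)
next
  assume *: "x = 0 \<or> rdeg x \<le> 0"
  show "proper_rf x"
  proof (cases "x = 0")
    case True thus ?thesis unfolding proper_rf_def by (intro exI[of _ 0] exI[of _ 1]) (simp add: Zero_fract_def)
  next
    case False
    then obtain a b where "x = Fract a b" "a \<noteq> 0" "b \<noteq> 0" by (elim fract_nonzero_cases)
    thus ?thesis using * False unfolding proper_rf_def by (auto simp: rdeg_Fract)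
  qed
qed

lemma strictly_proper_iff: "strictly_proper_rf x \<longleftrightarrow> x = 0 \<or> rdeg x < 0"
proof
  assume "strictly_proper_rf x"
  then consider "x = 0" | a b where "b \<noteq> 0" "x = Fract a b" "degree a < degree b"
    unfolding strictly_proper_rf_def by blast
  thus "x = 0 \<or> rdeg x < 0"
  proof cases
    case 2 thus ?thesis by (cases "a = 0") (auto simp: rdeg_Fract Fract_eq_0_iff)
  qed simp
next
  assume *: "x = 0 \<or> rdeg x < 0"
  show "strictly_proper_rf x"
  proof (cases "x = 0")
    case False
    then obtain a b where "x = Fract a b" "a \<noteq> 0" "b \<noteq> 0" by (elim fract_nonzero_cases)
    thus ?thesis using * False unfolding strictly_proper_rf_def by (auto simp: rdeg_Fract)
  qed (simp add: strictly_proper_rf_def)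
qed

lemma rdeg_add_le:
  assumes "x = 0 \<or> rdeg x \<le> k" "y = 0 \<or> rdeg y \<le> k"
  shows "x + y = 0 \<or> rdeg (x + y) \<le> k"
proof (cases "x = 0 \<or> y = 0 \<or> x + y = 0")
  case False
  then obtain a b c d where ab: "x = Fract a b" "a \<noteq> 0" "b \<noteq> 0" and cd: "y = Fract c d" "c \<noteq> 0" "d \<noteq> 0"
    by (metis fract_nonzero_cases)
  have s: "x + y = Fract (a * d + c * b) (b * d)" using ab cd by simp
  have nz: "a * d + c * b \<noteq> 0" using False s ab cd by (metis Fract_eq_0_iff mult_eq_0_iff)
  have 1: "int (degree (a * d)) \<le> k + int (degree (b * d))" "int (degree (c * b)) \<le> k + int (degree (b * d))"
    using assms False ab cd by (auto simp: rdeg_Fract degree_mult_eq)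
  have "degree (a * d + c * b) \<le> max (degree (a * d)) (degree (c * b))" by (rule degree_add_le_max)
  thus ?thesis unfolding s using nz ab cd 1 by (auto simp: rdeg_Fract)
qed (use assms in auto)

lemma strictly_proper_add: "strictly_proper_rf x \<Longrightarrow> strictly_proper_rf y \<Longrightarrow> strictly_proper_rf (x + y)"
  using rdeg_add_le[of x "-1" y] by (force simp: strictly_proper_iff)

lemma strictly_proper_uminus: "strictly_proper_rf x \<Longrightarrow> strictly_proper_rf (- x)"
  by (auto simp: strictly_proper_iff)

lemma strictly_proper_mult: "proper_rf x \<Longrightarrow> strictly_proper_rf y \<Longrightarrow> strictly_proper_rf (x * y)"
  by (cases "x = 0 \<or> y = 0") (auto simp: strictly_proper_iff proper_iff rdeg_mult)

lemma strictly_proper_imp_proper: "strictly_proper_rf x \<Longrightarrow> proper_rf x"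
  by (auto simp: strictly_proper_iff proper_iff)

lemma strictly_proper_0 [simp]: "strictly_proper_rf 0"
  by (simp add: strictly_proper_iff)

lemma strictly_proper_to_fract_iff: "strictly_proper_rf (to_fract q) \<longleftrightarrow> q = 0"
  by (cases "q = 0") (auto simp: strictly_proper_iff rdeg_to_fract)

text \<open>Division with remainder: \<open>a div b\<close> is the polynomial part of
  \<open>Fract a b\<close>, and \<open>Fract (a mod b) b\<close> is strictly proper.\<close>

lemma poly_part_exists: "\<exists>q. strictly_proper_rf (x - to_fract q)"
proof (cases x rule: Fract_cases_nonzero)
  case 0 thus ?thesis by (intro exI[of _ 0]) simp
next
  case (Fract a b)
  have "x - to_fract (a div b) = Fract (a - b * (a div b)) b"
    using Fract by (simp add: to_fract_def mult.commute)
  also have "a - b * (a div b) = a mod b" by (simp add: minus_mult_div_eq_mod)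
  finally have *: "x - to_fract (a div b) = Fract (a mod b) b" .
  show ?thesis
  proof (cases "a mod b = 0")
    case True
    hence "x - to_fract (a div b) = 0" using * Fract by (simp add: Fract_eq_0_iff)
    thus ?thesis by (metis strictly_proper_0)
  next
    case False
    hence "degree (a mod b) < degree b" using degree_mod_less[of b a] Fract by auto
    thus ?thesis using * Fract(3) unfolding strictly_proper_rf_def by (metis Fract(2))
  qed
qed

section \<open>Polynomials and proper functions as Euclidean subrings\<close>

interpretation pol: euclidean_subring "range (to_fract :: 'a::field poly \<Rightarrow> 'a poly fract)" rdeg
proof
  fix x y :: "'a poly fract"
  show "0 \<in> range (to_fract :: 'a poly \<Rightarrow> _)" "1 \<in> range (to_fract :: 'a poly \<Rightarrow> _)"
    using rangeI[of to_fract "0 :: 'a poly"] rangeI[of to_fract "1 :: 'a poly"] by simp_all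
  assume "x \<in> range to_fract" "y \<in> range to_fract"
  thus "x + y \<in> range to_fract" "x * y \<in> range to_fract"
    by (auto simp flip: to_fract_add to_fract_mult)
next
  fix x :: "'a poly fract" assume "x \<in> range to_fract"
  thus "- x \<in> range to_fract" by (auto simp flip: to_fract_uminus)
next
  fix x y :: "'a poly fract" assume "x \<noteq> 0" "y \<noteq> 0"
  thus "rdeg (x * y) = rdeg x + rdeg y" by (rule rdeg_mult)
next
  fix x :: "'a poly fract" assume "x \<in> range to_fract" "x \<noteq> 0"
  then obtain q where "x = to_fract q" "q \<noteq> 0" by auto
  thus "0 \<le> rdeg x" by (simp add: rdeg_to_fract)
next
  fix a b :: "'a poly fract" assume b: "b \<noteq> 0"
  \<comment> \<open>The quotient is the polynomial part of \<open>a / b\<close>; the remainder is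
    \<open>b\<close> times a strictly proper function and has smaller degree.\<close>
  obtain q where q: "strictly_proper_rf (a / b - to_fract q)" using poly_part_exists by blast
  have e: "a - to_fract q * b = (a / b - to_fract q) * b" using b by (simp add: algebra_simps)
  have "a - to_fract q * b = 0 \<or> rdeg (a - to_fract q * b) < rdeg b"
    using q b rdeg_mult[of "a / b - to_fract q" b] unfolding e strictly_proper_iff
    by (cases "a / b - to_fract q = 0") simp_all
  thus "\<exists>q\<in>range to_fract. a - q * b = 0 \<or> rdeg (a - q * b) < rdeg b" by blast
next
  fix x :: "'a poly fract"
  show "\<exists>d\<in>range to_fract. d \<noteq> 0 \<and> d * x \<in> range to_fract"
  proof (cases x)
    case (Fract a b)
    hence "to_fract b * x = to_fract a" by (simp add: to_fract_def eq_fract)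
    thus ?thesis using Fract by (intro bexI[of _ "to_fract b"]) auto
  qed
qed

text \<open>A valuation ring: the quotient is either 0 or \<open>a / b\<close> itself. The norm is
  the order of vanishing at infinity, hence the minus sign.\<close>

interpretation prp: euclidean_subring "{x :: 'a::field poly fract. proper_rf x}" "\<lambda>x. - rdeg x"
proof
  fix x y :: "'a poly fract"
  show "0 \<in> {x :: 'a poly fract. proper_rf x}" "1 \<in> {x :: 'a poly fract. proper_rf x}"
    by (simp_all add: proper_iff)
  assume "x \<in> {x. proper_rf x}" "y \<in> {x. proper_rf x}"
  thus "x + y \<in> {x. proper_rf x}" "x * y \<in> {x. proper_rf x}"
    using rdeg_add_le[of x 0 y] by (cases "x = 0 \<or> y = 0"; auto simp: proper_iff rdeg_mult)+
next
  fix x :: "'a poly fract" assume "x \<in> {x. proper_rf x}"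
  thus "- x \<in> {x. proper_rf x}" by (simp add: proper_iff)
next
  fix x y :: "'a poly fract" assume "x \<noteq> 0" "y \<noteq> 0"
  thus "- rdeg (x * y) = - rdeg x + - rdeg y" by (simp add: rdeg_mult)
next
  fix x :: "'a poly fract" assume "x \<in> {x. proper_rf x}" "x \<noteq> 0"
  thus "0 \<le> - rdeg x" by (auto simp: proper_iff)
next
  fix a b :: "'a poly fract" assume b: "b \<noteq> 0"
  show "\<exists>q\<in>{x. proper_rf x}. a - q * b = 0 \<or> - rdeg (a - q * b) < - rdeg b"
  proof (cases "a \<noteq> 0 \<and> rdeg b < rdeg a")
    case True
    thus ?thesis by (intro bexI[of _ 0]) (auto simp: proper_iff)
  next
    case False
    have "proper_rf (a / b)" using False b by (cases "a = 0") (auto simp: proper_iff divide_inverse rdeg_mult rdeg_inverse)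
    thus ?thesis using b by (intro bexI[of _ "a / b"]) auto
  qed
next
  fix x :: "'a poly fract"
  show "\<exists>d\<in>{x. proper_rf x}. d \<noteq> 0 \<and> d * x \<in> {x. proper_rf x}"
  proof (cases "x = 0 \<or> rdeg x \<le> 0")
    case True thus ?thesis by (intro bexI[of _ 1]) (auto simp: proper_iff)
  next
    case False thus ?thesis by (intro bexI[of _ "inverse x"]) (auto simp: proper_iff rdeg_inverse)
  qed
qed

lemma unimodular_iff: "U \<in> carrier_mat k k \<Longrightarrow> unimodular U \<longleftrightarrow> pol.gl k U"
proof
  assume "U \<in> carrier_mat k k" "unimodular U"
  thus "pol.gl k U" unfolding unimodular_def pol.gl_def mat_over_def by (metis carrier_matD)
next
  assume "U \<in> carrier_mat k k" "pol.gl k U"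
  thus "unimodular U" unfolding unimodular_def pol.gl_def mat_over_def by (metis carrier_matD)
qed

lemma biproper_iff: "U \<in> carrier_mat k k \<Longrightarrow> biproper U \<longleftrightarrow> prp.gl k U"
proof
  assume "U \<in> carrier_mat k k" "biproper U"
  thus "prp.gl k U" unfolding biproper_def prp.gl_def mat_over_def by (metis carrier_matD mem_Collect_eq)
next
  assume "U \<in> carrier_mat k k" "prp.gl k U"
  thus "biproper U" unfolding biproper_def prp.gl_def mat_over_def by (metis carrier_matD mem_Collect_eq)
qed

section \<open>Values of proper functions and matrices at infinity\<close>

definition at_inf :: "'a::field poly fract \<Rightarrow> 'a \<Rightarrow> bool" where
  "at_inf x c \<longleftrightarrow> strictly_proper_rf (x - to_fract [:c:])"

lemma proper_const [simp]: "proper_rf (to_fract [:c:])"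
  by (cases "c = 0") (auto simp: proper_iff rdeg_to_fract)

lemma at_inf_proper: "at_inf x c \<Longrightarrow> proper_rf x"
  unfolding at_inf_def using prp.add_in[of "x - to_fract [:c:]" "to_fract [:c:]"] strictly_proper_imp_proper by force

text \<open>The polynomial part of a proper function is itself proper, hence constant.\<close>

lemma at_inf_exists:
  assumes "proper_rf x"
  shows "\<exists>c. at_inf x c"
proof -
  obtain q where q: "strictly_proper_rf (x - to_fract q)" using poly_part_exists by blast
  have "proper_rf (x + - (x - to_fract q))"
    using prp.add_in[of x "- (x - to_fract q)"] assms prp.uminus_in strictly_proper_imp_proper[OF q] by blast
  hence "degree q = 0" by (cases "q = 0") (auto simp: proper_iff rdeg_to_fract)
  then obtain c where "q = [:c:]" by (metis degree_eq_zeroE)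
  thus ?thesis using q unfolding at_inf_def by blast
qed

lemma at_inf_0_iff [simp]: "at_inf x 0 \<longleftrightarrow> strictly_proper_rf x"
  by (simp add: at_inf_def)

lemma at_inf_const [simp]: "at_inf (to_fract [:c:]) c"
  by (simp add: at_inf_def)

lemma at_inf_unique:
  assumes "at_inf x c" "at_inf x d"
  shows "c = d"
proof -
  have "strictly_proper_rf ((x - to_fract [:c:]) + - (x - to_fract [:d:]))"
    using assms strictly_proper_add strictly_proper_uminus unfolding at_inf_def by blast
  also have "(x - to_fract [:c:]) + - (x - to_fract [:d:]) = to_fract [:d - c:]"
    by (simp flip: to_fract_diff)
  finally show ?thesis by (simp add: strictly_proper_to_fract_iff)
qed

lemma at_inf_add: "at_inf x c \<Longrightarrow> at_inf y d \<Longrightarrow> at_inf (x + y) (c + d)"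
  using strictly_proper_add[of "x - to_fract [:c:]" "y - to_fract [:d:]"]
  unfolding at_inf_def by (simp add: algebra_simps flip: to_fract_add)

lemma at_inf_mult:
  assumes "at_inf x c" "at_inf y d"
  shows "at_inf (x * y) (c * d)"
proof -
  have "x * y - to_fract [:c * d:] = y * (x - to_fract [:c:]) + to_fract [:c:] * (y - to_fract [:d:])"
    by (simp add: algebra_simps flip: to_fract_mult)
  thus ?thesis unfolding at_inf_def
    using assms at_inf_proper strictly_proper_add strictly_proper_mult proper_const
    by (metis at_inf_def)
qed

lemma at_inf_0: "at_inf 0 0" and at_inf_1: "at_inf 1 1"
  using at_inf_const[of 1] by (simp_all flip: one_pCons)

lemma at_inf_sum: "(\<And>i. i \<in> I \<Longrightarrow> at_inf (f i) (g i)) \<Longrightarrow> at_inf (sum f I) (sum g I)"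
  by (induction I rule: infinite_finite_induct) (simp_all add: at_inf_add del: at_inf_0_iff, simp_all)

lemma at_inf_prod: "(\<And>i. i \<in> I \<Longrightarrow> at_inf (f i) (g i)) \<Longrightarrow> at_inf (prod f I) (prod g I)"
  by (induction I rule: infinite_finite_induct) (auto intro: at_inf_mult at_inf_1)

definition mat_at_inf :: "'a::field poly fract mat \<Rightarrow> 'a mat \<Rightarrow> bool" where
  "mat_at_inf X C \<longleftrightarrow> dim_row X = dim_row C \<and> dim_col X = dim_col C \<and>
     (\<forall>i < dim_row C. \<forall>j < dim_col C. at_inf (X $$ (i, j)) (C $$ (i, j)))"

lemma mat_at_inf_mult:
  assumes "mat_at_inf X C" "mat_at_inf Y D" "dim_col C = dim_row D"
  shows "mat_at_inf (X * Y) (C * D)"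
  using assms unfolding mat_at_inf_def by (auto simp: scalar_prod_def intro!: at_inf_sum at_inf_mult)

lemma mat_at_inf_add:
  assumes "mat_at_inf X C" "mat_at_inf Y D" "dim_row C = dim_row D" "dim_col C = dim_col D"
  shows "mat_at_inf (X + Y) (C + D)"
  using assms unfolding mat_at_inf_def by (auto intro!: at_inf_add)

text \<open>Evaluation at infinity respects sums and products, hence the Leibniz formula. So the
  determinant of a proper matrix is strictly proper exactly if its value at infinity is
  singular.\<close>

lemma det_at_inf:
  assumes "mat_at_inf X C" "X \<in> carrier_mat n n"
  shows "at_inf (det X) (det C)"
proof -
  have C: "C \<in> carrier_mat n n" using assms by (auto simp: mat_at_inf_def)
  have "at_inf (signof p) (signof p :: 'a)" for p
  proof (cases p rule: sign_cases)
    case odd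
    have "at_inf (to_fract [:-1:]) (-1 :: 'a)" by (rule at_inf_const)
    moreover have "to_fract [:-1:] = (-1 :: 'a poly fract)"
      by (metis one_pCons minus_pCons pCons_0_0 to_fract_1 to_fract_uminus minus_zero)
    ultimately have "at_inf (-1) (-1 :: 'a)" by metis
    thus ?thesis using odd by simp
  qed (simp add: at_inf_1)
  moreover have "at_inf (\<Prod>i = 0..<n. X $$ (i, p i)) (\<Prod>i = 0..<n. C $$ (i, p i))" 
    if "p permutes {0..<n}" for p
  proof (rule at_inf_prod)
    fix i assume i: "i \<in> {0..<n}"
    hence "p i \<in> {0..<n}" using that by (simp add: permutes_in_image)
    thus "at_inf (X $$ (i, p i)) (C $$ (i, p i))" using assms C i by (auto simp: mat_at_inf_def)
  qed
  ultimately show ?thesis unfolding det_def'[OF assms(2)] det_def'[OF C]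
    by (auto intro!: at_inf_sum at_inf_mult)
qed

section \<open>Polynomial bases of null spaces\<close>

lemma mat_over_to_fractD:
  assumes "mat_over (range to_fract) X" "X \<in> carrier_mat m n"
  obtains Xp where "Xp \<in> carrier_mat m n" "X = map_mat to_fract Xp"
proof -
  have "\<exists>q. X $$ (i, j) = to_fract q" if "i < m" "j < n" for i j
    using assms that by (auto simp: mat_over_def)
  then obtain q where q: "\<And>i j. i < m \<Longrightarrow> j < n \<Longrightarrow> X $$ (i, j) = to_fract (q i j)" by metis
  show ?thesis
    by (rule that[of "mat m n (\<lambda>(i, j). q i j)"]) (use assms q in \<open>auto intro!: eq_matI\<close>)
qed

lemma mat_over_map_to_fract [simp]: "mat_over (range to_fract) (map_mat to_fract X)"
  by (auto simp: mat_over_def)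

lemma poly_vec_degree_le_iff:
  "poly_vec_degree v \<le> k \<longleftrightarrow> (\<forall>i < dim_vec v. degree (v $ i) \<le> k)"
  unfolding poly_vec_degree_def by (subst Max_le_iff) auto

lemma degree_le_poly_vec_degree: "i < dim_vec v \<Longrightarrow> degree (v $ i) \<le> poly_vec_degree v"
  using poly_vec_degree_le_iff by blast

lemma poly_vec_degree_less:
  assumes "0 < k" "\<And>i. i < dim_vec v \<Longrightarrow> degree (v $ i) < k"
  shows "poly_vec_degree v < k"
proof -
  have "poly_vec_degree v \<le> k - 1" unfolding poly_vec_degree_le_iff using assms(2) by fastforce
  thus ?thesis using assms(1) by simp
qed

text \<open>If \<open>k < l\<close>, padding \<open>X\<close> with zero rows gives a singular square
  matrix, and a null vector of it is one of \<open>X\<close>.\<close>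

lemma injective_imp_dim_le:
  fixes X :: "'b::field mat"
  assumes X: "X \<in> carrier_mat k l" and inj: "\<And>c. c \<in> carrier_vec l \<Longrightarrow> X *\<^sub>v c = 0\<^sub>v k \<Longrightarrow> c = 0\<^sub>v l"
  shows "l \<le> k"
proof (rule ccontr)
  assume "\<not> l \<le> k"
  hence kl: "k < l" by simp
  define X' where "X' = mat l l (\<lambda>(i, j). if i < k then X $$ (i, j) else 0)"
  have X': "X' \<in> carrier_mat l l" by (simp add: X'_def)
  have "X'\<^sup>T *\<^sub>v unit_vec l k = 0\<^sub>v l"
    using kl by (intro eq_vecI) (auto simp: X'_def)
  moreover have "unit_vec l k \<noteq> (0\<^sub>v l :: 'b vec)" using kl by simp
  ultimately have "det (X'\<^sup>T) = 0"
    using det_0_iff_vec_prod_zero[of "X'\<^sup>T" l] X' by (metis transpose_carrier_mat unit_vec_carrier)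
  hence "det X' = 0" using det_transpose[OF X'] by simp
  then obtain v where v: "v \<in> carrier_vec l" "v \<noteq> 0\<^sub>v l" "X' *\<^sub>v v = 0\<^sub>v l"
    using det_0_iff_vec_prod_zero[OF X'] by blast
  have "X *\<^sub>v v = 0\<^sub>v k"
  proof (intro eq_vecI)
    fix i assume "i < dim_vec (0\<^sub>v k :: 'b vec)"
    hence i: "i < k" by simp
    have "row X' i = row X i" using i kl X by (intro eq_vecI) (auto simp: X'_def)
    moreover have "(X' *\<^sub>v v) $ i = 0" using v i kl by simp
    ultimately show "(X *\<^sub>v v) $ i = 0\<^sub>v k $ i" using i kl X X' by simp
  qed (use X in simp)
  thus False using inj v by blast
qed

lemma col_mult_mat_vec: "dim_col A = dim_row B \<Longrightarrow> j < dim_col B \<Longrightarrow> col (A * B) j = A *\<^sub>v col B j"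
  by (rule col_mult2[of A "dim_row A" "dim_col A" B "dim_col B"]) auto

lemma mat_eqI_cols:
  assumes "A \<in> carrier_mat m n" "B \<in> carrier_mat m n" "\<And>j. j < n \<Longrightarrow> col A j = col B j"
  shows "A = B"
  using assms by (intro mat_col_eqI) auto

lemma lincomb_rf_eq:
  assumes "set fs \<subseteq> carrier_vec n"
  shows "lincomb_rf n c fs = mat_of_cols n fs *\<^sub>v vec (length fs) c"
proof (rule eq_vecI)
  fix j assume "j < dim_vec (mat_of_cols n fs *\<^sub>v vec (length fs) c)"
  hence j: "j < n" by simp
  thus "lincomb_rf n c fs $ j = (mat_of_cols n fs *\<^sub>v vec (length fs) c) $ j"
    using assms by (auto simp: lincomb_rf_def scalar_prod_def mat_of_cols_index mult.commute atLeast0LessThan intro!: sum.cong)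
qed (simp add: lincomb_rf_def)

definition basis_mat :: "nat \<Rightarrow> 'a::field poly vec list \<Rightarrow> 'a poly fract mat" where
  "basis_mat n bs = mat_of_cols n (map (map_vec to_fract) bs)"

lemma basis_mat_carrier [simp]: "basis_mat n bs \<in> carrier_mat n (length bs)"
  unfolding basis_mat_def by (metis length_map mat_of_cols_carrier(1))

lemma basis_mat_dim [simp]: "dim_row (basis_mat n bs) = n" "dim_col (basis_mat n bs) = length bs"
  by (simp_all add: basis_mat_def)

lemma basis_mat_index:
  assumes "i < n" "j < length bs" "bs ! j \<in> carrier_vec n"
  shows "basis_mat n bs $$ (i, j) = to_fract (bs ! j $ i)"
  using assms by (simp add: basis_mat_def mat_of_cols_index)

lemma basis_mat_cols: "X \<in> carrier_mat n k \<Longrightarrow> basis_mat n (cols X) = map_mat to_fract X"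
  by (intro eq_matI) (auto simp: basis_mat_def mat_of_cols_index)

text \<open>Replaces linear combinations of a list by products with the matrix of its columns, so
  that bases can be compared by matrix algebra.\<close>

lemma is_poly_basis_right_iff:
  assumes H: "H \<in> carrier_mat m n"
  shows "is_poly_basis_right H bs \<longleftrightarrow> set bs \<subseteq> carrier_vec n \<and> H * basis_mat n bs = 0\<^sub>m m (length bs) \<and>
     (\<forall>c \<in> carrier_vec (length bs). basis_mat n bs *\<^sub>v c = 0\<^sub>v n \<longrightarrow> c = 0\<^sub>v (length bs)) \<and>
     (\<forall>x \<in> carrier_vec n. H *\<^sub>v x = 0\<^sub>v m \<longrightarrow> (\<exists>c \<in> carrier_vec (length bs). x = basis_mat n bs *\<^sub>v c))"
proof (cases "set bs \<subseteq> carrier_vec n")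
  case True
  define fs where "fs = map (map_vec to_fract) bs"
  have fs: "set fs \<subseteq> carrier_vec n" "length fs = length bs" using True by (auto simp: fs_def)
  have B: "basis_mat n bs = mat_of_cols n fs" by (simp add: basis_mat_def fs_def)
  have lc: "lincomb_rf n c fs = basis_mat n bs *\<^sub>v vec (length bs) c" for c
    using lincomb_rf_eq[OF fs(1)] fs(2) B by simp
  have 1: "set fs \<subseteq> right_null H \<longleftrightarrow> H * basis_mat n bs = 0\<^sub>m m (length bs)" (is "?l = ?r")
  proof
    assume l: ?l
    show ?r
    proof (rule mat_eqI_cols[of _ m "length bs"])
      fix j assume j: "j < length bs"
      have "fs ! j \<in> right_null H" using l j fs by (simp add: subset_iff)
      thus "col (H * basis_mat n bs) j = col (0\<^sub>m m (length bs)) j"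
        using H j fs by (simp add: right_null_def B col_mult_mat_vec[of H "mat_of_cols n fs"] del: col_mult)
    qed (use H basis_mat_carrier[of n bs] in auto)
  next
    assume r: ?r
    have "fs ! j \<in> right_null H" if "j < length fs" for j
    proof -
      have "H *\<^sub>v col (basis_mat n bs) j = col (H * basis_mat n bs) j"
        using that fs H by (simp add: col_mult_mat_vec del: col_mult)
      thus ?thesis using that r H fs by (simp add: right_null_def B subset_iff)
    qed
    thus ?l by (metis in_set_conv_nth subsetI)
  qed
  have v: "(\<forall>c. P (vec (length bs) c)) \<longleftrightarrow> (\<forall>c\<in>carrier_vec (length bs). P c)" for P :: "'a poly fract vec \<Rightarrow> bool"
  proof
    assume a: "\<forall>c. P (vec (length bs) c)"
    show "\<forall>c\<in>carrier_vec (length bs). P c"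
    proof
      fix c :: "'a poly fract vec" assume "c \<in> carrier_vec (length bs)"
      hence "vec (length bs) (\<lambda>i. c $ i) = c" by auto
      thus "P c" using a by metis
    qed
  qed auto
  have v': "(\<exists>c. P (vec (length bs) c)) \<longleftrightarrow> (\<exists>c\<in>carrier_vec (length bs). P c)" for P :: "'a poly fract vec \<Rightarrow> bool"
    using v[of "\<lambda>c. \<not> P c"] by blast
  have z: "(\<forall>i<length bs. c i = 0) \<longleftrightarrow> vec (length bs) c = 0\<^sub>v (length bs)" for c :: "nat \<Rightarrow> 'a poly fract"
    by (auto simp: vec_eq_iff)
  have 2: "(\<forall>c. lincomb_rf n c fs = 0\<^sub>v n \<longrightarrow> (\<forall>i<length fs. c i = 0)) \<longleftrightarrow>
     (\<forall>c \<in> carrier_vec (length bs). basis_mat n bs *\<^sub>v c = 0\<^sub>v n \<longrightarrow> c = 0\<^sub>v (length bs))"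
    unfolding lc fs z by (rule v)
  have 3: "(\<forall>x\<in>right_null H. \<exists>c. x = lincomb_rf n c fs) \<longleftrightarrow>
     (\<forall>x \<in> carrier_vec n. H *\<^sub>v x = 0\<^sub>v m \<longrightarrow> (\<exists>c \<in> carrier_vec (length bs). x = basis_mat n bs *\<^sub>v c))"
  proof -
    have "(\<exists>c. x = lincomb_rf n c fs) \<longleftrightarrow> (\<exists>c\<in>carrier_vec (length bs). x = basis_mat n bs *\<^sub>v c)" for x
      unfolding lc by (rule v')
    thus ?thesis using H by (auto simp: right_null_def)
  qed
  have 0: "(\<forall>b\<in>set bs. b \<in> carrier_vec (dim_col H)) \<longleftrightarrow> set bs \<subseteq> carrier_vec n"
    using H by auto
  show ?thesis unfolding is_poly_basis_right_def Let_def fs_def[symmetric] 0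
    unfolding carrier_matD(2)[OF H] 1 2 3 ..
next
  case False
  thus ?thesis using H by (auto simp: is_poly_basis_right_def)
qed

text \<open>A basis of the null space that extends to an invertible matrix over \<open>R\<close>; \<open>M'\<close> reads off the coordinates.\<close>

definition null_basis :: "'b::field set \<Rightarrow> 'b mat \<Rightarrow> nat \<Rightarrow> 'b mat \<Rightarrow> 'b mat \<Rightarrow> bool" where
  "null_basis R H k M M' \<longleftrightarrow> M \<in> carrier_mat (dim_col H) k \<and> M' \<in> carrier_mat k (dim_col H) \<and>
     mat_over R M \<and> mat_over R M' \<and> M' * M = 1\<^sub>m k \<and> H * M = 0\<^sub>m (dim_row H) k \<and>
     (\<forall>x \<in> carrier_vec (dim_col H). H *\<^sub>v x = 0\<^sub>v (dim_row H) \<longrightarrow> M *\<^sub>v (M' *\<^sub>v x) = x)"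

lemma null_basis_mat:
  assumes "null_basis R H k M M'" "H \<in> carrier_mat m n" "B \<in> carrier_mat n l" "H * B = 0\<^sub>m m l"
  shows "M * (M' * B) = B"
proof (rule mat_eqI_cols[of _ n l])
  have c: "M \<in> carrier_mat n k" "M' \<in> carrier_mat k n" using assms by (auto simp: null_basis_def)
  fix j assume j: "j < l"
  have "H *\<^sub>v col B j = col (H * B) j"
    by (rule col_mult_mat_vec[symmetric]) (use assms j in auto)
  also have "\<dots> = 0\<^sub>v m" unfolding assms(4) using j by simp
  finally have "H *\<^sub>v col B j = 0\<^sub>v m" .
  hence "M *\<^sub>v (M' *\<^sub>v col B j) = col B j" using assms j by (auto simp: null_basis_def)
  moreover have "col (M * (M' * B)) j = M *\<^sub>v col (M' * B) j"
    by (rule col_mult_mat_vec) (use c assms j in auto)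
  moreover have "col (M' * B) j = M' *\<^sub>v col B j"
    by (rule col_mult_mat_vec) (use c assms j in auto)
  ultimately show "col (M * (M' * B)) j = col B j" by simp
qed (use assms in \<open>auto simp: null_basis_def\<close>)

lemma det_nonzero_of_injective:
  fixes X :: "'b::field mat"
  assumes "X \<in> carrier_mat k k" "\<And>c. c \<in> carrier_vec k \<Longrightarrow> X *\<^sub>v c = 0\<^sub>v k \<Longrightarrow> c = 0\<^sub>v k"
  shows "det X \<noteq> 0"
  using det_0_iff_vec_prod_zero[OF assms(1)] assms(2) by blast

lemma mult_mat_zero_vec [simp]: "A \<in> carrier_mat m n \<Longrightarrow> A *\<^sub>v 0\<^sub>v n = (0\<^sub>v m :: 'b::semiring_0 vec)"
  by (intro eq_vecI) (auto simp: scalar_prod_def)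

lemma sum_list_map_nth: "(\<Sum>b\<leftarrow>bs. f b) = (\<Sum>j<length bs. f (bs ! j))"
  by (simp add: sum_list_sum_nth atLeast0LessThan)

text \<open>Multiplying a basis matrix by this matrix divides each column by lambda to its degree.
  The product is proper, and its value at infinity is the matrix of leading column
  coefficients.\<close>

definition degree_scaling :: "'a::field poly vec list \<Rightarrow> 'a poly fract mat" where
  "degree_scaling bs = mat (length bs) (length bs)
     (\<lambda>(i, j). if i = j then lam powi (- int (poly_vec_degree (bs ! j))) else 0)"

lemma degree_scaling_carrier [simp]: "degree_scaling bs \<in> carrier_mat (length bs) (length bs)"
  by (simp add: degree_scaling_def)

lemma degree_scaling_dim [simp]:
  "dim_row (degree_scaling bs) = length bs" "dim_col (degree_scaling bs) = length bs"
  by (simp_all add: degree_scaling_def)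

lemma degree_scaling_det:
  "det (degree_scaling bs) \<noteq> 0" "rdeg (det (degree_scaling bs)) = - int (\<Sum>b\<leftarrow>bs. poly_vec_degree b)"
proof -
  have "det (degree_scaling bs) = prod_list (diag_mat (degree_scaling bs))"
    by (rule det_upper_triangular[of _ "length bs"]) (auto simp: degree_scaling_def)
  also have "\<dots> = (\<Prod>i = 0..<length bs. lam powi (- int (poly_vec_degree (bs ! i))))"
    unfolding prod_list_diag_prod by (auto simp: degree_scaling_def intro: prod.cong)
  finally have *: "det (degree_scaling bs) = (\<Prod>i = 0..<length bs. lam powi (- int (poly_vec_degree (bs ! i))))" .
  show "det (degree_scaling bs) \<noteq> 0" unfolding * by simp
  show "rdeg (det (degree_scaling bs)) = - int (\<Sum>b\<leftarrow>bs. poly_vec_degree b)"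
    unfolding * by (subst rdeg_prod) (auto simp: sum_list_map_nth sum_negf atLeast0LessThan)
qed

lemma basis_mat_scaled_index:
  assumes "set bs \<subseteq> carrier_vec n" "i < n" "j < length bs"
  shows "(basis_mat n bs * degree_scaling bs) $$ (i, j)
    = to_fract (bs ! j $ i) * lam powi (- int (poly_vec_degree (bs ! j)))"
proof -
  have "(basis_mat n bs * degree_scaling bs) $$ (i, j)
      = (\<Sum>t = 0..<length bs. basis_mat n bs $$ (i, t) * degree_scaling bs $$ (t, j))"
    using assms basis_mat_carrier[of n bs] degree_scaling_carrier[of bs]
    by (auto simp: scalar_prod_def)
  also have "\<dots> = (\<Sum>t = 0..<length bs. if t = j then basis_mat n bs $$ (i, j) * lam powi (- int (poly_vec_degree (bs ! j))) else 0)"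
    using assms by (intro sum.cong) (auto simp: degree_scaling_def)
  also have "\<dots> = basis_mat n bs $$ (i, j) * lam powi (- int (poly_vec_degree (bs ! j)))"
    using assms by simp
  finally show ?thesis using assms by (simp add: basis_mat_index subset_iff)
qed

lemma basis_mat_scaled_proper:
  assumes "set bs \<subseteq> carrier_vec n"
  shows "mat_over {x. proper_rf x} (basis_mat n bs * degree_scaling bs)"
  unfolding mat_over_def
proof (intro allI impI)
  fix i j assume "i < dim_row (basis_mat n bs * degree_scaling bs)" "j < dim_col (basis_mat n bs * degree_scaling bs)"
  hence ij: "i < n" "j < length bs" using basis_mat_carrier[of n bs] degree_scaling_carrier[of bs] by auto
  have "bs ! j \<in> carrier_vec n" using assms ij by auto
  hence "degree (bs ! j $ i) \<le> poly_vec_degree (bs ! j)" using ij by (intro degree_le_poly_vec_degree) auto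
  thus "(basis_mat n bs * degree_scaling bs) $$ (i, j) \<in> {x. proper_rf x}"
    unfolding basis_mat_scaled_index[OF assms ij]
    by (cases "bs ! j $ i = 0") (auto simp: proper_iff rdeg_mult rdeg_to_fract)
qed

text \<open>\<open>M'\<close> is polynomial, so every polynomial basis has polynomial coordinates
  with respect to \<open>M\<close>. The rest is the change of basis between two bases of one
  space.\<close>

lemma poly_basis_coordinates:
  assumes H: "H \<in> carrier_mat m n" and nb: "null_basis (range to_fract) H k M M'"
    and bs: "is_poly_basis_right H bs"
  shows "length bs = k" "M' * basis_mat n bs \<in> carrier_mat k k" "det (M' * basis_mat n bs) \<noteq> 0"
    "mat_over (range to_fract) (M' * basis_mat n bs)" "M * (M' * basis_mat n bs) = basis_mat n bs"
proof -
  define B l where "B = basis_mat n bs" and "l = length bs"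
  have c: "M \<in> carrier_mat n k" "M' \<in> carrier_mat k n" "B \<in> carrier_mat n l"
    using nb H by (auto simp: null_basis_def B_def l_def)
  have b: "set bs \<subseteq> carrier_vec n" "H * B = 0\<^sub>m m l"
    "\<And>c. c \<in> carrier_vec l \<Longrightarrow> B *\<^sub>v c = 0\<^sub>v n \<Longrightarrow> c = 0\<^sub>v l"
    "\<And>x. x \<in> carrier_vec n \<Longrightarrow> H *\<^sub>v x = 0\<^sub>v m \<Longrightarrow> \<exists>c \<in> carrier_vec l. x = B *\<^sub>v c"
    using bs unfolding is_poly_basis_right_iff[OF H] B_def l_def by auto
  have MB: "M * (M' * B) = B" using null_basis_mat[OF nb H c(3) b(2)] .
  thus "M * (M' * basis_mat n bs) = basis_mat n bs" by (simp add: B_def)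
  have inj: "v = 0\<^sub>v l" if v: "v \<in> carrier_vec l" "(M' * B) *\<^sub>v v = 0\<^sub>v k" for v
  proof -
    have "B *\<^sub>v v = (M * (M' * B)) *\<^sub>v v" using MB by simp
    also have "\<dots> = M *\<^sub>v ((M' * B) *\<^sub>v v)" using c v by (intro assoc_mult_mat_vec) auto
    also have "\<dots> = 0\<^sub>v n" using v c by simp
    finally show ?thesis using b v by blast
  qed
  have X: "M' * B \<in> carrier_mat k l" using c by simp
  have lk: "l \<le> k" using injective_imp_dim_le[OF X] inj by blast
  \<comment> \<open>Conversely the columns of \<open>M\<close> are combinations of the basis. Their
    coefficients \<open>Y\<close> form a right inverse of \<open>M' * B\<close>, which gives
    \<open>k \<le> l\<close>.\<close>
  have "\<exists>c \<in> carrier_vec l. col M j = B *\<^sub>v c" if "j < k" for j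
  proof (rule b(4))
    have "H *\<^sub>v col M j = col (H * M) j" using H c that by (simp add: col_mult_mat_vec del: col_mult)
    thus "H *\<^sub>v col M j = 0\<^sub>v m" using nb H that by (simp add: null_basis_def)
  qed (use c that in auto)
  then obtain y where y: "\<And>j. j < k \<Longrightarrow> y j \<in> carrier_vec l" "\<And>j. j < k \<Longrightarrow> col M j = B *\<^sub>v y j" by metis
  define Y where "Y = mat_of_cols l (map y [0..<k])"
  have Y: "Y \<in> carrier_mat l k" by (simp add: Y_def mat_of_cols_def)
  have BY: "B * Y = M"
    using c Y y by (intro mat_eqI_cols[of _ n k]) (auto simp: col_mult_mat_vec Y_def simp del: col_mult)
  have XY: "(M' * B) * Y = 1\<^sub>m k" using c Y BY nb by (simp add: mat_assoc null_basis_def)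
  have "v = 0\<^sub>v k" if v: "v \<in> carrier_vec k" "Y *\<^sub>v v = 0\<^sub>v l" for v
  proof -
    have "v = ((M' * B) * Y) *\<^sub>v v" using XY v by simp
    also have "\<dots> = (M' * B) *\<^sub>v (Y *\<^sub>v v)" using X Y v by (intro assoc_mult_mat_vec) auto
    also have "\<dots> = 0\<^sub>v k" using v X by simp
    finally show ?thesis .
  qed
  hence "k \<le> l" using injective_imp_dim_le[OF Y] by blast
  with lk have kl: "l = k" by simp
  thus "length bs = k" by (simp add: l_def)
  show "M' * basis_mat n bs \<in> carrier_mat k k" using X kl by (simp add: B_def)
  show "det (M' * basis_mat n bs) \<noteq> 0"
    using det_nonzero_of_injective[of "M' * B" k] X inj kl unfolding B_def[symmetric] by metis
  have "mat_over (range to_fract) B" unfolding B_def mat_over_def basis_mat_def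
    using b(1) by (auto simp: mat_of_cols_index subset_iff)
  thus "mat_over (range to_fract) (M' * basis_mat n bs)"
    using nb c H unfolding B_def[symmetric] by (intro pol.mat_over_mult) (simp_all add: null_basis_def)
qed

text \<open>The scaled basis has coordinates \<open>M' * B * L\<close> with respect to
  \<open>M\<close> and \<open>Y\<close> with respect to \<open>Mi\<close>, related by
  \<open>M' * Mi\<close>. Comparing determinants gives the last claim, since
  \<open>rdeg (det L)\<close> is minus the degree sum. The term with \<open>M' * Mi\<close> is the
  same for all bases.\<close>

lemma poly_basis_degree_sum:
  assumes H: "H \<in> carrier_mat m n" and nb: "null_basis (range to_fract) H k M M'"
    and ni: "null_basis {x. proper_rf x} H k Mi Mi'" and bs: "is_poly_basis_right H bs"
  defines "Y \<equiv> Mi' * (basis_mat n bs * degree_scaling bs)"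
  shows "Y \<in> carrier_mat k k" "mat_over {x. proper_rf x} Y" "det Y \<noteq> 0"
    "Mi * Y = basis_mat n bs * degree_scaling bs"
    "int (\<Sum>b\<leftarrow>bs. poly_vec_degree b) = rdeg (det (M' * basis_mat n bs)) - rdeg (det (M' * Mi)) - rdeg (det Y)"
proof -
  note pc = poly_basis_coordinates[OF H nb bs]
  define B where "B = basis_mat n bs"
  define L where "L = degree_scaling bs"
  have c: "M \<in> carrier_mat n k" "M' \<in> carrier_mat k n" "Mi \<in> carrier_mat n k" "Mi' \<in> carrier_mat k n"
    "B \<in> carrier_mat n k" "L \<in> carrier_mat k k" "B * L \<in> carrier_mat n k"
    using nb ni H pc(1) basis_mat_carrier[of n bs] degree_scaling_carrier[of bs]
    by (auto simp: null_basis_def B_def L_def)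
  have b: "set bs \<subseteq> carrier_vec n" "H * B = 0\<^sub>m m k"
    using bs pc(1) unfolding is_poly_basis_right_iff[OF H] B_def by auto
  show Yc: "Y \<in> carrier_mat k k" using c by (simp add: Y_def B_def L_def)
  show "mat_over {x. proper_rf x} Y"
    unfolding Y_def
  proof (rule prp.mat_over_mult)
    show "mat_over {x. proper_rf x} Mi'" using ni by (simp add: null_basis_def)
    show "dim_col Mi' = dim_row (basis_mat n bs * degree_scaling bs)" using c by (simp add: B_def)
  qed (rule basis_mat_scaled_proper[OF b(1)])
  have "H * (B * L) = 0\<^sub>m m k" using b(2) c H by (simp flip: mat_assoc)
  from null_basis_mat[OF ni H c(7) this] show MY: "Mi * Y = basis_mat n bs * degree_scaling bs"
    by (simp add: Y_def B_def L_def)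
  have "(M' * B) * L = M' * (Mi * Y)" using MY c by (simp add: mat_assoc B_def L_def)
  also have "\<dots> = (M' * Mi) * Y" using c Yc by (simp add: mat_assoc)
  finally have "det (M' * B) * det L = det (M' * Mi) * det Y"
    using c Yc det_mult[of "M' * B" k L] det_mult[of "M' * Mi" k Y] by simp
  moreover have "det (M' * B) \<noteq> 0" "det L \<noteq> 0"
    using pc(3) degree_scaling_det(1) by (auto simp: B_def L_def)
  ultimately have *: "det (M' * Mi) \<noteq> 0" "det Y \<noteq> 0"
      "rdeg (det (M' * B)) + rdeg (det L) = rdeg (det (M' * Mi)) + rdeg (det Y)"
    by (auto simp flip: rdeg_mult) (metis mult_eq_0_iff rdeg_mult)+
  show "det Y \<noteq> 0" by fact
  show "int (\<Sum>b\<leftarrow>bs. poly_vec_degree b) = rdeg (det (M' * basis_mat n bs)) - rdeg (det (M' * Mi)) - rdeg (det Y)"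
    using *(3) degree_scaling_det(2)[of bs] unfolding B_def L_def by simp
qed

text \<open>Converse to \<open>poly_basis_coordinates\<close>: a nonsingular polynomial coordinate
  matrix, whether or not its determinant is constant, comes from a polynomial basis.\<close>

lemma poly_basis_of_unimodular:
  assumes H: "H \<in> carrier_mat m n" and nb: "null_basis (range to_fract) H k (map_mat to_fract Mp) M'"
    and Mp: "Mp \<in> carrier_mat n k" and Xp: "Xp \<in> carrier_mat k k" "det Xp \<noteq> 0"
  shows "is_poly_basis_right H (cols (Mp * Xp))" "M' * basis_mat n (cols (Mp * Xp)) = map_mat to_fract Xp"
proof -
  define M X where "M = map_mat to_fract Mp" and "X = map_mat to_fract Xp"
  have M: "M \<in> carrier_mat n k" "M' \<in> carrier_mat k n" and X: "X \<in> carrier_mat k k"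
    using Mp Xp nb H by (auto simp: M_def X_def null_basis_def)
  have B: "basis_mat n (cols (Mp * Xp)) = M * X"
    using Mp Xp by (simp add: basis_mat_cols[of _ n k] to_fract_hom.mat_hom_mult[of _ n k _ k] M_def X_def)
  have l: "length (cols (Mp * Xp)) = k" using Mp Xp by simp
  have M'M: "M' * M = 1\<^sub>m k" "H * M = 0\<^sub>m m k" using nb H by (auto simp: null_basis_def M_def)
  have M'B: "M' * (M * X) = X" using M X M'M by (simp flip: mat_assoc)
  thus "M' * basis_mat n (cols (Mp * Xp)) = map_mat to_fract Xp" using B by (simp add: X_def)
  have dX: "det X \<noteq> 0" using Xp by (simp add: X_def)
  obtain X' where X': "X' \<in> carrier_mat k k" "X * X' = 1\<^sub>m k" using det_nonzero_inverse[OF X dX] .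
  show "is_poly_basis_right H (cols (Mp * Xp))"
    unfolding is_poly_basis_right_iff[OF H] l B
  proof (intro conjI ballI impI)
    show "set (cols (Mp * Xp)) \<subseteq> carrier_vec n" using cols_dim[of "Mp * Xp"] Mp by simp
    show "H * (M * X) = 0\<^sub>m m k" using M X M'M H by (simp flip: mat_assoc)
  next
    fix v assume v: "v \<in> carrier_vec k" "(M * X) *\<^sub>v v = 0\<^sub>v n"
    have "X *\<^sub>v v = (M' * (M * X)) *\<^sub>v v" using M'B by simp
    also have "\<dots> = M' *\<^sub>v ((M * X) *\<^sub>v v)" using M X v by (intro assoc_mult_mat_vec) auto
    also have "\<dots> = 0\<^sub>v k" using v M by simp
    finally show "v = 0\<^sub>v k" using dX det_0_iff_vec_prod_zero[OF X] v by blast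
  next
    fix x assume x: "x \<in> carrier_vec n" "H *\<^sub>v x = 0\<^sub>v m"
    have "M *\<^sub>v (M' *\<^sub>v x) = x" using nb x H by (auto simp: null_basis_def M_def)
    moreover have "(M * X) *\<^sub>v (X' *\<^sub>v (M' *\<^sub>v x)) = M *\<^sub>v ((X * X') *\<^sub>v (M' *\<^sub>v x))"
    proof -
      have "(M * X) *\<^sub>v (X' *\<^sub>v (M' *\<^sub>v x)) = M *\<^sub>v (X *\<^sub>v (X' *\<^sub>v (M' *\<^sub>v x)))"
        using M X X' x by (intro assoc_mult_mat_vec) auto
      also have "X *\<^sub>v (X' *\<^sub>v (M' *\<^sub>v x)) = (X * X') *\<^sub>v (M' *\<^sub>v x)"
        using M X X' x by (intro assoc_mult_mat_vec[symmetric]) auto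
      finally show ?thesis .
    qed
    moreover have "(X * X') *\<^sub>v (M' *\<^sub>v x) = M' *\<^sub>v x" using X' M x by simp
    ultimately show "\<exists>c\<in>carrier_vec k. x = (M * X) *\<^sub>v c" using X' M x
      by (intro bexI[of _ "X' *\<^sub>v (M' *\<^sub>v x)"]) auto
  qed
qed

section \<open>The index sum theorem\<close>

lemma rdeg_lam_power [simp]: "rdeg (lam ^ n :: 'a::field poly fract) = int n"
  using rdeg_lam_powi[of "int n"] by (simp del: rdeg_lam_powi)

lemma index_mult_mat_sum:
  "A \<in> carrier_mat m n \<Longrightarrow> B \<in> carrier_mat n l \<Longrightarrow> i < m \<Longrightarrow> j < l \<Longrightarrow>
    (A * B) $$ (i, j) = (\<Sum>t = 0..<n. A $$ (i, t) * B $$ (t, j))"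
  by (auto simp: scalar_prod_def)

lemma index_mult_vec_sum:
  "A \<in> carrier_mat m n \<Longrightarrow> v \<in> carrier_vec n \<Longrightarrow> i < m \<Longrightarrow>
    (A *\<^sub>v v) $ i = (\<Sum>t = 0..<n. A $$ (i, t) * v $ t)"
  by (auto simp: scalar_prod_def)

lemma proper_at_inf_mat:
  assumes "mat_over {x. proper_rf x} Y" "Y \<in> carrier_mat m n"
  obtains Y0 where "Y0 \<in> carrier_mat m n" "mat_at_inf Y Y0"
proof -
  have "\<exists>c. at_inf (Y $$ (i, j)) c" if "i < m" "j < n" for i j
    using assms that by (intro at_inf_exists) (auto simp: mat_over_def)
  then obtain c where c: "\<And>i j. i < m \<Longrightarrow> j < n \<Longrightarrow> at_inf (Y $$ (i, j)) (c i j)" by metis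
  show ?thesis by (rule that[of "mat m n (\<lambda>(i, j). c i j)"]) (use c assms in \<open>auto simp: mat_at_inf_def\<close>)
qed

lemma strictly_proper_sum: "(\<And>i. i \<in> I \<Longrightarrow> strictly_proper_rf (f i)) \<Longrightarrow> strictly_proper_rf (sum f I)"
  by (induction I rule: infinite_finite_induct) (auto intro: strictly_proper_add)

lemma strictly_proper_mult_vec:
  assumes "mat_over {x. proper_rf x} A" "dim_vec v = dim_col A"
    "\<And>j. j < dim_vec v \<Longrightarrow> strictly_proper_rf (v $ j)" "i < dim_row A"
  shows "strictly_proper_rf ((A *\<^sub>v v) $ i)"
  using assms by (auto simp: scalar_prod_def mat_over_def intro!: strictly_proper_sum strictly_proper_mult)

text \<open>If the scaled basis is singular at infinity, some column has a combination of lower degree.\<close>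

lemma degree_reduction:
  assumes H: "H \<in> carrier_mat m n" and nb: "null_basis (range to_fract) H k (map_mat to_fract Mp) M'"
    and ni: "null_basis {x. proper_rf x} H k Mi Mi'" and Mp: "Mp \<in> carrier_mat n k"
    and Xp: "Xp \<in> carrier_mat k k" "det Xp \<noteq> 0"
  defines "bs \<equiv> cols (Mp * Xp)"
  defines "Y \<equiv> Mi' * (basis_mat n bs * degree_scaling bs)"
  assumes neg: "rdeg (det Y) < 0"
  shows "\<exists>X' \<in> carrier_mat k k. det X' \<noteq> 0 \<and> degree (det X') = degree (det Xp) \<and>
     (\<Sum>b\<leftarrow>cols (Mp * X'). poly_vec_degree b) < (\<Sum>b\<leftarrow>bs. poly_vec_degree b)"
proof -
  have pb: "is_poly_basis_right H bs"
    unfolding bs_def by (rule poly_basis_of_unimodular[OF H nb Mp Xp])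
  note Yf = poly_basis_degree_sum[OF H nb ni pb, folded Y_def]
  have len: "length bs = k" using Mp Xp by (simp add: bs_def)
  have bsc: "set bs \<subseteq> carrier_vec n" using pb is_poly_basis_right_iff[OF H] by blast
  have bsj: "bs ! j = col (Mp * Xp) j" if "j < k" for j using that Mp Xp by (simp add: bs_def)
  obtain Y0 where Y0: "Y0 \<in> carrier_mat k k" "mat_at_inf Y Y0"
    using proper_at_inf_mat[OF Yf(2,1)] .
  \<comment> \<open>A determinant of negative degree means that the value \<open>Y0\<close> of
    \<open>Y\<close> at infinity is singular, with a constant null vector \<open>c\<close>.\<close>
  have "at_inf (det Y) (det Y0)" by (rule det_at_inf[OF Y0(2) Yf(1)])
  moreover have "at_inf (det Y) 0" using neg by (simp add: strictly_proper_iff)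
  ultimately have "det Y0 = 0" by (rule at_inf_unique)
  then obtain c where c: "c \<in> carrier_vec k" "c \<noteq> 0\<^sub>v k" "Y0 *\<^sub>v c = 0\<^sub>v k"
    using det_0_iff_vec_prod_zero[OF Y0(1)] by blast
  define cc where "cc = map_vec (\<lambda>a. to_fract [:a:]) c"
  have cc: "cc \<in> carrier_vec k" using c by (simp add: cc_def)
  have Yc: "strictly_proper_rf ((Y *\<^sub>v cc) $ i)" if i: "i < k" for i
  proof -
    have "at_inf (\<Sum>j = 0..<k. Y $$ (i, j) * to_fract [:c $ j:]) (\<Sum>j = 0..<k. Y0 $$ (i, j) * c $ j)"
      using Y0 i by (intro at_inf_sum at_inf_mult) (auto simp: mat_at_inf_def)
    also have "(\<Sum>j = 0..<k. Y0 $$ (i, j) * c $ j) = (Y0 *\<^sub>v c) $ i"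
      using Y0(1) c(1) i by (auto simp: scalar_prod_def)
    also have "\<dots> = 0" using c i by simp
    finally show ?thesis using Yf(1) c(1) i by (auto simp: scalar_prod_def cc_def)
  qed
  define BL where "BL = basis_mat n bs * degree_scaling bs"
  have Mi: "Mi \<in> carrier_mat n k" "mat_over {x. proper_rf x} Mi" using ni H by (auto simp: null_basis_def)
  \<comment> \<open>\<open>Mi\<close> is proper and carries a strictly proper vector to a strictly
    proper one. In other words, the combination \<open>c\<close> cancels the leading coefficients of
    the columns.\<close>
  have BLc: "strictly_proper_rf ((BL *\<^sub>v cc) $ t)" if "t < n" for t
  proof -
    have "BL *\<^sub>v cc = Mi *\<^sub>v (Y *\<^sub>v cc)"
      unfolding BL_def Yf(4)[symmetric] using Mi Yf(1) cc by (intro assoc_mult_mat_vec) auto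
    moreover have "strictly_proper_rf ((Mi *\<^sub>v (Y *\<^sub>v cc)) $ t)"
    proof (rule strictly_proper_mult_vec[OF Mi(2)])
      show "\<And>j. j < dim_vec (Y *\<^sub>v cc) \<Longrightarrow> strictly_proper_rf ((Y *\<^sub>v cc) $ j)"
        using Yc Yf(1) by (metis carrier_matD(1) dim_mult_mat_vec)
    qed (use Mi(1) Yf(1) that in simp_all)
    ultimately show ?thesis by simp
  qed
  define d where "d j = poly_vec_degree (bs ! j)" for j
  define S where "S = {j. j < k \<and> c $ j \<noteq> 0}"
  have S: "finite S" "S \<noteq> {}" using c by (auto simp: S_def)
  \<comment> \<open>The column to be replaced has the highest degree among those occurring in the
    combination. The truncated differences \<open>d i - d j\<close> in \<open>w\<close> are
    therefore true ones wherever \<open>c $ j\<close> is nonzero.\<close>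
  obtain i where i: "i \<in> S" "\<And>j. j \<in> S \<Longrightarrow> d j \<le> d i"
    using Max_in[of "d ` S"] S Max_ge[of "d ` S"] by (metis (no_types, lifting) finite_imageI image_iff image_is_empty)
  have ik: "i < k" "c $ i \<noteq> 0" using i by (auto simp: S_def)
  have BL: "BL \<in> carrier_mat n k" by (auto simp: BL_def len)
  have BLi: "BL $$ (t, j) = to_fract (bs ! j $ t) * lam powi (- int (d j))" if "t < n" "j < k" for t j
    unfolding BL_def d_def using basis_mat_scaled_index[OF bsc] that len by simp
  define w where "w = vec k (\<lambda>j. monom (c $ j) (d i - d j))"
  have w: "w \<in> carrier_vec k" by (simp add: w_def)
  have wj: "to_fract (w $ j) = lam powi (int (d i)) * (lam powi (- int (d j)) * to_fract [:c $ j:])" if "j < k" for j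
  proof (cases "c $ j = 0")
    case False
    hence "d j \<le> d i" using i that by (auto simp: S_def)
    hence "lam powi (int (d i)) * lam powi (- int (d j)) = (lam :: 'a poly fract) ^ (d i - d j)"
      by (simp flip: power_int_add power_int_of_nat add: of_nat_diff)
    moreover have "w $ j = [:0, 1:] ^ (d i - d j) * [:c $ j:]"
      using that by (simp add: w_def monom_altdef)
    hence "to_fract (w $ j) = to_fract ([:0, 1:] ^ (d i - d j)) * to_fract [:c $ j:]"
      by (simp only: to_fract_mult)
    moreover have "to_fract ([:0, 1:] ^ (d i - d j)) = (lam :: 'a poly fract) ^ (d i - d j)"
      by (simp add: lam_def to_fract_hom.hom_power)
    ultimately show ?thesis by (simp only: mult.assoc[symmetric])
  qed (use that in \<open>simp add: w_def\<close>)
  define b' where "b' = (Mp * Xp) *\<^sub>v w"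
  have b'c: "b' \<in> carrier_vec n" using Mp Xp w by (simp add: b'_def)
  have b't: "to_fract (b' $ t) = lam powi (int (d i)) * (BL *\<^sub>v cc) $ t" if t: "t < n" for t
  proof -
    have "b' $ t = (\<Sum>j = 0..<k. (Mp * Xp) $$ (t, j) * w $ j)"
      unfolding b'_def using Mp Xp w t by (intro index_mult_vec_sum[of _ n]) auto
    also have "\<dots> = (\<Sum>j = 0..<k. bs ! j $ t * w $ j)"
      using Mp Xp t by (intro sum.cong) (auto simp: bsj)
    finally have "to_fract (b' $ t) = (\<Sum>j = 0..<k. to_fract (bs ! j $ t) * to_fract (w $ j))" by simp
    also have "\<dots> = (\<Sum>j = 0..<k. lam powi (int (d i)) * (BL $$ (t, j) * cc $ j))"
      using t len c by (intro sum.cong) (auto simp: wj BLi cc_def)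
    also have "\<dots> = lam powi (int (d i)) * (BL *\<^sub>v cc) $ t"
      using t by (simp add: index_mult_vec_sum[OF BL cc] sum_distrib_left)
    finally show ?thesis .
  qed
  have deg: "b' $ t = 0 \<or> degree (b' $ t) < d i" if t: "t < n" for t
  proof (cases "b' $ t = 0")
    case False
    hence nz: "(BL *\<^sub>v cc) $ t \<noteq> 0" using b't[OF t] by (metis mult_zero_right to_fract_eq_0_iff)
    have "int (degree (b' $ t)) = rdeg (to_fract (b' $ t))" using False by (simp add: rdeg_to_fract)
    also have "\<dots> = int (d i) + rdeg ((BL *\<^sub>v cc) $ t)" unfolding b't[OF t] using nz by (simp add: rdeg_mult)
    also have "\<dots> < int (d i)" using BLc[OF t] nz by (simp add: strictly_proper_iff)
    finally show ?thesis by simp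
  qed simp
  define X' where "X' = replace_col Xp (Xp *\<^sub>v w) i"
  have X'c: "X' \<in> carrier_mat k k" using Xp by (simp add: X'_def replace_col_def)
  \<comment> \<open>Cramer's rule: replacing column \<open>i\<close> by
    \<open>Xp *\<^sub>v w\<close> multiplies the determinant by \<open>w $ i\<close>, the nonzero
    constant \<open>c $ i\<close>.\<close>
  have dX': "det X' = [:c $ i:] * det Xp"
    unfolding X'_def using cramer_lemma_mat[OF Xp(1) w ik(1)] ik by (simp add: w_def monom_0)
  have dX'nz: "det X' \<noteq> 0" using dX' Xp ik by simp
  have ddX': "degree (det X') = degree (det Xp)" using dX' Xp ik by simp
  have col_i: "col (Mp * X') i = b'"
  proof -
    have "col X' i = Xp *\<^sub>v w" using Xp ik w by (intro eq_vecI) (auto simp: X'_def replace_col_def)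
    hence "col (Mp * X') i = Mp *\<^sub>v (Xp *\<^sub>v w)" using Mp X'c ik by (simp add: col_mult_mat_vec del: col_mult)
    also have "\<dots> = b'" unfolding b'_def by (rule assoc_mult_mat_vec[symmetric, OF Mp Xp(1) w])
    finally show ?thesis .
  qed
  have col_j: "col (Mp * X') j = bs ! j" if "j < k" "j \<noteq> i" for j
  proof -
    have "col X' j = col Xp j" using Xp that by (intro eq_vecI) (auto simp: X'_def replace_col_def)
    thus ?thesis using Mp X'c Xp that by (simp add: col_mult_mat_vec bsj del: col_mult)
  qed
  \<comment> \<open>If \<open>d i\<close> were 0, the new column would vanish, although the new
    coordinate matrix is nonsingular and its columns form a basis.\<close>
  have di: "0 < d i"
  proof (rule ccontr)
    assume "\<not> 0 < d i"
    hence "b' = 0\<^sub>v n" using deg b'c by (intro eq_vecI) auto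
    hence z: "col (Mp * X') i = 0\<^sub>v n" using col_i by simp
    have pb': "is_poly_basis_right H (cols (Mp * X'))" by (rule poly_basis_of_unimodular[OF H nb Mp X'c dX'nz])
    have lc: "length (cols (Mp * X')) = k" using X'c by simp
    have "basis_mat n (cols (Mp * X')) *\<^sub>v unit_vec k i = 0\<^sub>v n"
    proof (rule eq_vecI)
      fix t assume "t < dim_vec (0\<^sub>v n :: 'a poly fract vec)"
      hence t: "t < n" by simp
      have "(Mp * X') $$ (t, i) = 0" using z t ik Mp X'c by (metis carrier_matD index_col index_mult_mat(2,3) index_zero_vec(1))
      thus "(basis_mat n (cols (Mp * X')) *\<^sub>v unit_vec k i) $ t = 0\<^sub>v n $ t"
        using t ik Mp X'c by (simp add: basis_mat_cols[of _ n k])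
    qed simp
    moreover have "\<forall>c \<in> carrier_vec k. basis_mat n (cols (Mp * X')) *\<^sub>v c = 0\<^sub>v n \<longrightarrow> c = 0\<^sub>v k"
      using pb' unfolding is_poly_basis_right_iff[OF H] lc by blast
    ultimately have "unit_vec k i = (0\<^sub>v k :: 'a poly fract vec)" by simp
    thus False using ik by simp
  qed
  have less: "poly_vec_degree b' < d i"
    using deg b'c di by (intro poly_vec_degree_less) fastforce+
  have "(\<Sum>b\<leftarrow>cols (Mp * X'). poly_vec_degree b) = (\<Sum>j<k. poly_vec_degree (col (Mp * X') j))"
    using X'c by (simp add: sum_list_map_nth)
  also have "\<dots> < (\<Sum>j<k. d j)"
  proof (rule sum_strict_mono_ex1)
    show "\<forall>j\<in>{..<k}. poly_vec_degree (col (Mp * X') j) \<le> d j"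
    proof
      fix j assume "j \<in> {..<k}"
      thus "poly_vec_degree (col (Mp * X') j) \<le> d j" using col_i col_j less by (cases "j = i") (auto simp: d_def)
    qed
    show "\<exists>j\<in>{..<k}. poly_vec_degree (col (Mp * X') j) < d j" using ik less col_i by auto
  qed simp
  also have "\<dots> = (\<Sum>b\<leftarrow>bs. poly_vec_degree b)" by (simp add: sum_list_map_nth len d_def)
  finally show ?thesis using X'c dX'nz ddX' by blast
qed

text \<open>In the formula for the degree sum, \<open>rdeg (det (M' * B))\<close> is nonnegative and
  \<open>rdeg (det Y)\<close> is nonpositive, which gives the lower bound. For a basis of least
  degree sum among the unimodular changes of \<open>M\<close>, the first vanishes by choice and the
  second by \<open>degree_reduction\<close>.\<close>

lemma right_min_indices_sum_null_basis:
  assumes H: "H \<in> carrier_mat m n" and nb: "null_basis (range to_fract) H k M M'"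
    and ni: "null_basis {x. proper_rf x} H k Mi Mi'"
  shows "int (right_min_indices_sum H) = - rdeg (det (M' * Mi))"
proof -
  obtain Mp where Mp: "Mp \<in> carrier_mat n k" "M = map_mat to_fract Mp"
    using mat_over_to_fractD[of M n k] nb H by (auto simp: null_basis_def)
  note nb' = nb[unfolded Mp(2)]
  have lower: "- rdeg (det (M' * Mi)) \<le> int (\<Sum>b\<leftarrow>bs. poly_vec_degree b)" if bs: "is_poly_basis_right H bs" for bs
  proof -
    note pc = poly_basis_coordinates[OF H nb bs] and pd = poly_basis_degree_sum[OF H nb ni bs]
    have "0 \<le> rdeg (det (M' * basis_mat n bs))" using pol.N_nonneg pol.det_in pc(3,4) by blast
    moreover have "rdeg (det (Mi' * (basis_mat n bs * degree_scaling bs))) \<le> 0"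
      using prp.N_nonneg[OF prp.det_in[OF pd(2)] pd(3)] by simp
    ultimately show ?thesis using pd(5) by linarith
  qed
  \<comment> \<open>Constant nonzero determinant. \<open>degree_reduction\<close> stays within this
    set because it preserves the degree of the determinant.\<close>
  define good where "good X \<longleftrightarrow> X \<in> carrier_mat k k \<and> det X \<noteq> 0 \<and> degree (det X) = 0" for X :: "'a poly mat"
  have "good (1\<^sub>m k)" by (simp add: good_def)
  then obtain X where X: "good X" "\<And>X'. good X' \<Longrightarrow>
      (\<Sum>b\<leftarrow>cols (Mp * X). poly_vec_degree b) \<le> (\<Sum>b\<leftarrow>cols (Mp * X'). poly_vec_degree b)"
    using ex_has_least_nat[of good "1\<^sub>m k" "\<lambda>X. \<Sum>b\<leftarrow>cols (Mp * X). poly_vec_degree b"] by blast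
  have Xg: "X \<in> carrier_mat k k" "det X \<noteq> 0" "degree (det X) = 0" using X by (auto simp: good_def)
  let ?bs = "cols (Mp * X)"
  note pb = poly_basis_of_unimodular[OF H nb' Mp(1) Xg(1,2)]
  note pd = poly_basis_degree_sum[OF H nb ni pb(1)]
  have "\<not> rdeg (det (Mi' * (basis_mat n ?bs * degree_scaling ?bs))) < 0"
  proof
    assume "rdeg (det (Mi' * (basis_mat n ?bs * degree_scaling ?bs))) < 0"
    from degree_reduction[OF H nb' ni Mp(1) Xg(1,2) this]
    obtain X' where "good X'" "(\<Sum>b\<leftarrow>cols (Mp * X'). poly_vec_degree b) < (\<Sum>b\<leftarrow>?bs. poly_vec_degree b)"
      using Xg(3) by (auto simp: good_def)
    thus False using X(2) by fastforce
  qed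
  moreover have "rdeg (det (Mi' * (basis_mat n ?bs * degree_scaling ?bs))) \<le> 0"
    using prp.N_nonneg[OF prp.det_in[OF pd(2)] pd(3)] by simp
  moreover have "rdeg (det (M' * basis_mat n ?bs)) = 0"
    unfolding pb(2) using Xg by (simp add: rdeg_to_fract)
  ultimately have eq: "int (\<Sum>b\<leftarrow>?bs. poly_vec_degree b) = - rdeg (det (M' * Mi))" using pd(5) by linarith
  have "right_min_indices_sum H = (\<Sum>b\<leftarrow>?bs. poly_vec_degree b)"
    unfolding right_min_indices_sum_def
  proof (rule Least_equality)
    show "\<exists>bs. is_poly_basis_right H bs \<and> (\<Sum>b\<leftarrow>?bs. poly_vec_degree b) = (\<Sum>b\<leftarrow>bs. poly_vec_degree b)"
      using pb(1) by blast
  next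
    fix y assume "\<exists>bs. is_poly_basis_right H bs \<and> y = (\<Sum>b\<leftarrow>bs. poly_vec_degree b)"
    thus "(\<Sum>b\<leftarrow>?bs. poly_vec_degree b) \<le> y" using lower eq by (metis of_nat_le_iff)
  qed
  thus ?thesis using eq by simp
qed

section \<open>Null bases read off a compression\<close>

context euclidean_subring
begin

text \<open>The null space of the compressed matrix is spanned by the first \<open>n - r\<close>
  unit vectors, the columns of \<open>J\<close>. Back in the original coordinates they become the
  first columns of \<open>Q\<close>, and the first rows of \<open>Q'\<close> read off the
  coordinates.\<close>

lemma null_basis_compressed:
  assumes H: "H \<in> carrier_mat m n" and P: "gl m P" and Q: "gl n Q" "Q' * Q = 1\<^sub>m n" "gl n Q'"
    and r: "r \<le> m" "r \<le> n" and C: "C \<in> carrier_mat r r" "det C \<noteq> 0"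
    and PHQ: "P * H * Q = dsum (0\<^sub>m (m - r) (n - r)) C"
  defines "J \<equiv> mat n (n - r) (\<lambda>(i, j). if i = j then 1 else 0)"
  shows "null_basis R H (n - r) (Q * J) (J\<^sup>T * Q')"
proof -
  define k where "k = n - r"
  have J: "J \<in> carrier_mat n k" "mat_over R J" by (auto simp: J_def k_def mat_over_def)
  have c: "P \<in> carrier_mat m m" "Q \<in> carrier_mat n n" "Q' \<in> carrier_mat n n"
    using P Q gl_carrier by auto
  have QQ': "Q * Q' = 1\<^sub>m n" using mat_mult_left_right_inverse[OF c(3,2) Q(2)] .
  obtain P' where P': "gl m P'" "P' * P = 1\<^sub>m m" using gl_inverse[OF P] by metis
  have P'c: "P' \<in> carrier_mat m m" using P' gl_carrier by auto
  let ?D = "dsum (0\<^sub>m (m - r) k) C"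
  have D: "?D \<in> carrier_mat m n" using r C by (auto simp: k_def intro!: carrier_matI)
  have JJ: "J\<^sup>T * J = 1\<^sub>m k"
  proof (rule eq_matI)
    fix i j assume ij: "i < dim_row (1\<^sub>m k :: 'k mat)" "j < dim_col (1\<^sub>m k :: 'k mat)"
    have "(J\<^sup>T * J) $$ (i, j) = (\<Sum>t = 0..<n. J $$ (t, i) * J $$ (t, j))"
      using ij J by (simp add: scalar_prod_def)
    also have "\<dots> = (\<Sum>t = 0..<n. if t = i then (if i = j then 1 else 0) else 0)"
      using ij by (intro sum.cong) (auto simp: J_def k_def)
    also have "\<dots> = 1\<^sub>m k $$ (i, j)" using ij by (auto simp: k_def)
    finally show "(J\<^sup>T * J) $$ (i, j) = 1\<^sub>m k $$ (i, j)" .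
  qed (use J in auto)
  have DJ: "?D * J = 0\<^sub>m m k"
  proof (rule eq_matI)
    fix i j assume ij: "i < dim_row (0\<^sub>m m k :: 'k mat)" "j < dim_col (0\<^sub>m m k :: 'k mat)"
    have "(?D * J) $$ (i, j) = (\<Sum>t = 0..<n. ?D $$ (i, t) * J $$ (t, j))"
      using ij by (intro index_mult_mat_sum[OF D J(1)]) auto
    also have "\<dots> = 0" using ij C r by (intro sum.neutral) (auto simp: J_def k_def dsum_index)
    finally show "(?D * J) $$ (i, j) = 0\<^sub>m m k $$ (i, j)" using ij by simp
  qed (use J D in auto)
  \<comment> \<open>Since \<open>C\<close> is nonsingular, the last \<open>r\<close> entries of
    \<open>z\<close> vanish, so truncation by \<open>J\<close> loses nothing.\<close>
  have JJz: "J *\<^sub>v (J\<^sup>T *\<^sub>v z) = z" if z: "z \<in> carrier_vec n" "?D *\<^sub>v z = 0\<^sub>v m" for z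
  proof -
    define z2 where "z2 = vec r (\<lambda>i. z $ (k + i))"
    have "C *\<^sub>v z2 = 0\<^sub>v r"
    proof (rule eq_vecI)
      fix i assume "i < dim_vec (0\<^sub>v r :: 'k vec)"
      hence i: "i < r" by simp
      have "(?D *\<^sub>v z) $ (m - r + i) = (\<Sum>t = 0..<n. ?D $$ (m - r + i, t) * z $ t)"
        using i r by (intro index_mult_vec_sum[OF D z(1)]) auto
      also have "\<dots> = (\<Sum>t = 0..<k. ?D $$ (m - r + i, t) * z $ t) + (\<Sum>t = k..<n. ?D $$ (m - r + i, t) * z $ t)"
        by (rule sum.atLeastLessThan_concat[symmetric]) (auto simp: k_def)
      also have "(\<Sum>t = 0..<k. ?D $$ (m - r + i, t) * z $ t) = 0"
        using i r C by (intro sum.neutral) (auto simp: dsum_index)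
      also have "(\<Sum>t = k..<n. ?D $$ (m - r + i, t) * z $ t) = (\<Sum>t = 0..<r. ?D $$ (m - r + i, k + t) * z $ (k + t))"
        using sum.shift_bounds_nat_ivl[of "\<lambda>t. ?D $$ (m - r + i, t) * z $ t" 0 k r] r
        by (simp add: k_def add.commute)
      also have "\<dots> = (C *\<^sub>v z2) $ i"
        using i r C by (auto simp: dsum_index z2_def scalar_prod_def intro!: sum.cong)
      finally show "(C *\<^sub>v z2) $ i = 0\<^sub>v r $ i" using z i r by simp
    qed (use C in simp)
    hence z2: "z2 = 0\<^sub>v r" using det_0_iff_vec_prod_zero[OF C(1)] C(2) by (metis vec_carrier z2_def)
    have z0: "z $ i = 0" if "i < n" "\<not> i < k" for i
    proof -
      have ik: "i - k < r" "k + (i - k) = i" using that r by (auto simp: k_def)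
      have "z2 $ (i - k) = 0" using z2 ik by simp
      thus ?thesis using ik by (simp add: z2_def)
    qed
    have Jz: "(J\<^sup>T *\<^sub>v z) $ j = z $ j" if "j < k" for j
    proof -
      have "(J\<^sup>T *\<^sub>v z) $ j = (\<Sum>t = 0..<n. J $$ (t, j) * z $ t)"
        using that J z by (simp add: scalar_prod_def)
      also have "\<dots> = (\<Sum>t = 0..<n. if t = j then z $ j else 0)"
        using that by (intro sum.cong) (auto simp: J_def k_def)
      finally show ?thesis using that by (simp add: k_def)
    qed
    show ?thesis
    proof (rule eq_vecI)
      fix i assume "i < dim_vec z"
      hence i: "i < n" using z by simp
      have "(J *\<^sub>v (J\<^sup>T *\<^sub>v z)) $ i = (\<Sum>t = 0..<k. J $$ (i, t) * z $ t)"
        using i J z Jz by (simp add: scalar_prod_def)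
      also have "\<dots> = (\<Sum>t = 0..<k. if t = i then z $ i else 0)"
        using i by (intro sum.cong) (auto simp: J_def k_def)
      also have "\<dots> = z $ i" using z0 i by auto
      finally show "(J *\<^sub>v (J\<^sup>T *\<^sub>v z)) $ i = z $ i" .
    qed (use J z in auto)
  qed
  have "P * (H * (Q * J)) = P * H * Q * J" using c H J by (simp add: mat_assoc)
  also have "\<dots> = 0\<^sub>m m k" using PHQ DJ by (simp add: k_def)
  finally have "P' * (P * (H * (Q * J))) = P' * 0\<^sub>m m k" by simp
  hence HM: "H * (Q * J) = 0\<^sub>m m k"
    using mat_cancel[OF P'(2) P'c c(1), of "H * (Q * J)"] H P'c by simp
  have rec: "(Q * J) *\<^sub>v ((J\<^sup>T * Q') *\<^sub>v x) = x" if x: "x \<in> carrier_vec n" "H *\<^sub>v x = 0\<^sub>v m" for x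
  proof -
    define z where "z = Q' *\<^sub>v x"
    have z: "z \<in> carrier_vec n" using c x by (simp add: z_def)
    have Qz: "Q *\<^sub>v z = x" unfolding z_def
      using assoc_mult_mat_vec[OF c(2,3) x(1)] QQ' x by simp
    have "?D *\<^sub>v z = (P * H) *\<^sub>v (Q *\<^sub>v z)"
      using PHQ assoc_mult_mat_vec[of "P * H" m n Q n z] c H z by (simp add: k_def)
    also have "\<dots> = P *\<^sub>v (H *\<^sub>v x)" unfolding Qz using c H x by (intro assoc_mult_mat_vec) auto
    also have "\<dots> = 0\<^sub>v m" using x c by simp
    finally have "J *\<^sub>v (J\<^sup>T *\<^sub>v z) = z" using JJz z by blast
    moreover have "(J\<^sup>T * Q') *\<^sub>v x = J\<^sup>T *\<^sub>v z"
      unfolding z_def using J c x by (intro assoc_mult_mat_vec) auto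
    moreover have "(Q * J) *\<^sub>v (J\<^sup>T *\<^sub>v z) = Q *\<^sub>v (J *\<^sub>v (J\<^sup>T *\<^sub>v z))"
      using J c z by (intro assoc_mult_mat_vec) auto
    ultimately show ?thesis using Qz by simp
  qed
  have M'M: "J\<^sup>T * Q' * (Q * J) = 1\<^sub>m k"
    using mat_cancel[OF Q(2) c(3,2), of J] J c JJ by (simp add: mat_assoc)
  show ?thesis unfolding null_basis_def k_def[symmetric]
    using H c J HM rec M'M Q by (auto simp: gl_def intro!: mat_over_mult mat_over_transpose)
qed

end

section \<open>Block matrices and the comparison of the two compressions\<close>

lemma four_block_mat_split:
  assumes "A \<in> carrier_mat (a + b) (c + d)"
  obtains A11 A12 A21 A22 where "A11 \<in> carrier_mat a c" "A12 \<in> carrier_mat a d"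
    "A21 \<in> carrier_mat b c" "A22 \<in> carrier_mat b d" "A = four_block_mat A11 A12 A21 A22"
proof -
  obtain A11 A12 A21 A22 where s: "split_block A a c = (A11, A12, A21, A22)" by (metis prod_cases4)
  show ?thesis using split_block[OF s] assms by (intro that[of A11 A12 A21 A22]) auto
qed

lemma four_block_mat_inject:
  assumes "A \<in> carrier_mat a c" "B \<in> carrier_mat a d" "C \<in> carrier_mat b c" "D \<in> carrier_mat b d"
    "A' \<in> carrier_mat a c" "B' \<in> carrier_mat a d" "C' \<in> carrier_mat b c" "D' \<in> carrier_mat b d"
    "four_block_mat A B C D = four_block_mat A' B' C' D'"
  shows "A = A'" "B = B'" "C = C'" "D = D'"
proof -
  have e: "split_block (four_block_mat W X Y Z) a c = (W, X, Y, Z)"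
    if "W \<in> carrier_mat a c" "X \<in> carrier_mat a d" "Y \<in> carrier_mat b c" "Z \<in> carrier_mat b d" for W X Y Z :: "'a mat"
    using that unfolding split_block_def Let_def prod.inject by (intro conjI eq_matI) auto
  have "(A, B, C, D) = (A', B', C', D')"
    using e[OF assms(1-4)] e[OF assms(5-8)] unfolding assms(9) by (rule trans[OF sym])
  thus "A = A'" "B = B'" "C = C'" "D = D'" by simp_all
qed

lemma nonsingular_mult_eq_zero:
  fixes A :: "'b::field mat"
  assumes "A \<in> carrier_mat n n" "det A \<noteq> 0" "X \<in> carrier_mat n k" "A * X = 0\<^sub>m n k"
  shows "X = 0\<^sub>m n k"
proof -
  obtain B where B: "B \<in> carrier_mat n n" "B * A = 1\<^sub>m n" using det_nonzero_inverse[OF assms(1,2)] by metis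
  have "X = B * (A * X)" using mat_cancel[OF B(2,1) assms(1), of X] assms(3) by simp
  thus ?thesis using assms(4) B by simp
qed

lemma mult_nonsingular_eq_zero:
  fixes A :: "'b::field mat"
  assumes "A \<in> carrier_mat n n" "det A \<noteq> 0" "X \<in> carrier_mat k n" "X * A = 0\<^sub>m k n"
  shows "X = 0\<^sub>m k n"
proof -
  have "A\<^sup>T * X\<^sup>T = 0\<^sub>m n k"
    using assms by (simp flip: transpose_mult[of _ k n _ n])
  hence "X\<^sup>T = 0\<^sub>m n k"
    using nonsingular_mult_eq_zero[of "A\<^sup>T" n "X\<^sup>T" k] assms det_transpose[OF assms(1)] by simp
  thus ?thesis by (metis transpose_transpose zero_transpose_mat)
qed

text \<open>Through this, the change of basis between the polynomial and the proper null basis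
  appears as a block of a transition matrix.\<close>

lemma top_left_block_mat:
  assumes "A11 \<in> carrier_mat k k" "A22 \<in> carrier_mat l l" "n = k + l"
  defines "J \<equiv> mat n k (\<lambda>(i, j). if i = j then 1 else 0) :: 'b::comm_ring_1 mat"
  shows "J\<^sup>T * (four_block_mat A11 A12 A21 A22 * J) = A11"
proof (rule eq_matI)
  define A where "A = four_block_mat A11 A12 A21 A22"
  have A: "A \<in> carrier_mat n n" using assms by (auto simp: A_def)
  have J: "J \<in> carrier_mat n k" by (simp add: J_def)
  fix i j assume ij: "i < dim_row A11" "j < dim_col A11"
  have AJ: "(A * J) $$ (t, j) = A $$ (t, j)" if "t < n" for t
  proof -
    have "(A * J) $$ (t, j) = (\<Sum>u = 0..<n. A $$ (t, u) * J $$ (u, j))"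
      using ij A J that assms by (simp add: scalar_prod_def)
    also have "\<dots> = (\<Sum>u = 0..<n. if u = j then A $$ (t, j) else 0)"
      using ij assms by (intro sum.cong) (auto simp: J_def)
    finally show ?thesis using ij assms by simp
  qed
  have "(J\<^sup>T * (A * J)) $$ (i, j) = (\<Sum>t = 0..<n. J $$ (t, i) * (A * J) $$ (t, j))"
    using ij A J assms(1) by (simp add: scalar_prod_def)
  also have "\<dots> = (\<Sum>t = 0..<n. if t = i then A $$ (i, j) else 0)"
    using ij assms AJ by (intro sum.cong) (auto simp: J_def)
  also have "\<dots> = A11 $$ (i, j)" using ij assms by (simp add: A_def)
  finally show "(J\<^sup>T * (four_block_mat A11 A12 A21 A22 * J)) $$ (i, j) = A11 $$ (i, j)"
    by (simp add: A_def)
qed (use assms in \<open>auto simp: J_def\<close>)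

text \<open>The index sum theorem, with the finite and infinite structure recorded by the determinants of the
  nonsingular cores of two compressions.\<close>

theorem mu_eq:
  assumes H: "H \<in> carrier_mat m n" and r: "r \<le> m" "r \<le> n"
    and C: "C \<in> carrier_mat r r" "det C \<noteq> 0" "pol.eqv H (dsum (0\<^sub>m (m - r) (n - r)) C)"
    and Ci: "Ci \<in> carrier_mat r r" "det Ci \<noteq> 0" "prp.eqv H (dsum (0\<^sub>m (m - r) (n - r)) Ci)"
  shows "int (mu H) = rdeg (det Ci) - rdeg (det C)"
proof -
  define k l where "k = n - r" and "l = m - r"
  have kl: "n = k + r" "m = l + r" using r by (auto simp: k_def l_def)
  obtain P Q where PQ: "pol.gl m P" "pol.gl n Q" "P * H * Q = dsum (0\<^sub>m l k) C"
    using pol.eqvE[OF C(3) H] by (metis k_def l_def)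
  obtain Pi Qi where PQi: "prp.gl m Pi" "prp.gl n Qi" "Pi * H * Qi = dsum (0\<^sub>m l k) Ci"
    using prp.eqvE[OF Ci(3) H] by (metis k_def l_def)
  obtain P' where P': "pol.gl m P'" "P * P' = 1\<^sub>m m" "P' * P = 1\<^sub>m m" using pol.gl_inverse[OF PQ(1)] .
  obtain Q' where Q': "pol.gl n Q'" "Q * Q' = 1\<^sub>m n" "Q' * Q = 1\<^sub>m n" using pol.gl_inverse[OF PQ(2)] .
  obtain Pi' where Pi': "prp.gl m Pi'" "Pi * Pi' = 1\<^sub>m m" "Pi' * Pi = 1\<^sub>m m" using prp.gl_inverse[OF PQi(1)] .
  obtain Qi' where Qi': "prp.gl n Qi'" "Qi * Qi' = 1\<^sub>m n" "Qi' * Qi = 1\<^sub>m n" using prp.gl_inverse[OF PQi(2)] .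
  have c: "P \<in> carrier_mat m m" "Q \<in> carrier_mat n n" "P' \<in> carrier_mat m m" "Q' \<in> carrier_mat n n"
    "Pi \<in> carrier_mat m m" "Qi \<in> carrier_mat n n" "Pi' \<in> carrier_mat m m" "Qi' \<in> carrier_mat n n"
    using PQ P' Q' PQi Pi' Qi' pol.gl_carrier prp.gl_carrier by auto
  \<comment> \<open>Transition matrices between the two compressions. Each is a product of a
    unimodular and a biproper matrix, so its determinant has degree 0.\<close>
  define T S where "T = Q' * Qi" and "S = Pi * P'"
  have TS: "T \<in> carrier_mat n n" "S \<in> carrier_mat m m" using c by (auto simp: T_def S_def)
  have SDT: "S * dsum (0\<^sub>m l k) C * T = dsum (0\<^sub>m l k) Ci"
  proof -
    have "S * (P * H * Q) * T = Pi * (P' * (P * (H * (Q * (Q' * Qi)))))"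
      unfolding T_def S_def using c H by (simp add: mat_assoc)
    also have "Q * (Q' * Qi) = Qi" using mat_cancel[OF Q'(2)] c by simp
    also have "P' * (P * (H * Qi)) = H * Qi" using mat_cancel[OF P'(3)] c H by simp
    also have "Pi * (H * Qi) = Pi * H * Qi" using c H by (simp add: mat_assoc)
    finally show ?thesis using PQ(3) PQi(3) by simp
  qed
  obtain T11 T12 T21 T22 where T: "T11 \<in> carrier_mat k k" "T12 \<in> carrier_mat k r"
    "T21 \<in> carrier_mat r k" "T22 \<in> carrier_mat r r" "T = four_block_mat T11 T12 T21 T22"
    using four_block_mat_split[of T k r k r] TS(1) kl by metis
  obtain S11 S12 S21 S22 where S: "S11 \<in> carrier_mat l l" "S12 \<in> carrier_mat l r"
    "S21 \<in> carrier_mat r l" "S22 \<in> carrier_mat r r" "S = four_block_mat S11 S12 S21 S22"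
    using four_block_mat_split[of S l r l r] TS(2) kl by metis
  have "S * dsum (0\<^sub>m l k) C = four_block_mat (0\<^sub>m l k) (S12 * C) (0\<^sub>m r k) (S22 * C)"
    unfolding S(5) dsum_def using S(1-4) C(1)
    by (subst mult_four_block_mat[of _ l l _ r _ r _ _ k _ r]) auto
  also have "\<dots> * T = four_block_mat (S12 * C * T21) (S12 * C * T22) (S22 * C * T21) (S22 * C * T22)"
    unfolding T(5) using S(1-4) T(1-4) C(1)
    by (subst mult_four_block_mat[of _ l k _ r _ r _ _ k _ r]) auto
  finally have "four_block_mat (S12 * C * T21) (S12 * C * T22) (S22 * C * T21) (S22 * C * T22)
      = four_block_mat (0\<^sub>m l k) (0\<^sub>m l r) (0\<^sub>m r k) Ci"
    unfolding SDT using Ci(1) by (simp add: dsum_def)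
  note blocks = four_block_mat_inject[OF _ _ _ _ _ _ _ _ this, of l k r r]
  \<comment> \<open>As \<open>det Ci\<close> is nonzero, so are \<open>det S22\<close> and
    \<open>det T22\<close>. The two vanishing products then make \<open>T\<close> block upper and
    \<open>S\<close> block lower triangular.\<close>
  have b: "S12 * C * T22 = 0\<^sub>m l r" "S22 * C * T21 = 0\<^sub>m r k" "S22 * C * T22 = Ci"
    by (rule blocks; use S T C Ci in auto)+
  have dCi: "det Ci = det S22 * det C * det T22"
    unfolding b(3)[symmetric] using S T C by (simp add: det_mult[of _ r])
  hence nz: "det S22 \<noteq> 0" "det T22 \<noteq> 0" using Ci(2) by auto
  have T21: "T21 = 0\<^sub>m r k"
    using nonsingular_mult_eq_zero[of "S22 * C" r T21 k] b(2) S T C nz by (simp add: det_mult[of _ r])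
  have S12: "S12 = 0\<^sub>m l r"
    using mult_nonsingular_eq_zero[of "C * T22" r S12 l] b(1) S T C nz by (simp add: det_mult[of _ r] mat_assoc)
  have dT: "det T = det T11 * det T22" unfolding T(5) T21
    by (rule det_four_block_mat_lower_left_zero[OF T(1,2) _ T(4)]) simp
  have dS: "det S = det S11 * det S22" unfolding S(5) S12
    by (rule det_four_block_mat_upper_right_zero[OF S(1) _ S(3,4)]) simp
  have "det T = det Q' * det Qi" "det S = det Pi * det P'"
    using c by (auto simp: T_def S_def det_mult[of _ n] det_mult[of _ m])
  moreover have "rdeg (det Q') = 0" "rdeg (det Qi) = 0" "rdeg (det Pi) = 0" "rdeg (det P') = 0"
    "det Q' \<noteq> 0" "det Qi \<noteq> 0" "det Pi \<noteq> 0" "det P' \<noteq> 0"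
    using pol.gl_det[OF Q'(1)] pol.gl_det[OF P'(1)] prp.gl_det[OF PQi(1)] prp.gl_det[OF PQi(2)] by auto
  ultimately have r0: "rdeg (det T) = 0" "rdeg (det S) = 0" "det T \<noteq> 0" "det S \<noteq> 0"
    by (auto simp: rdeg_mult)
  have dT': "rdeg (det T11) = - rdeg (det T22)" 
    using r0(1,3) dT rdeg_mult[of "det T11" "det T22"] by auto
  have dS': "rdeg (det S11) = - rdeg (det S22)" 
    using r0(2,4) dS rdeg_mult[of "det S11" "det S22"] by auto
  define J where "J = (\<lambda>n k. mat n k (\<lambda>(i, j). if i = j then 1 else 0) :: 'a poly fract mat)"
  have nb: "null_basis (range to_fract) H k (Q * J n k) (transpose_mat (J n k) * Q')"
    unfolding k_def J_def using PQ Q' r C by (intro pol.null_basis_compressed[OF H, of P]) (auto simp: k_def l_def)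
  have ni: "null_basis {x. proper_rf x} H k (Qi * J n k) (transpose_mat (J n k) * Qi')"
    unfolding k_def J_def using PQi Qi' r Ci by (intro prp.null_basis_compressed[OF H, of Pi]) (auto simp: k_def l_def)
  have Jc: "J n k \<in> carrier_mat n k" "J m l \<in> carrier_mat m l" by (auto simp: J_def)
  \<comment> \<open>The change of basis between the two null bases is \<open>T11\<close>. The right
    indices sum to minus the degree of its determinant, which is the degree of
    \<open>det T22\<close>.\<close>
  have "transpose_mat (J n k) * Q' * (Qi * J n k) = transpose_mat (J n k) * (T * J n k)"
    unfolding T_def using c Jc by (simp add: mat_assoc)
  also have "\<dots> = T11" unfolding T(5) J_def by (rule top_left_block_mat[OF T(1,4) kl(1)])
  finally have right: "int (right_min_indices_sum H) = rdeg (det T22)"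
    using right_min_indices_sum_null_basis[OF H nb ni] dT' by simp
  \<comment> \<open>The left null space is treated by transposition: \<open>P\<close> and
    \<open>Q\<close> exchange their roles, and \<open>S11\<close> takes the place of
    \<open>T11\<close>.\<close>
  have Ht: "H\<^sup>T \<in> carrier_mat n m" using H by simp
  have tr: "Q0\<^sup>T * H\<^sup>T * P0\<^sup>T = transpose_mat (P0 * H * Q0)"
    if "P0 \<in> carrier_mat m m" "Q0 \<in> carrier_mat n n" for P0 Q0
    using that H by (simp add: transpose_mult[of _ m n _ n] transpose_mult[of _ m m _ n] mat_assoc)
  have PHQt: "Q\<^sup>T * H\<^sup>T * P\<^sup>T = dsum (0\<^sub>m (n - r) (m - r)) (C\<^sup>T)"
    unfolding tr[OF c(1,2)] PQ(3) dsum_transpose by (simp add: k_def l_def)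
  have PHQti: "Qi\<^sup>T * H\<^sup>T * Pi\<^sup>T = dsum (0\<^sub>m (n - r) (m - r)) (Ci\<^sup>T)"
    unfolding tr[OF c(5,6)] PQi(3) dsum_transpose by (simp add: k_def l_def)
  have inv: "P'\<^sup>T * P\<^sup>T = 1\<^sub>m m" "Pi'\<^sup>T * Pi\<^sup>T = 1\<^sub>m m"
    using P'(2) Pi'(2) transpose_mult[OF c(1,3)] transpose_mult[OF c(5,7)] transpose_one by metis+
  have nb': "null_basis (range to_fract) (H\<^sup>T) l (P\<^sup>T * J m l) (transpose_mat (J m l) * P'\<^sup>T)"
    unfolding l_def J_def
    by (rule pol.null_basis_compressed[OF Ht pol.gl_transpose[OF PQ(2)] pol.gl_transpose[OF PQ(1)] inv(1)
          pol.gl_transpose[OF P'(1)] r(2,1) _ _ PHQt]) (use C in \<open>auto simp: det_transpose[OF C(1)]\<close>)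
  have ni': "null_basis {x. proper_rf x} (H\<^sup>T) l (Pi\<^sup>T * J m l) (transpose_mat (J m l) * Pi'\<^sup>T)"
    unfolding l_def J_def
    by (rule prp.null_basis_compressed[OF Ht prp.gl_transpose[OF PQi(2)] prp.gl_transpose[OF PQi(1)] inv(2)
          prp.gl_transpose[OF Pi'(1)] r(2,1) _ _ PHQti]) (use Ci in \<open>auto simp: det_transpose[OF Ci(1)]\<close>)
  have "P'\<^sup>T * Pi\<^sup>T = S\<^sup>T"
    unfolding S_def using c by (simp add: transpose_mult[of _ m m _ m])
  hence "S\<^sup>T * J m l = P'\<^sup>T * (Pi\<^sup>T * J m l)"
    using c Jc mat_assoc[of "P'\<^sup>T" "Pi\<^sup>T" "J m l"] by simp
  hence "transpose_mat (J m l) * P'\<^sup>T * (Pi\<^sup>T * J m l)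
      = transpose_mat (J m l) * (S\<^sup>T * J m l)"
    using c Jc by (simp add: mat_assoc)
  also have "S\<^sup>T = four_block_mat (S11\<^sup>T) (S21\<^sup>T) (S12\<^sup>T) (S22\<^sup>T)"
    unfolding S(5) by (rule transpose_four_block_mat[OF S(1-4)])
  also have "transpose_mat (J m l) * (\<dots> * J m l) = S11\<^sup>T"
    unfolding J_def by (rule top_left_block_mat[of _ l _ r]) (use S kl in auto)
  finally have left: "int (right_min_indices_sum (H\<^sup>T)) = rdeg (det S22)"
    using right_min_indices_sum_null_basis[OF Ht nb' ni'] dS' det_transpose[OF S(1)] by simp
  \<comment> \<open>By \<open>dCi\<close>, the degrees of \<open>det S22\<close> and
    \<open>det T22\<close> together make up the difference of the degrees of the two cores.\<close>
  show ?thesis unfolding mu_def using left right dCi nz C(2) by (simp add: rdeg_mult)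
qed

section \<open>Rank and structure at infinity\<close>

context vec_space
begin

lemma rank_injective:
  assumes X: "X \<in> carrier_mat n r" and inj: "\<And>c. c \<in> carrier_vec r \<Longrightarrow> X *\<^sub>v c = 0\<^sub>v n \<Longrightarrow> c = 0\<^sub>v r"
  shows "rank X = r"
proof -
  have "distinct (cols X)"
  proof (rule ccontr)
    assume "\<not> distinct (cols X)"
    then obtain i j where ij: "i < r" "j < r" "i \<noteq> j" "col X i = col X j"
      using X by (auto simp: distinct_conv_nth)
    let ?c = "unit_vec r i - unit_vec r j :: 'a vec"
    have "X *\<^sub>v ?c = X *\<^sub>v unit_vec r i - X *\<^sub>v unit_vec r j"
      using X by (intro mult_minus_distrib_mat_vec) auto
    also have "X *\<^sub>v unit_vec r i = col X i" using X ij(1) by (intro eq_vecI) auto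
    also have "X *\<^sub>v unit_vec r j = col X j" using X ij(2) by (intro eq_vecI) auto
    also have "col X i - col X j = 0\<^sub>v n" unfolding ij(4) using X by (intro eq_vecI) auto
    finally have "?c = 0\<^sub>v r" using inj by simp
    hence "?c $ i = 0" using ij by simp
    thus False using ij by simp
  qed
  moreover have "lin_indpt (set (cols X))"
    using lin_depE[OF X _ \<open>distinct (cols X)\<close>] inj by blast
  ultimately show ?thesis using lin_indpt_full_rank[OF X] by blast
qed

text \<open>A surjective right factor leaves the column space unchanged.\<close>

lemma rank_full_factorization:
  assumes X: "X \<in> carrier_mat n r" and inj: "\<And>c. c \<in> carrier_vec r \<Longrightarrow> X *\<^sub>v c = 0\<^sub>v n \<Longrightarrow> c = 0\<^sub>v r"
    and Y: "Y \<in> carrier_mat r k" and surj: "\<And>c. c \<in> carrier_vec r \<Longrightarrow> \<exists>x \<in> carrier_vec k. Y *\<^sub>v x = c"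
  shows "rank (X * Y) = r"
proof -
  have "col_space (X * Y) = col_space X"
  proof -
    have 1: "\<exists>c \<in> carrier_vec r. X *\<^sub>v c = y" if "x \<in> carrier_vec k" "(X * Y) *\<^sub>v x = y" for x y
      using that X Y assoc_mult_mat_vec[OF X Y that(1)] by (intro bexI[of _ "Y *\<^sub>v x"]) auto
    have 2: "\<exists>x \<in> carrier_vec k. (X * Y) *\<^sub>v x = y" if c: "c \<in> carrier_vec r" "X *\<^sub>v c = y" for c y
    proof -
      obtain x where "x \<in> carrier_vec k" "Y *\<^sub>v x = c" using surj[OF c(1)] by blast
      thus ?thesis using c assoc_mult_mat_vec[OF X Y] by metis
    qed
    show ?thesis
      unfolding col_space_eq[OF X] col_space_eq[OF mult_carrier_mat[OF X Y]]
      using X Y 1 2 by auto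
  qed
  thus ?thesis using rank_injective[OF X inj] by (simp add: rank_def col_space_def)
qed

end

text \<open>The compressed matrix factors as \<open>JC * K\<close>, where \<open>K\<close> projects
  onto the last \<open>r\<close> coordinates and \<open>JC\<close> is injective because
  \<open>C\<close> is nonsingular.\<close>

lemma rank_compressed:
  fixes H :: "'b::field mat"
  assumes H: "H \<in> carrier_mat m n" and P: "P \<in> carrier_mat m m" "P' \<in> carrier_mat m m" "P * P' = 1\<^sub>m m"
    and Q: "Q \<in> carrier_mat n n" "Q' \<in> carrier_mat n n" "Q * Q' = 1\<^sub>m n"
    and r: "r \<le> m" "r \<le> n" and C: "C \<in> carrier_mat r r" "det C \<noteq> 0"
    and PHQ: "P * H * Q = dsum (0\<^sub>m (m - r) (n - r)) C"
  shows "vec_space.rank m H = r"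
proof -
  have P'P: "P' * P = 1\<^sub>m m" by (rule mat_mult_left_right_inverse[OF P])
  have Q'Q: "Q' * Q = 1\<^sub>m n" by (rule mat_mult_left_right_inverse[OF Q])
  define JC where "JC = mat m r (\<lambda>(i, j). if i < m - r then 0 else C $$ (i - (m - r), j))"
  define K where "K = (mat r n (\<lambda>(i, j). if j = n - r + i then 1 else 0) :: 'b mat)"
  have JC: "JC \<in> carrier_mat m r" and K: "K \<in> carrier_mat r n" by (auto simp: JC_def K_def)
  have D: "dsum (0\<^sub>m (m - r) (n - r)) C = JC * K"
  proof (rule eq_matI)
    fix i j assume "i < dim_row (JC * K)" "j < dim_col (JC * K)"
    hence ij: "i < m" "j < n" using JC K by auto
    have "(JC * K) $$ (i, j) = (\<Sum>t = 0..<r. JC $$ (i, t) * K $$ (t, j))"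
      by (rule index_mult_mat_sum[OF JC K ij])
    also have "\<dots> = (\<Sum>t = 0..<r. if n - r + t = j then JC $$ (i, j - (n - r)) else 0)"
      using ij by (intro sum.cong) (auto simp: K_def)
    also have "\<dots> = (if j < n - r then 0 else JC $$ (i, j - (n - r)))"
    proof (cases "j < n - r")
      case False
      hence "(\<lambda>t. if n - r + t = j then JC $$ (i, j - (n - r)) else 0) = (\<lambda>t. if t = j - (n - r) then JC $$ (i, j - (n - r)) else 0)"
        by (intro ext) auto
      moreover have "j - (n - r) < r" using False ij r by simp
      ultimately show ?thesis using False by (simp only:) simp
    qed (auto intro: sum.neutral)
    also have "\<dots> = dsum (0\<^sub>m (m - r) (n - r)) C $$ (i, j)"
      using ij C r by (auto simp: dsum_index JC_def)
    finally show "dsum (0\<^sub>m (m - r) (n - r)) C $$ (i, j) = (JC * K) $$ (i, j)" ..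
  qed (use JC K C r in auto)
  have "P' * (P * H * Q) * Q' = P' * (P * (H * (Q * Q')))" using P Q H by (simp add: mat_assoc)
  also have "\<dots> = H" using mat_cancel[OF P'P] P Q H by simp
  finally have "H = P' * (JC * K) * Q'" unfolding PHQ D by simp
  also have "\<dots> = (P' * JC) * (K * Q')" using P Q JC K by (simp add: mat_assoc)
  finally have HXY: "H = (P' * JC) * (K * Q')" .
  show ?thesis unfolding HXY
  proof (rule vec_space.rank_full_factorization)
    show "P' * JC \<in> carrier_mat m r" "K * Q' \<in> carrier_mat r n" using P Q JC K by auto
  next
    fix c assume c: "c \<in> carrier_vec r" "(P' * JC) *\<^sub>v c = 0\<^sub>v m"
    have "JC *\<^sub>v c = (P * P') *\<^sub>v (JC *\<^sub>v c)" using P JC c by simp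
    also have "\<dots> = P *\<^sub>v (P' *\<^sub>v (JC *\<^sub>v c))" using P JC c by (intro assoc_mult_mat_vec) auto
    also have "P' *\<^sub>v (JC *\<^sub>v c) = 0\<^sub>v m" using assoc_mult_mat_vec[OF P(2) JC c(1)] c(2) by simp
    also have "P *\<^sub>v 0\<^sub>v m = 0\<^sub>v m" using P by simp
    finally have z: "JC *\<^sub>v c = 0\<^sub>v m" .
    have "C *\<^sub>v c = 0\<^sub>v r"
    proof (rule eq_vecI)
      fix i assume "i < dim_vec (0\<^sub>v r :: 'b vec)"
      hence i: "i < r" by simp
      have "(C *\<^sub>v c) $ i = (\<Sum>t = 0..<r. C $$ (i, t) * c $ t)" by (rule index_mult_vec_sum[OF C(1) c(1) i])
      also have "\<dots> = (\<Sum>t = 0..<r. JC $$ (m - r + i, t) * c $ t)"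
        using i r by (intro sum.cong) (auto simp: JC_def)
      also have "\<dots> = (JC *\<^sub>v c) $ (m - r + i)"
        using i r by (intro index_mult_vec_sum[OF JC c(1), symmetric]) auto
      finally show "(C *\<^sub>v c) $ i = 0\<^sub>v r $ i" using z i r by simp
    qed (use C in simp)
    thus "c = 0\<^sub>v r" using det_0_iff_vec_prod_zero[OF C(1)] C(2) c(1) by blast
  next
    fix c :: "'b vec" assume c: "c \<in> carrier_vec r"
    define x where "x = vec n (\<lambda>j. if j < n - r then 0 else c $ (j - (n - r)))"
    have x: "x \<in> carrier_vec n" by (simp add: x_def)
    have "K *\<^sub>v x = c"
    proof (rule eq_vecI)
      fix i assume "i < dim_vec c"
      hence i: "i < r" using c by simp
      have "(K *\<^sub>v x) $ i = (\<Sum>t = 0..<n. K $$ (i, t) * x $ t)" by (rule index_mult_vec_sum[OF K x i])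
      also have "\<dots> = (\<Sum>t = 0..<n. if t = n - r + i then c $ i else 0)"
        using i r by (intro sum.cong) (auto simp: K_def x_def)
      also have "\<dots> = c $ i" using i r by simp
      finally show "(K *\<^sub>v x) $ i = c $ i" .
    qed (use K c in simp)
    moreover have "(K * Q') *\<^sub>v (Q *\<^sub>v x) = K *\<^sub>v ((Q' * Q) *\<^sub>v x)"
    proof -
      have "(K * Q') *\<^sub>v (Q *\<^sub>v x) = K *\<^sub>v (Q' *\<^sub>v (Q *\<^sub>v x))" using K Q x by (intro assoc_mult_mat_vec) auto
      thus ?thesis using assoc_mult_mat_vec[OF Q(2,1) x] by simp
    qed
    ultimately have "(K * Q') *\<^sub>v (Q *\<^sub>v x) = c" using Q'Q x by simp
    thus "\<exists>x\<in>carrier_vec n. (K * Q') *\<^sub>v x = c" using Q x by (intro bexI[of _ "Q *\<^sub>v x"]) auto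
  qed
qed

text \<open>Ensures that the polynomial and the proper compression of one matrix have cores of the
  same size.\<close>

lemma (in euclidean_subring) rank_eqv:
  assumes "H \<in> carrier_mat m n" "r \<le> m" "r \<le> n" "C \<in> carrier_mat r r" "det C \<noteq> 0"
    "eqv H (dsum (0\<^sub>m (m - r) (n - r)) C)"
  shows "vec_space.rank m H = r"
proof -
  obtain P Q where PQ: "gl m P" "gl n Q" "P * H * Q = dsum (0\<^sub>m (m - r) (n - r)) C"
    using eqvE[OF assms(6,1)] by metis
  obtain P' where P': "gl m P'" "P * P' = 1\<^sub>m m" using gl_inverse[OF PQ(1)] .
  obtain Q' where Q': "gl n Q'" "Q * Q' = 1\<^sub>m n" using gl_inverse[OF PQ(2)] .
  show ?thesis
    by (rule rank_compressed[of H m n P P' Q Q' r C]) (use PQ P' Q' assms gl_carrier in auto)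
qed

section \<open>The Smith form at infinity and the first invariant order\<close>

definition diag_lam :: "int list \<Rightarrow> 'a::field poly fract mat" where
  "diag_lam qs = mat (length qs) (length qs) (\<lambda>(i, j). if i = j then lam powi (- (qs ! i)) else 0)"

lemma diag_lam_dim [simp]: "dim_row (diag_lam qs) = length qs" "dim_col (diag_lam qs) = length qs"
  by (simp_all add: diag_lam_def)

lemma diag_lam_carrier [simp]: "diag_lam qs \<in> carrier_mat (length qs) (length qs)"
  by (simp add: diag_lam_def)

lemma diag_lam_Cons: "diag_lam (q # qs) = dsum (mat 1 1 (\<lambda>_. lam powi (- q))) (diag_lam qs)"
  by (rule eq_matI) (auto simp: diag_lam_def dsum_index nth_Cons')

lemma diag_lam_det: "det (diag_lam qs) \<noteq> 0"
proof -
  have "det (diag_lam qs) = prod_list (diag_mat (diag_lam qs))"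
    by (rule det_upper_triangular[of _ "length qs"]) (auto simp: diag_lam_def)
  also have "\<dots> \<noteq> 0" unfolding prod_list_diag_prod by (simp add: diag_lam_def)
  finally show ?thesis .
qed

text \<open>A nonzero rational function is a power of lambda times a unit of the ring of proper
  functions.\<close>

lemma eqv_normalize_entry:
  assumes "a \<noteq> 0"
  shows "prp.eqv (mat 1 1 (\<lambda>_. a)) (mat 1 1 (\<lambda>_. lam powi (rdeg a)))"
proof -
  define u where "u = lam powi (rdeg a) / a"
  have u: "u \<noteq> 0" "rdeg u = 0" using assms by (auto simp: u_def divide_inverse rdeg_mult rdeg_inverse)
  have "prp.gl 1 (mat 1 1 (\<lambda>_. u))"
    by (rule prp.gl_of_det) (use u in \<open>auto simp: mat_over_def proper_iff det_single\<close>)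
  moreover have "mat 1 1 (\<lambda>_. lam powi (rdeg a)) = mat 1 1 (\<lambda>_. u) * mat 1 1 (\<lambda>_. a) * 1\<^sub>m 1"
    using assms by (intro eq_matI) (auto simp: scalar_prod_def u_def)
  ultimately show ?thesis by (intro prp.eqvI[of _ 1 1 "mat 1 1 (\<lambda>_. u)" "1\<^sub>m 1"]) auto
qed

text \<open>Pivots are split off and normalized to powers of lambda. A pivot has least norm among
  the entries of all equivalent matrices, and the later pivots occur as such entries; this sorts the
  orders.\<close>

lemma smith_at_infinity:
  assumes "G \<in> carrier_mat m n"
  obtains qs where "sorted qs" "length qs \<le> m" "length qs \<le> n"
    "prp.eqv G (dsum (diag_lam qs) (0\<^sub>m (m - length qs) (n - length qs)))"
proof -
  have "\<exists>qs. sorted qs \<and> length qs \<le> m \<and> length qs \<le> n \<and>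
      prp.eqv G (dsum (diag_lam qs) (0\<^sub>m (m - length qs) (n - length qs)))"
    using assms
  proof (induction m arbitrary: n G)
    case (0 n G)
    have "G = dsum (diag_lam []) (0\<^sub>m 0 n)" using 0 by (intro eq_matI) auto
    thus ?case by (intro exI[of _ "[]"]) auto
  next
    case (Suc m n G)
    show ?case
    proof (cases "G = 0\<^sub>m (Suc m) n")
      case True
      hence "G = dsum (diag_lam []) (0\<^sub>m (Suc m) n)" by (intro eq_matI) (auto simp: dsum_index)
      thus ?thesis by (intro exI[of _ "[]"]) auto
    next
      case False
      obtain a C where a: "a \<noteq> 0" "n \<noteq> 0" "C \<in> carrier_mat m (n - 1)" "prp.eqv G (dsum (mat 1 1 (\<lambda>_. a)) C)"
        "\<And>B i j. prp.eqv G B \<Longrightarrow> i < Suc m \<Longrightarrow> j < n \<Longrightarrow> B $$ (i, j) \<noteq> 0 \<Longrightarrow> - rdeg a \<le> - rdeg (B $$ (i, j))"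
        using prp.pivot[OF Suc.prems False] by (metis diff_Suc_1)
      obtain qs where qs: "sorted qs" "length qs \<le> m" "length qs \<le> n - 1"
        "prp.eqv C (dsum (diag_lam qs) (0\<^sub>m (m - length qs) (n - 1 - length qs)))"
        using Suc.IH[OF a(3)] by blast
      define q where "q = - rdeg a"
      have "prp.eqv (dsum (mat 1 1 (\<lambda>_. a)) C) (dsum (mat 1 1 (\<lambda>_. lam powi (- q)))
          (dsum (diag_lam qs) (0\<^sub>m (m - length qs) (n - 1 - length qs))))"
        using prp.eqv_dsum[OF eqv_normalize_entry[OF a(1)] qs(4)] by (simp add: q_def)
      hence e: "prp.eqv G (dsum (diag_lam (q # qs)) (0\<^sub>m (m - length qs) (n - 1 - length qs)))"
        using prp.eqv_trans[OF a(4)] by (simp add: diag_lam_Cons dsum_assoc)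
      have "q \<le> hd qs" if "qs \<noteq> []"
      proof -
        have l: "0 < length qs" using that by simp
        have ent: "dsum (diag_lam (q # qs)) (0\<^sub>m (m - length qs) (n - 1 - length qs)) $$ (1, 1) = lam powi (- (qs ! 0))"
          using l by (subst dsum_index) (auto simp: diag_lam_def)
        have "- rdeg a \<le> - rdeg (lam powi (- (qs ! 0)) :: 'a poly fract)"
          using a(5)[OF e, of 1 1] l qs unfolding ent by fastforce
        thus ?thesis using that by (simp add: q_def hd_conv_nth)
      qed
      hence "sorted (q # qs)" using qs(1) by (cases qs) auto
      thus ?thesis using e qs a(2) by (intro exI[of _ "q # qs"]) auto
    qed
  qed
  thus ?thesis using that by blast
qed

lemma inv_orders_inf_exists:
  assumes G: "G \<in> carrier_mat m n"
  shows "\<exists>qs. inv_orders_inf G qs"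
proof -
  obtain qs where qs: "sorted qs" "length qs \<le> m" "length qs \<le> n"
    "prp.eqv G (dsum (diag_lam qs) (0\<^sub>m (m - length qs) (n - length qs)))"
    using smith_at_infinity[OF G] .
  have "prp.eqv G (dsum (0\<^sub>m (m - length qs) (n - length qs)) (diag_lam qs))"
    using prp.eqv_trans[OF qs(4) prp.eqv_dsum_swap] .
  hence "rf_rank G = length qs"
    unfolding rf_rank_def using prp.rank_eqv[OF G qs(2,3) diag_lam_carrier diag_lam_det] G by simp
  moreover obtain P Q where PQ: "prp.gl m P" "prp.gl n Q"
      "P * G * Q = dsum (diag_lam qs) (0\<^sub>m (m - length qs) (n - length qs))"
    using prp.eqvE[OF qs(4) G] by metis
  moreover have "dsum (diag_lam qs) (0\<^sub>m (m - length qs) (n - length qs))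
      = mat m n (\<lambda>(i, j). if i = j \<and> i < length qs then lam powi (- (qs ! i)) else 0)"
    using qs by (intro eq_matI) (auto simp: dsum_index diag_lam_def)
  ultimately have "inv_orders_inf G qs"
    unfolding inv_orders_inf_def using qs(1) G PQ prp.gl_carrier[OF PQ(1)] prp.gl_carrier[OF PQ(2)]
    by (intro conjI exI[of _ P] exI[of _ Q]) (auto simp: biproper_iff[of _ m] biproper_iff[of _ n])
  thus ?thesis ..
qed

definition rdeg_le :: "int \<Rightarrow> 'a::field poly fract \<Rightarrow> bool" where
  "rdeg_le k x \<longleftrightarrow> x = 0 \<or> rdeg x \<le> k"

lemma rdeg_le_sum: "(\<And>i. i \<in> I \<Longrightarrow> rdeg_le k (f i)) \<Longrightarrow> rdeg_le k (sum f I)"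
proof (induction I rule: infinite_finite_induct)
  case (insert x F)
  thus ?case using rdeg_add_le[of "f x" k "sum f F"] by (auto simp: rdeg_le_def)
qed (auto simp: rdeg_le_def)

lemma rdeg_le_mult: "proper_rf x \<Longrightarrow> rdeg_le k y \<Longrightarrow> rdeg_le k (x * y)"
  by (cases "x = 0 \<or> y = 0") (auto simp: rdeg_le_def proper_iff rdeg_mult)

lemma rdeg_le_mat_mult:
  assumes "mat_over {x. proper_rf x} P" "mat_over {x. proper_rf x} Q"
    "mat_over {x. rdeg_le k x} G" "dim_col P = dim_row G" "dim_col G = dim_row Q"
  shows "mat_over {x. rdeg_le k x} (P * G * Q)"
proof -
  have 1: "mat_over {x. rdeg_le k x} (P * G)"
    using assms by (auto simp: mat_over_def scalar_prod_def intro!: rdeg_le_sum rdeg_le_mult)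
  show ?thesis unfolding mat_over_def
  proof (intro allI impI)
    fix i j assume ij: "i < dim_row (P * G * Q)" "j < dim_col (P * G * Q)"
    have "(P * G * Q) $$ (i, j) = (\<Sum>t = 0..<dim_row Q. Q $$ (t, j) * (P * G) $$ (i, t))"
      using ij assms(4,5) by (subst index_mult_mat_sum[of "P * G" "dim_row P" "dim_row Q" Q "dim_col Q"])
        (auto simp: mult.commute)
    moreover have "rdeg_le k (\<Sum>t = 0..<dim_row Q. Q $$ (t, j) * (P * G) $$ (i, t))"
      using ij 1 assms by (intro rdeg_le_sum rdeg_le_mult) (auto simp: mat_over_def simp del: index_mult_mat(1))
    ultimately show "(P * G * Q) $$ (i, j) \<in> {x. rdeg_le k x}" by simp
  qed
qed

text \<open>Proper factors do not raise degrees, so \<open>G\<close> and its Smith form obey the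
  same degree bounds, and the largest degree in the form is \<open>- hd qs\<close>. Hence all lists
  of invariant orders share their head, and the choice in \<open>first_inv_order\<close> is
  unambiguous.\<close>

lemma inv_orders_inf_hd:
  assumes G: "G \<in> carrier_mat m n" and qs: "inv_orders_inf G qs" "qs \<noteq> []"
  shows "mat_over {x. rdeg_le k x} G \<longleftrightarrow> - hd qs \<le> k"
proof -
  define S where "S = (mat m n (\<lambda>(i, j). if i = j \<and> i < length qs then lam powi (- (qs ! i)) else 0) :: 'a poly fract mat)"
  obtain P Q where PQ: "P \<in> carrier_mat m m" "Q \<in> carrier_mat n n" "biproper P" "biproper Q" "P * G * Q = S"
    and srt: "sorted qs" and len: "length qs = rf_rank G"
    using qs(1) G unfolding inv_orders_inf_def S_def by auto
  have gl: "prp.gl m P" "prp.gl n Q" using PQ biproper_iff by auto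
  have eqv: "prp.eqv G S" using prp.eqvI[OF G gl] PQ(5) by simp
  obtain P' Q' where PQ': "prp.gl m P'" "prp.gl n Q'" "G = P' * S * Q'"
    using prp.eqvE[OF prp.eqv_sym[OF eqv], of m n] by (auto simp: S_def)
  have hd: "hd qs = qs ! 0" using qs(2) by (rule hd_conv_nth)
  \<comment> \<open>A nonempty list means positive rank, so the entry (0, 0) of the Smith form
    exists.\<close>
  have mn: "m \<noteq> 0" "n \<noteq> 0"
  proof -
    obtain r C where C: "r \<le> m" "r \<le> n" "C \<in> carrier_mat r r" "det C \<noteq> 0"
      "prp.eqv G (dsum (0\<^sub>m (m - r) (n - r)) C)" using prp.compression[OF G] .
    have "length qs = r" unfolding len rf_rank_def using prp.rank_eqv[OF G C] G by simp
    moreover have "length qs \<noteq> 0" using qs(2) by simp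
    ultimately show "m \<noteq> 0" "n \<noteq> 0" using C(1,2) by linarith+
  qed
  have "mat_over {x. rdeg_le k x} G \<longleftrightarrow> mat_over {x. rdeg_le k x} S"
  proof
    assume "mat_over {x. rdeg_le k x} G"
    thus "mat_over {x. rdeg_le k x} S" unfolding PQ(5)[symmetric]
      using gl PQ G by (intro rdeg_le_mat_mult) (auto simp: prp.gl_def)
  next
    assume "mat_over {x. rdeg_le k x} S"
    thus "mat_over {x. rdeg_le k x} G" unfolding PQ'(3)
      using PQ' prp.gl_carrier[OF PQ'(1)] prp.gl_carrier[OF PQ'(2)]
      by (intro rdeg_le_mat_mult) (auto simp: prp.gl_def S_def)
  qed
  also have "\<dots> \<longleftrightarrow> - hd qs \<le> k"
  proof
    assume "mat_over {x. rdeg_le k x} S"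
    moreover have "S \<in> carrier_mat m n" by (simp add: S_def)
    ultimately have "rdeg_le k (S $$ (0, 0))" using mn unfolding mat_over_def by auto
    thus "- hd qs \<le> k" using mn qs(2) by (simp add: S_def rdeg_le_def hd)
  next
    assume k: "- hd qs \<le> k"
    have "- (qs ! i) \<le> k" if "i < length qs" for i
      using k sorted_nth_mono[OF srt, of 0 i] that hd by simp
    thus "mat_over {x. rdeg_le k x} S" by (auto simp: mat_over_def S_def rdeg_le_def)
  qed
  finally show ?thesis .
qed

text \<open>Here \<open>d\<close> is the largest degree of an entry, cut off at 0 like
  \<open>gexp\<close> itself; it has to be attained only when positive. A zero matrix has no first
  invariant order, so its \<open>gexp\<close> is an arbitrary choice.\<close>

lemma gexp_eq:
  assumes G: "G \<in> carrier_mat m n" and nz: "G \<noteq> 0\<^sub>m m n"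
    and le: "mat_over {x. rdeg_le (int d) x} G"
    and attained: "0 < d \<Longrightarrow> \<not> mat_over {x. rdeg_le (int d - 1) x} G"
  shows "gexp G = - int d"
proof -
  have *: "min 0 (hd qs) = - int d" if "inv_orders_inf G qs" "qs \<noteq> []" for qs
    using inv_orders_inf_hd[OF G that, of "int d"] inv_orders_inf_hd[OF G that, of "int d - 1"] le attained
    by (cases "d = 0") auto
  obtain qs where qs: "inv_orders_inf G qs" using inv_orders_inf_exists[OF G] by blast
  have "qs \<noteq> []"
  proof
    assume "qs = []"
    then obtain P Q where PQ: "P \<in> carrier_mat m m" "Q \<in> carrier_mat n n" "biproper P" "biproper Q"
      "P * G * Q = mat m n (\<lambda>(i, j). 0)"
      using qs G unfolding inv_orders_inf_def by auto
    have gl: "prp.gl m P" "prp.gl n Q" using PQ biproper_iff by auto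
    have "mat m n (\<lambda>(i, j). 0) = (0\<^sub>m m n :: 'a poly fract mat)" by (intro eq_matI) auto
    hence "prp.eqv G (0\<^sub>m m n)" using prp.eqvI[OF G gl] PQ(5) by metis
    from prp.eqv_sym[OF this] obtain P' Q' where PQ': "prp.gl m P'" "prp.gl n Q'" "G = P' * 0\<^sub>m m n * Q'"
      using prp.eqvE[OF _ zero_carrier_mat] by metis
    hence "G = 0\<^sub>m m n" using prp.gl_carrier[OF PQ'(1)] prp.gl_carrier[OF PQ'(2)] by simp
    thus False using nz by simp
  qed
  hence "\<exists>q. \<exists>qs. inv_orders_inf G qs \<and> qs \<noteq> [] \<and> hd qs = q" using qs by blast
  from someI_ex[OF this] obtain qs' where "inv_orders_inf G qs'" "qs' \<noteq> []" "hd qs' = first_inv_order G"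
    unfolding first_inv_order_def by blast
  thus ?thesis using * unfolding gexp_def by metis
qed

text \<open>A strictly proper summand does not affect a nonnegative degree bound. This links the
  degree of the polynomial part with the exponent \<open>gexp G\<close>.\<close>

lemma rdeg_le_poly_part:
  assumes "0 \<le> k"
  shows "rdeg_le k x \<longleftrightarrow> int (degree (poly_part_rf x)) \<le> k"
proof -
  define q where "q = poly_part_rf x"
  have sp: "strictly_proper_rf (x - to_fract q)"
    unfolding q_def poly_part_rf_def by (rule someI_ex[OF poly_part_exists])
  hence "rdeg_le k (x - to_fract q)" "rdeg_le k (- (x - to_fract q))"
    using assms strictly_proper_uminus[OF sp] by (auto simp: rdeg_le_def strictly_proper_iff)
  hence "rdeg_le k x \<longleftrightarrow> rdeg_le k (to_fract q)"
    using rdeg_add_le[of "x - to_fract q" k "to_fract q"]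
      rdeg_add_le[of x k "- (x - to_fract q)"] unfolding rdeg_le_def by fastforce
  thus ?thesis using assms unfolding q_def[symmetric] 
    by (cases "q = 0") (auto simp: rdeg_le_def rdeg_to_fract)
qed

lemma mat_degree_le_iff: "mat_degree P \<le> k \<longleftrightarrow> (\<forall>i < dim_row P. \<forall>j < dim_col P. degree (P $$ (i, j)) \<le> k)"
proof -
  have "finite {degree (P $$ (i, j)) | i j. i < dim_row P \<and> j < dim_col P}"
    by (rule finite_image_set2) auto
  thus ?thesis unfolding mat_degree_def by (subst Max_le_iff) auto
qed

lemma gexp_eq_poly_part:
  assumes G: "G \<in> carrier_mat m n" and nz: "G \<noteq> 0\<^sub>m m n"
  shows "gexp G = - int (mat_degree (poly_part_mat G))"
proof -
  have *: "mat_over {x. rdeg_le (int k) x} G \<longleftrightarrow> mat_degree (poly_part_mat G) \<le> k" for k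
    unfolding mat_degree_le_iff mat_over_def by (auto simp: poly_part_mat_def rdeg_le_poly_part)
  show ?thesis
  proof (rule gexp_eq[OF G nz])
    assume "0 < mat_degree (poly_part_mat G)"
    thus "\<not> mat_over {x. rdeg_le (int (mat_degree (poly_part_mat G)) - 1) x} G"
      using *[of "mat_degree (poly_part_mat G) - 1"] by (simp add: of_nat_diff)
  qed (simp add: *)
qed

section \<open>Index sums under finite equivalence and scaled equivalence at infinity\<close>

lemma (in euclidean_subring) eqv_smult:
  assumes "eqv A B"
  shows "eqv (c \<cdot>\<^sub>m A) (c \<cdot>\<^sub>m B)"
proof -
  define m n where mn: "m = dim_row A" "n = dim_col A"
  have A: "A \<in> carrier_mat m n" by (auto simp: mn)
  obtain P Q where PQ: "gl m P" "gl n Q" "B = P * A * Q" using assms eqvE A by blast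
  have c: "P \<in> carrier_mat m m" "Q \<in> carrier_mat n n" using PQ gl_carrier by auto
  have "c \<cdot>\<^sub>m B = P * (c \<cdot>\<^sub>m A) * Q" unfolding PQ using c A
    by (simp add: mult_smult_assoc_mat[of _ m n _ n] mult_smult_distrib[of _ m m _ n])
  thus ?thesis using PQ A by (intro eqvI[of _ m n P Q]) auto
qed

lemma smult_zero_mat [simp]: "c \<cdot>\<^sub>m 0\<^sub>m a b = (0\<^sub>m a b :: 'b::mult_zero mat)"
  by (rule eq_matI) auto

lemma smult_smult_mat: "a \<cdot>\<^sub>m (b \<cdot>\<^sub>m A) = (a * b) \<cdot>\<^sub>m A" for A :: "'b::semigroup_mult mat"
  by (rule eq_matI) (auto simp: mult.assoc)

lemma rdeg_power: "x \<noteq> 0 \<Longrightarrow> rdeg (x ^ n) = int n * rdeg x"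
  by (induction n) (auto simp: rdeg_mult algebra_simps)

text \<open>\<open>Gh\<close> has the polynomial core of \<open>G\<close> enlarged by an identity
  block. Its core at infinity is \<open>Ci1\<close>, whose determinant gains \<open>g\<close> for
  each of the \<open>r\<close> rows of \<open>Ci\<close> and \<open>- gh\<close> for each of the
  \<open>r + s\<close> rows of the enlarged core.\<close>

lemma mu_equivalence:
  fixes G Gh :: "'a::field poly fract mat"
  assumes G: "G \<in> carrier_mat p m"
    and fin: "pol.eqv (dsum G (1\<^sub>m s)) Gh"
    and inf: "prp.eqv (dsum ((lam powi g) \<cdot>\<^sub>m G) (1\<^sub>m s)) ((lam powi gh) \<cdot>\<^sub>m Gh)"
  shows "int (mu Gh) = int (mu G) + g * int (rf_rank G) - gh * int (rf_rank G + s)"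
proof -
  obtain r C where C: "r \<le> p" "r \<le> m" "C \<in> carrier_mat r r" "det C \<noteq> 0"
    "pol.eqv G (dsum (0\<^sub>m (p - r) (m - r)) C)" using pol.compression[OF G] .
  obtain r' Ci where Ci': "r' \<le> p" "r' \<le> m" "Ci \<in> carrier_mat r' r'" "det Ci \<noteq> 0"
    "prp.eqv G (dsum (0\<^sub>m (p - r') (m - r')) Ci)" using prp.compression[OF G] .
  have "rf_rank G = r" "rf_rank G = r'"
    using pol.rank_eqv[OF G C] prp.rank_eqv[OF G Ci'] G by (simp_all add: rf_rank_def)
  hence r: "r' = r" "rf_rank G = r" by simp_all
  note Ci = Ci'[unfolded r(1)]
  let ?Z = "0\<^sub>m (p - r) (m - r) :: 'a poly fract mat"
  \<comment> \<open>The identity block raises the dimensions and the rank alike, so the zero block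
    keeps its size.\<close>
  have z: "p - r = (p + s) - (r + s)" "m - r = (m + s) - (r + s)" by simp_all
  have Gh: "Gh \<in> carrier_mat (p + s) (m + s)"
    using pol.eqv_carrier[OF fin] G by simp
  have muG: "int (mu G) = rdeg (det Ci) - rdeg (det C)" by (rule mu_eq[OF G C(1-5) Ci(3-5)])
  define C1 where "C1 = dsum C (1\<^sub>m s)"
  define Ci1 where "Ci1 = lam powi (- gh) \<cdot>\<^sub>m dsum (lam powi g \<cdot>\<^sub>m Ci) (1\<^sub>m s)"
  have C1: "C1 \<in> carrier_mat (r + s) (r + s)" "det C1 = det C" 
    using C(3) dsum_det[OF C(3), of "1\<^sub>m s" s] by (auto simp: C1_def)
  have Ci1: "Ci1 \<in> carrier_mat (r + s) (r + s)" using Ci(3) by (auto simp: Ci1_def)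
  have "det Ci1 = (lam powi (- gh)) ^ (r + s) * ((lam powi g) ^ r * det Ci)"
    using Ci(3) dsum_det[of "lam powi g \<cdot>\<^sub>m Ci" r "1\<^sub>m s" s] by (simp add: Ci1_def det_smult)
  hence dCi1: "det Ci1 \<noteq> 0" "rdeg (det Ci1) = - gh * int (r + s) + g * int r + rdeg (det Ci)"
    using Ci(4) by (simp_all add: rdeg_mult rdeg_power algebra_simps)
  have "pol.eqv (dsum G (1\<^sub>m s)) (dsum ?Z C1)"
    using pol.eqv_dsum[OF C(5) pol.eqv_refl] by (simp add: C1_def dsum_assoc)
  hence 1: "pol.eqv Gh (dsum ?Z C1)" using pol.eqv_trans[OF pol.eqv_sym[OF fin]] by blast
  have "prp.eqv (lam powi g \<cdot>\<^sub>m G) (dsum ?Z (lam powi g \<cdot>\<^sub>m Ci))"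
    using prp.eqv_smult[OF Ci(5), of "lam powi g"] by (simp add: dsum_smult)
  from prp.eqv_dsum[OF this prp.eqv_refl, of "1\<^sub>m s"]
  have "prp.eqv (dsum (lam powi g \<cdot>\<^sub>m G) (1\<^sub>m s)) (dsum ?Z (dsum (lam powi g \<cdot>\<^sub>m Ci) (1\<^sub>m s)))"
    by (simp add: dsum_assoc)
  hence "prp.eqv (lam powi gh \<cdot>\<^sub>m Gh) (dsum ?Z (dsum (lam powi g \<cdot>\<^sub>m Ci) (1\<^sub>m s)))"
    using prp.eqv_trans[OF prp.eqv_sym[OF inf]] by blast
  from prp.eqv_smult[OF this, of "lam powi (- gh)"]
  have "prp.eqv ((lam powi (- gh) * lam powi gh) \<cdot>\<^sub>m Gh) (dsum ?Z Ci1)"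
    by (simp add: smult_smult_mat dsum_smult Ci1_def)
  moreover have "lam powi (- gh) * lam powi gh = (1 :: 'a poly fract)"
    by (simp flip: power_int_add)
  moreover have "1 \<cdot>\<^sub>m Gh = Gh" by (rule eq_matI) auto
  ultimately have 2: "prp.eqv Gh (dsum ?Z Ci1)" by simp
  have "int (mu Gh) = rdeg (det Ci1) - rdeg (det C1)"
    using 1 2 C1 C Ci1 dCi1(1) unfolding z by (intro mu_eq[OF Gh, of "r + s"]) auto
  thus ?thesis using muG dCi1(2) C1(2) r by (simp add: algebra_simps)
qed

section \<open>Coprime factorizations of least order\<close>

lemma mat_inv_sq:
  fixes A :: "'b::field mat"
  assumes "A \<in> carrier_mat n n" "det A \<noteq> 0"
  shows "mat_inv_sq A \<in> carrier_mat n n" "A * mat_inv_sq A = 1\<^sub>m n" "mat_inv_sq A * A = 1\<^sub>m n"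
proof -
  obtain B where "B \<in> carrier_mat n n" "A * B = 1\<^sub>m n" "B * A = 1\<^sub>m n" using det_nonzero_inverse[OF assms] .
  hence "\<exists>B. B \<in> carrier_mat (dim_row A) (dim_row A) \<and> A * B = 1\<^sub>m (dim_row A) \<and> B * A = 1\<^sub>m (dim_row A)"
    using assms by auto
  from someI_ex[OF this] show "mat_inv_sq A \<in> carrier_mat n n" "A * mat_inv_sq A = 1\<^sub>m n" "mat_inv_sq A * A = 1\<^sub>m n"
    using assms unfolding mat_inv_sq_def by auto
qed

lemma mat_inv_sq_eqI:
  fixes A :: "'b::field mat"
  assumes "A \<in> carrier_mat n n" "B \<in> carrier_mat n n" "B * A = 1\<^sub>m n"
  shows "mat_inv_sq A = B"
proof -
  have "det A \<noteq> 0" using det_mult_inverse[OF assms(2,1,3)] by auto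
  note inv = mat_inv_sq[OF assms(1) this]
  show ?thesis using square_inverse_unique[OF assms(1,2) inv(1) assms(3) inv(2)] by simp
qed

lemma mat_inv_sq_transpose:
  fixes A :: "'b::field mat"
  assumes "A \<in> carrier_mat n n" "det A \<noteq> 0"
  shows "mat_inv_sq (A\<^sup>T) = transpose_mat (mat_inv_sq A)"
proof (rule mat_inv_sq_eqI)
  note inv = mat_inv_sq[OF assms]
  show "transpose_mat (mat_inv_sq A) * A\<^sup>T = 1\<^sub>m n"
    using transpose_mult[OF assms(1) inv(1)] inv(2) by simp
qed (use assms mat_inv_sq[OF assms] in auto)

definition vec_over :: "'b set \<Rightarrow> 'b vec \<Rightarrow> bool" where
  "vec_over R v \<longleftrightarrow> (\<forall>i < dim_vec v. v $ i \<in> R)"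

lemma (in euclidean_subring) vec_over_mult_mat_vec:
  "mat_over R A \<Longrightarrow> vec_over R v \<Longrightarrow> dim_col A = dim_vec v \<Longrightarrow> vec_over R (A *\<^sub>v v)"
  by (auto simp: vec_over_def mat_over_def scalar_prod_def intro!: sum_in mult_in)

lemma (in euclidean_subring) vec_over_uminus: "vec_over R v \<Longrightarrow> vec_over R (- v)"
  by (auto simp: vec_over_def intro: uminus_in)

lemma vec_over_map_vec [simp]: "vec_over (range f) (map_vec f v)"
  by (auto simp: vec_over_def)

lemma vec_over_append: "vec_over R u \<Longrightarrow> vec_over R v \<Longrightarrow> vec_over R (u @\<^sub>v v)"
  by (auto simp: vec_over_def)

text \<open>Makes the \<open>LEAST\<close> in \<open>right_min_indices_sum\<close> a value that some
  basis attains.\<close>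

lemma is_poly_basis_right_exists:
  assumes H: "H \<in> carrier_mat m n"
  shows "\<exists>bs. is_poly_basis_right H bs"
proof -
  obtain r C where C: "r \<le> m" "r \<le> n" "C \<in> carrier_mat r r" "det C \<noteq> 0"
      "pol.eqv H (dsum (0\<^sub>m (m - r) (n - r)) C)"
    using pol.compression[OF H] .
  obtain P Q where PQ: "pol.gl m P" "pol.gl n Q" "P * H * Q = dsum (0\<^sub>m (m - r) (n - r)) C"
    using pol.eqvE[OF C(5) H] by metis
  obtain Q' where Q': "pol.gl n Q'" "Q * Q' = 1\<^sub>m n" "Q' * Q = 1\<^sub>m n" using pol.gl_inverse[OF PQ(2)] .
  obtain M M' where nb: "null_basis (range to_fract) H (n - r) M M'"
    using pol.null_basis_compressed[OF H PQ(1,2) Q'(3,1) C(1-4) PQ(3)] by blast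
  obtain Mp where Mp: "Mp \<in> carrier_mat n (n - r)" "M = map_mat to_fract Mp"
    using mat_over_to_fractD[of M n "n - r"] nb H by (auto simp: null_basis_def)
  show ?thesis using poly_basis_of_unimodular(1)[OF H nb[unfolded Mp(2)] Mp(1) one_carrier_mat] by auto
qed

lemma proper_mult_degree_le:
  assumes A: "A \<in> carrier_mat m n" "mat_over {x. proper_rf x} A"
    and v: "v \<in> carrier_vec n" and w: "map_vec to_fract w = A *\<^sub>v map_vec to_fract v"
  shows "poly_vec_degree w \<le> poly_vec_degree v"
  unfolding poly_vec_degree_le_iff
proof (intro allI impI)
  fix i assume "i < dim_vec w"
  moreover have "dim_vec w = m" using arg_cong[OF w, of dim_vec] A by simp
  ultimately have i: "i < m" "i < dim_vec w" by auto
  have "to_fract (w $ i) = (map_vec to_fract w) $ i" using i by simp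
  also have "\<dots> = (\<Sum>t = 0..<n. A $$ (i, t) * to_fract (v $ t))"
    unfolding w using v i by (subst index_mult_vec_sum[OF A(1)]) auto
  finally have "to_fract (w $ i) = (\<Sum>t = 0..<n. A $$ (i, t) * to_fract (v $ t))" .
  moreover have "rdeg_le (int (poly_vec_degree v)) (\<Sum>t = 0..<n. A $$ (i, t) * to_fract (v $ t))"
  proof (intro rdeg_le_sum rdeg_le_mult)
    fix t assume t: "t \<in> {0..<n}"
    show "proper_rf (A $$ (i, t))" using A i t by (auto simp: mat_over_def)
    have "degree (v $ t) \<le> poly_vec_degree v" using v t by (intro degree_le_poly_vec_degree) auto
    thus "rdeg_le (int (poly_vec_degree v)) (to_fract (v $ t))"
      by (cases "v $ t = 0") (auto simp: rdeg_le_def rdeg_to_fract)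
  qed
  ultimately have "rdeg_le (int (poly_vec_degree v)) (to_fract (w $ i))" by simp
  thus "degree (w $ i) \<le> poly_vec_degree v"
    by (cases "w $ i = 0") (auto simp: rdeg_le_def rdeg_to_fract)
qed

text \<open>Transports a basis of least degree sum. \<open>M\<close> maps one null space bijectively
  to the other, keeps polynomial vectors polynomial by \<open>poly\<close>, and does not raise
  degrees because it is proper. Two such maps in opposite directions give equality.\<close>

lemma right_min_indices_sum_le:
  fixes H1 H2 :: "'a::field poly fract mat"
  assumes H1: "H1 \<in> carrier_mat m1 n1" and H2: "H2 \<in> carrier_mat m2 n2"
    and M: "M \<in> carrier_mat n2 n1" "mat_over {x. proper_rf x} M"
    and into: "\<And>x. x \<in> carrier_vec n1 \<Longrightarrow> H1 *\<^sub>v x = 0\<^sub>v m1 \<Longrightarrow> H2 *\<^sub>v (M *\<^sub>v x) = 0\<^sub>v m2 \<and> f (M *\<^sub>v x) = x"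
    and onto: "\<And>y. y \<in> carrier_vec n2 \<Longrightarrow> H2 *\<^sub>v y = 0\<^sub>v m2 \<Longrightarrow>
        f y \<in> carrier_vec n1 \<and> H1 *\<^sub>v f y = 0\<^sub>v m1 \<and> M *\<^sub>v f y = y"
    and poly: "\<And>x. x \<in> carrier_vec n1 \<Longrightarrow> H1 *\<^sub>v x = 0\<^sub>v m1 \<Longrightarrow> vec_over (range to_fract) x \<Longrightarrow>
        vec_over (range to_fract) (M *\<^sub>v x)"
  shows "right_min_indices_sum H2 \<le> right_min_indices_sum H1"
proof -
  have "\<exists>t bs. is_poly_basis_right H1 bs \<and> t = (\<Sum>b\<leftarrow>bs. poly_vec_degree b)"
    using is_poly_basis_right_exists[OF H1] by blast
  from LeastI_ex[OF this] obtain bs where bs: "is_poly_basis_right H1 bs"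
    "right_min_indices_sum H1 = (\<Sum>b\<leftarrow>bs. poly_vec_degree b)" unfolding right_min_indices_sum_def by blast
  define l where "l = length bs"
  note b = bs(1)[unfolded is_poly_basis_right_iff[OF H1], folded l_def]
  have bc: "bs ! j \<in> carrier_vec n1" if "j < l" for j using b that by (auto simp: l_def)
  define B where "B = basis_mat n1 bs"
  have B: "B \<in> carrier_mat n1 l" by (simp add: B_def l_def)
  have colB: "col B j = map_vec to_fract (bs ! j)" if "j < l" for j
    using that bc[OF that] by (intro eq_vecI) (auto simp: B_def l_def basis_mat_index)
  have nullB: "H1 *\<^sub>v map_vec to_fract (bs ! j) = 0\<^sub>v m1" if "j < l" for j
  proof -
    have "H1 *\<^sub>v col B j = col (H1 * B) j" 
      by (rule col_mult_mat_vec[symmetric]) (use that H1 B in auto)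
    also have "\<dots> = 0\<^sub>v m1" using b that by (simp add: B_def)
    finally show ?thesis using colB[OF that] by simp
  qed
  have "\<exists>w. map_vec to_fract w = M *\<^sub>v map_vec to_fract (bs ! j)" if j: "j < l" for j
  proof -
    have "vec_over (range to_fract) (M *\<^sub>v map_vec to_fract (bs ! j))"
      using poly[OF _ nullB[OF j]] bc[OF j] by simp
    then obtain w where "\<And>i. i < n2 \<Longrightarrow> (M *\<^sub>v map_vec to_fract (bs ! j)) $ i = to_fract (w i)"
      using M by (simp add: vec_over_def image_iff) metis
    thus ?thesis using M by (intro exI[of _ "vec n2 w"] eq_vecI) auto
  qed
  then obtain w where w: "\<And>j. j < l \<Longrightarrow> map_vec to_fract (w j) = M *\<^sub>v map_vec to_fract (bs ! j)" by metis
  define bs' where "bs' = map w [0..<l]"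
  have l': "length bs' = l" by (simp add: bs'_def)
  have wc: "w j \<in> carrier_vec n2" if "j < l" for j
    using arg_cong[OF w[OF that], of dim_vec] M by (auto intro: carrier_vecI)
  have B': "basis_mat n2 bs' = M * B"
  proof (rule mat_eqI_cols[of _ n2 l])
    fix j assume j: "j < l"
    have "col (basis_mat n2 bs') j = map_vec to_fract (w j)"
      using j wc[OF j] by (intro eq_vecI) (auto simp: basis_mat_index l' bs'_def)
    also have "\<dots> = col (M * B) j" using j M B by (simp add: w colB col_mult_mat_vec del: col_mult)
    finally show "col (basis_mat n2 bs') j = col (M * B) j" .
  qed (use l' M B in \<open>auto intro!: carrier_matI\<close>)
  \<comment> \<open>Nothing is assumed about linearity of \<open>f\<close>, so its value at 0 is
    read off from \<open>into\<close>.\<close>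
  have f0: "f (0\<^sub>v n2) = 0\<^sub>v n1" using into[of "0\<^sub>v n1"] H1 M by simp
  have inB: "H1 *\<^sub>v (B *\<^sub>v c) = 0\<^sub>v m1" if c: "c \<in> carrier_vec l" for c
  proof -
    have "H1 *\<^sub>v (B *\<^sub>v c) = (H1 * B) *\<^sub>v c" using H1 B c by (intro assoc_mult_mat_vec[symmetric]) auto
    also have "\<dots> = 0\<^sub>v m1" using b c by (auto simp: B_def intro!: eq_vecI)
    finally show ?thesis .
  qed
  have MB: "(M * B) *\<^sub>v c = M *\<^sub>v (B *\<^sub>v c)" if "c \<in> carrier_vec l" for c
    using M B that by (intro assoc_mult_mat_vec) auto
  have "is_poly_basis_right H2 bs'"
    unfolding is_poly_basis_right_iff[OF H2] l' B'
  proof (intro conjI ballI impI)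
    show "set bs' \<subseteq> carrier_vec n2" using wc by (auto simp: bs'_def)
    show "H2 * (M * B) = 0\<^sub>m m2 l"
    proof (rule mat_eqI_cols[of _ m2 l])
      fix j assume j: "j < l"
      have "col (H2 * (M * B)) j = H2 *\<^sub>v (M *\<^sub>v col B j)"
        using j H2 M B by (simp add: col_mult_mat_vec del: col_mult)
      thus "col (H2 * (M * B)) j = col (0\<^sub>m m2 l) j"
        using into[OF _ nullB[OF j]] bc[OF j] j by (simp add: colB)
    qed (use H2 M B in auto)
  next
    fix c assume c: "c \<in> carrier_vec l" "(M * B) *\<^sub>v c = 0\<^sub>v n2"
    have "B *\<^sub>v c = f (M *\<^sub>v (B *\<^sub>v c))" using into[OF _ inB[OF c(1)]] B c by simp
    also have "\<dots> = 0\<^sub>v n1" using MB[OF c(1)] c(2) f0 by simp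
    finally show "c = 0\<^sub>v l" using b c by (simp add: B_def)
  next
    fix y assume y: "y \<in> carrier_vec n2" "H2 *\<^sub>v y = 0\<^sub>v m2"
    obtain c where c: "c \<in> carrier_vec l" "f y = B *\<^sub>v c"
      using b onto[OF y] unfolding B_def by blast
    have "y = (M * B) *\<^sub>v c" using MB[OF c(1)] onto[OF y] c(2) by simp
    thus "\<exists>c\<in>carrier_vec l. y = (M * B) *\<^sub>v c" using c by blast
  qed
  hence "right_min_indices_sum H2 \<le> (\<Sum>b\<leftarrow>bs'. poly_vec_degree b)"
    unfolding right_min_indices_sum_def by (intro Least_le) blast
  also have "\<dots> = (\<Sum>j<l. poly_vec_degree (w j))"
    by (simp add: sum_list_map_nth l') (simp add: bs'_def)
  also have "\<dots> \<le> (\<Sum>j<l. poly_vec_degree (bs ! j))"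
    using proper_mult_degree_le[OF M] bc w by (intro sum_mono) auto
  also have "\<dots> = right_min_indices_sum H1" unfolding bs(2) by (simp add: sum_list_map_nth l_def)
  finally show ?thesis .
qed

text \<open>In a factorization of least order, a common right divisor of \<open>A\<close> and \<open>C\<close> is unimodular.\<close>

lemma right_coprime:
  fixes A C :: "'a::field poly mat"
  assumes A: "A \<in> carrier_mat n n" "det A \<noteq> 0" and C: "C \<in> carrier_mat q n"
    and minimal: "\<And>A' C'. A' \<in> carrier_mat n n \<Longrightarrow> C' \<in> carrier_mat q n \<Longrightarrow> det A' \<noteq> 0 \<Longrightarrow>
      map_mat to_fract C' * mat_inv_sq (map_mat to_fract A') = map_mat to_fract C * mat_inv_sq (map_mat to_fract A) \<Longrightarrow>
      degree (det A) \<le> degree (det A')"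
    and x: "x \<in> carrier_vec n" "vec_over (range to_fract) (map_mat to_fract A *\<^sub>v x)"
      "vec_over (range to_fract) (map_mat to_fract C *\<^sub>v x)"
  shows "vec_over (range to_fract) x"
proof -
  define Af Cf where "Af = map_mat to_fract A" and "Cf = map_mat to_fract C"
  have c: "Af \<in> carrier_mat n n" "Cf \<in> carrier_mat q n" using A C by (auto simp: Af_def Cf_def)
  have dA: "det Af \<noteq> 0" using A by (simp add: Af_def)
  \<comment> \<open>\<open>A\<close> stacked on \<open>C\<close>. Compressing it will give a
    factorization \<open>M = N * K\<close> with \<open>K\<close> square, that is, a common right
    divisor \<open>K\<close> of \<open>A\<close> and \<open>C\<close>.\<close>
  define M where "M = Af @\<^sub>r Cf"
  have M: "M \<in> carrier_mat (n + q) n" using c by (auto simp: M_def)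
  have Mi: "M $$ (i, j) = (if i < n then Af $$ (i, j) else Cf $$ (i - n, j))" if "i < n + q" "j < n" for i j
    using that c by (auto simp: M_def append_rows_def)
  have Mp: "mat_over (range to_fract) M" unfolding mat_over_def using M Mi A C
    by (auto simp: Af_def Cf_def)
  have Mv: "M *\<^sub>v v = (Af *\<^sub>v v) @\<^sub>v (Cf *\<^sub>v v)" if "v \<in> carrier_vec n" for v
    unfolding M_def by (rule mat_mult_append[OF c that])
  obtain r Cc where r: "r \<le> n + q" "r \<le> n" "Cc \<in> carrier_mat r r" "det Cc \<noteq> 0"
      "pol.eqv M (dsum (0\<^sub>m (n + q - r) (n - r)) Cc)"
    using pol.compression[OF M] .
  \<comment> \<open>As \<open>A\<close> is nonsingular, the core has full size \<open>n\<close> and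
    the zero block has no columns.\<close>
  have "vec_space.rank (n + q) M = n"
  proof (rule vec_space.rank_injective[OF M])
    fix v assume v: "v \<in> carrier_vec n" "M *\<^sub>v v = 0\<^sub>v (n + q)"
    have "Af *\<^sub>v v = 0\<^sub>v n"
    proof (rule eq_vecI)
      fix i assume "i < dim_vec (0\<^sub>v n :: 'a poly fract vec)"
      thus "(Af *\<^sub>v v) $ i = 0\<^sub>v n $ i"
        using arg_cong[OF v(2), of "\<lambda>u. u $ i"] Mv[OF v(1)] c by simp
    qed (use c in simp)
    thus "v = 0\<^sub>v n" using det_0_iff_vec_prod_zero[OF c(1)] dA v(1) by blast
  qed
  hence rn: "r = n" using pol.rank_eqv[OF M r] by simp
  obtain P Q where PQ: "pol.gl (n + q) P" "pol.gl n Q" "P * M * Q = dsum (0\<^sub>m q 0) Cc"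
    using pol.eqvE[OF r(5) M] unfolding rn by (metis add_diff_cancel_left' diff_self_eq_0)
  obtain P' where P': "pol.gl (n + q) P'" "P * P' = 1\<^sub>m (n + q)" "P' * P = 1\<^sub>m (n + q)" using pol.gl_inverse[OF PQ(1)] .
  obtain Q' where Q': "pol.gl n Q'" "Q * Q' = 1\<^sub>m n" "Q' * Q = 1\<^sub>m n" using pol.gl_inverse[OF PQ(2)] .
  have cPQ: "P \<in> carrier_mat (n + q) (n + q)" "P' \<in> carrier_mat (n + q) (n + q)" "Q \<in> carrier_mat n n" "Q' \<in> carrier_mat n n"
    using PQ P' Q' pol.gl_carrier by auto
  have PM: "P * M \<in> carrier_mat (n + q) n" "mat_over (range to_fract) (P * M)"
    using cPQ M PQ(1) Mp by (auto simp: pol.gl_def intro!: pol.mat_over_mult)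
  have Z: "dsum (0\<^sub>m q 0) Cc \<in> carrier_mat (n + q) n" using r rn by (auto intro!: carrier_matI)
  have "P * M = P * M * (Q * Q')" unfolding Q'(2) by (rule right_mult_one_mat[OF PM(1), symmetric])
  also have "\<dots> = dsum (0\<^sub>m q 0) Cc * Q'" unfolding PQ(3)[symmetric] using cPQ M by (simp add: mat_assoc)
  finally have PMQ: "P * M = dsum (0\<^sub>m q 0) Cc * Q'" .
  have top: "(P * M) $$ (i, j) = 0" if "i < q" "j < n" for i j
    unfolding PMQ using that r rn
    by (subst index_mult_mat_sum[OF Z cPQ(4)]) (auto intro!: sum.neutral simp: dsum_index)
  define K where "K = mat n n (\<lambda>(i, j). (P * M) $$ (q + i, j))"
  define J where "J = (mat (n + q) n (\<lambda>(i, j). if i = q + j then 1 else 0) :: 'a poly fract mat)"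
  have K: "K \<in> carrier_mat n n" "mat_over (range to_fract) K"
    using PM cPQ(1) M by (auto simp: K_def mat_over_def simp del: index_mult_mat(1))
  have J: "J \<in> carrier_mat (n + q) n" "mat_over (range to_fract) J"
    using pol.zero_in pol.one_in unfolding J_def mat_over_def by auto
  have JK: "P * M = J * K"
  proof (rule eq_matI)
    fix i j assume "i < dim_row (J * K)" "j < dim_col (J * K)"
    hence ij: "i < n + q" "j < n" using J K by auto
    have "(J * K) $$ (i, j) = (\<Sum>t = 0..<n. J $$ (i, t) * K $$ (t, j))" by (rule index_mult_mat_sum[OF J(1) K(1) ij])
    also have "\<dots> = (\<Sum>t = 0..<n. if q \<le> i \<and> t = i - q then K $$ (i - q, j) else 0)"
      using ij by (intro sum.cong) (auto simp: J_def)
    also have "\<dots> = (if q \<le> i then K $$ (i - q, j) else 0)" using ij by (cases "q \<le> i") simp_all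
    also have "\<dots> = (P * M) $$ (i, j)" using ij top[of i j] by (auto simp: K_def simp del: index_mult_mat(1))
    finally show "(P * M) $$ (i, j) = (J * K) $$ (i, j)" ..
  qed (use PM J K in auto)
  \<comment> \<open>The last \<open>n\<close> columns of the unimodular \<open>P'\<close>, hence
    polynomial: what is left of \<open>M\<close> after division by \<open>K\<close>.\<close>
  define N where "N = P' * J"
  have N: "N \<in> carrier_mat (n + q) n" "mat_over (range to_fract) N"
    using cPQ J P'(1) by (auto simp: N_def pol.gl_def intro!: pol.mat_over_mult)
  have MNK: "M = N * K"
  proof -
    have "M = P' * (P * M)" using mat_cancel[OF P'(3) cPQ(2,1)] M by simp
    also have "\<dots> = N * K" unfolding JK N_def using cPQ J K by (simp add: mat_assoc)
    finally show ?thesis .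
  qed
  define A'f C'f where "A'f = mat n n (\<lambda>(i, j). N $$ (i, j))" and "C'f = mat q n (\<lambda>(i, j). N $$ (n + i, j))"
  have c': "A'f \<in> carrier_mat n n" "C'f \<in> carrier_mat q n" by (auto simp: A'f_def C'f_def)
  obtain A' where A': "A' \<in> carrier_mat n n" "A'f = map_mat to_fract A'"
    using mat_over_to_fractD[of A'f n n] N c' by (auto simp: mat_over_def A'f_def)
  obtain C' where C': "C' \<in> carrier_mat q n" "C'f = map_mat to_fract C'"
    using mat_over_to_fractD[of C'f q n] N c' by (auto simp: mat_over_def C'f_def)
  have AK: "Af = A'f * K"
  proof (rule eq_matI)
    fix i j assume "i < dim_row (A'f * K)" "j < dim_col (A'f * K)"
    hence ij: "i < n" "j < n" using c' K by auto
    have "Af $$ (i, j) = (N * K) $$ (i, j)" using Mi[of i j] ij MNK by simp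
    also have "\<dots> = (\<Sum>t = 0..<n. N $$ (i, t) * K $$ (t, j))" using ij by (intro index_mult_mat_sum[OF N(1) K(1)]) auto
    also have "\<dots> = (\<Sum>t = 0..<n. A'f $$ (i, t) * K $$ (t, j))" using ij by (intro sum.cong) (auto simp: A'f_def)
    also have "\<dots> = (A'f * K) $$ (i, j)" using index_mult_mat_sum[OF c'(1) K(1) ij] by simp
    finally show "Af $$ (i, j) = (A'f * K) $$ (i, j)" .
  qed (use c c' K in auto)
  have CK: "Cf = C'f * K"
  proof (rule eq_matI)
    fix i j assume "i < dim_row (C'f * K)" "j < dim_col (C'f * K)"
    hence ij: "i < q" "j < n" using c' K by auto
    have "Cf $$ (i, j) = (N * K) $$ (n + i, j)" using Mi[of "n + i" j] ij MNK by simp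
    also have "\<dots> = (\<Sum>t = 0..<n. N $$ (n + i, t) * K $$ (t, j))" using ij by (intro index_mult_mat_sum[OF N(1) K(1)]) auto
    also have "\<dots> = (\<Sum>t = 0..<n. C'f $$ (i, t) * K $$ (t, j))" using ij by (intro sum.cong) (auto simp: C'f_def)
    also have "\<dots> = (C'f * K) $$ (i, j)" using index_mult_mat_sum[OF c'(2) K(1) ij] by simp
    finally show "Cf $$ (i, j) = (C'f * K) $$ (i, j)" .
  qed (use c c' K in auto)
  \<comment> \<open>Cancelling \<open>K\<close> does not change the quotient of \<open>C\<close> by
    \<open>A\<close>. Minimality gives \<open>degree (det A) \<le> degree (det A')\<close>, and
    since the difference of the two is \<open>rdeg (det K)\<close>, this degree is 0 and
    \<open>K\<close> is unimodular.\<close>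
  have det: "det Af = det A'f * det K" unfolding AK using c' K by (simp add: det_mult[of _ n])
  hence nz: "det A'f \<noteq> 0" "det K \<noteq> 0" using dA by auto
  have dA': "det A' \<noteq> 0" using nz by (simp add: A'(2))
  note invA = mat_inv_sq[OF c(1) dA] and invA' = mat_inv_sq[OF c'(1) nz(1)]
  have "C'f * mat_inv_sq A'f * Af = C'f * (mat_inv_sq A'f * (A'f * K))"
    unfolding AK using c' K invA' by (simp add: mat_assoc)
  also have "\<dots> = Cf" unfolding CK using mat_cancel[OF invA'(3,1) c'(1), of K] K by simp
  finally have CA: "C'f * mat_inv_sq A'f * Af = Cf" .
  have "Cf * mat_inv_sq Af = C'f * mat_inv_sq A'f * (Af * mat_inv_sq Af)"
    unfolding CA[symmetric] using c c' invA invA' by (simp add: mat_assoc)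
  also have "\<dots> = C'f * mat_inv_sq A'f" using invA(2) c' invA' by simp
  finally have "degree (det A) \<le> degree (det A')"
    using minimal[OF A'(1) C'(1) dA'] by (simp add: A'(2) C'(2) Af_def Cf_def)
  moreover have "int (degree (det A)) = int (degree (det A')) + rdeg (det K)"
    using rdeg_mult[OF nz, folded det] A(2) dA' by (simp add: Af_def A'(2) rdeg_to_fract)
  moreover have "0 \<le> rdeg (det K)" using pol.N_nonneg[OF pol.det_in[OF K(2)] nz(2)] .
  ultimately have "rdeg (det K) = 0" by linarith
  hence "pol.gl n K" using pol.gl_of_det[OF K nz(2)] by simp
  then obtain K' where K': "pol.gl n K'" "K' * K = 1\<^sub>m n" using pol.gl_inverse by metis
  \<comment> \<open>\<open>x\<close> is recovered from polynomial data: the last \<open>n\<close>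
    entries of \<open>(P * M) *\<^sub>v x\<close> are those of \<open>K *\<^sub>v x\<close>, and
    \<open>K\<close> has a polynomial inverse.\<close>
  have "vec_over (range to_fract) (M *\<^sub>v x)"
    unfolding Mv[OF x(1)] using x(2,3) by (intro vec_over_append) (auto simp: Af_def Cf_def)
  hence "vec_over (range to_fract) (P *\<^sub>v (M *\<^sub>v x))"
    by (rule pol.vec_over_mult_mat_vec[rotated]) (use PQ(1) cPQ(1) M in \<open>auto simp: pol.gl_def\<close>)
  also have "P *\<^sub>v (M *\<^sub>v x) = (P * M) *\<^sub>v x" using cPQ M x by (intro assoc_mult_mat_vec[symmetric]) auto
  finally have PMx: "vec_over (range to_fract) ((P * M) *\<^sub>v x)" .
  have "vec_over (range to_fract) (K *\<^sub>v x)"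
    unfolding vec_over_def
  proof (intro allI impI)
    fix i assume "i < dim_vec (K *\<^sub>v x)"
    hence i: "i < n" using K by simp
    have "(K *\<^sub>v x) $ i = (\<Sum>t = 0..<n. K $$ (i, t) * x $ t)" by (rule index_mult_vec_sum[OF K(1) x(1) i])
    also have "\<dots> = (\<Sum>t = 0..<n. (P * M) $$ (q + i, t) * x $ t)"
      using i by (intro sum.cong) (auto simp: K_def simp del: index_mult_mat(1))
    also have "\<dots> = ((P * M) *\<^sub>v x) $ (q + i)"
      using i by (intro index_mult_vec_sum[OF PM(1) x(1), symmetric]) simp
    also have "\<dots> \<in> range to_fract" using PMx i PM(1) cPQ(1) by (simp add: vec_over_def del: index_mult_mat_vec)
    finally show "(K *\<^sub>v x) $ i \<in> range to_fract" .
  qed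
  hence "vec_over (range to_fract) (K' *\<^sub>v (K *\<^sub>v x))"
    by (rule pol.vec_over_mult_mat_vec[rotated]) (use K' K pol.gl_carrier[OF K'(1)] in \<open>auto simp: pol.gl_def\<close>)
  also have "K' *\<^sub>v (K *\<^sub>v x) = x"
    using assoc_mult_mat_vec[OF pol.gl_carrier[OF K'(1)] K(1) x(1)] K'(2) x(1) by simp
  finally show ?thesis .
qed

section \<open>Minimal indices of system matrices\<close>

text \<open>The embedding \<open>S\<close> of null vectors does not raise degrees by
  \<open>proper\<close> and keeps them polynomial by \<open>right_coprime\<close>. Its inverse is
  the coordinate projection \<open>pr\<close>, a constant matrix. \<open>minimal\<close> varies only
  \<open>A\<close> and \<open>C\<close>, because common right divisors are all that matters on this
  side.\<close>

lemma right_min_indices_sum_system: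
  fixes A B C D :: "'a::field poly mat"
  assumes A: "A \<in> carrier_mat n n" "det A \<noteq> 0" and B: "B \<in> carrier_mat n m" and C: "C \<in> carrier_mat q n"
    and D: "D \<in> carrier_mat q m"
    and minimal: "\<And>A' C'. A' \<in> carrier_mat n n \<Longrightarrow> C' \<in> carrier_mat q n \<Longrightarrow> det A' \<noteq> 0 \<Longrightarrow>
      map_mat to_fract C' * mat_inv_sq (map_mat to_fract A') = map_mat to_fract C * mat_inv_sq (map_mat to_fract A) \<Longrightarrow>
      degree (det A) \<le> degree (det A')"
    and proper: "mat_over {x. proper_rf x} (mat_inv_sq (map_mat to_fract A) * map_mat to_fract B)"
  defines "Af \<equiv> map_mat to_fract A" and "Bf \<equiv> map_mat to_fract B"
    and "Cf \<equiv> map_mat to_fract C" and "Df \<equiv> map_mat to_fract D"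
  shows "right_min_indices_sum (four_block_mat Af Bf (- Cf) Df)
    = right_min_indices_sum (Df + Cf * mat_inv_sq Af * Bf)"
proof -
  let ?L = "four_block_mat Af Bf (- Cf) Df"
  let ?G = "Df + Cf * mat_inv_sq Af * Bf"
  have c: "Af \<in> carrier_mat n n" "Bf \<in> carrier_mat n m" "Cf \<in> carrier_mat q n" "Df \<in> carrier_mat q m"
    using A B C D by (auto simp: Af_def Bf_def Cf_def Df_def)
  have dA: "det Af \<noteq> 0" using A by (simp add: Af_def)
  define Ai where "Ai = mat_inv_sq Af"
  have Ai: "Ai \<in> carrier_mat n n" "Af * Ai = 1\<^sub>m n" "Ai * Af = 1\<^sub>m n"
    unfolding Ai_def by (rule mat_inv_sq[OF c(1) dA])+
  define T where "T = - (Ai * Bf)"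
  have T: "T \<in> carrier_mat n m" "mat_over {x. proper_rf x} T"
    using Ai c proper prp.uminus_in by (auto simp: T_def Ai_def Af_def Bf_def mat_over_def)
  have L: "?L \<in> carrier_mat (n + q) (n + m)" and G: "?G \<in> carrier_mat q m" using c Ai by (auto simp: Ai_def)
  have Lv: "?L *\<^sub>v (x @\<^sub>v y) = (Af *\<^sub>v x + Bf *\<^sub>v y) @\<^sub>v (- Cf *\<^sub>v x + Df *\<^sub>v y)"
    if "x \<in> carrier_vec n" "y \<in> carrier_vec m" for x y
    by (rule four_block_mat_mult_vec[of Af n n Bf m "- Cf" q Df]) (use c that in auto)
  have Tv: "T *\<^sub>v y = - (Ai *\<^sub>v (Bf *\<^sub>v y))" if "y \<in> carrier_vec m" for y
    unfolding T_def using that Ai c by (simp add: uminus_mult_mat_vec assoc_mult_mat_vec[of Ai n n Bf m y])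
  have ATv: "Af *\<^sub>v (T *\<^sub>v y) = - (Bf *\<^sub>v y)" if y: "y \<in> carrier_vec m" for y
  proof -
    have "Af * T = - Bf" unfolding T_def using mat_cancel[OF Ai(2) c(1) Ai(1), of Bf] c Ai(1) by simp
    hence "Af *\<^sub>v (T *\<^sub>v y) = (- Bf) *\<^sub>v y" using assoc_mult_mat_vec[OF c(1) T(1) y] by simp
    thus ?thesis using y c by simp
  qed
  have Gv: "- Cf *\<^sub>v (T *\<^sub>v y) + Df *\<^sub>v y = ?G *\<^sub>v y" if y: "y \<in> carrier_vec m" for y
  proof -
    have "(- Cf) * T = Cf * Ai * Bf" unfolding T_def using c Ai by (simp add: mat_assoc)
    hence "- Cf *\<^sub>v (T *\<^sub>v y) = (Cf * Ai * Bf) *\<^sub>v y"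
      using assoc_mult_mat_vec[of "- Cf" q n T m y] c T y by simp
    hence "- Cf *\<^sub>v (T *\<^sub>v y) + Df *\<^sub>v y = (Cf * Ai * Bf) *\<^sub>v y + Df *\<^sub>v y" by simp
    also have "\<dots> = Df *\<^sub>v y + (Cf * Ai * Bf) *\<^sub>v y"
      by (rule comm_add_vec[of _ q]) (use c Ai y in \<open>auto intro!: carrier_vecI\<close>)
    also have "\<dots> = ?G *\<^sub>v y"
      unfolding Ai_def[symmetric] using c Ai y by (intro add_mult_distrib_mat_vec[symmetric]) auto
    finally show ?thesis .
  qed
  define S where "S = T @\<^sub>r 1\<^sub>m m"
  have S: "S \<in> carrier_mat (n + m) m" using T by (auto simp: S_def)
  have Sp: "mat_over {x. proper_rf x} S" unfolding S_def append_rows_def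
    using T prp.zero_in prp.one_in by (auto simp: mat_over_def)
  have Sv: "S *\<^sub>v y = (T *\<^sub>v y) @\<^sub>v y" if "y \<in> carrier_vec m" for y
    unfolding S_def using mat_mult_append[OF T(1) one_carrier_mat that] that by simp
  define pr where "pr = (mat m (n + m) (\<lambda>(i, j). if j = n + i then 1 else 0) :: 'a poly fract mat)"
  have pr: "pr \<in> carrier_mat m (n + m)" "mat_over {x. proper_rf x} pr"
    using prp.zero_in prp.one_in by (auto simp: pr_def mat_over_def)
  have prv: "pr *\<^sub>v z = vec_last z m" if z: "z \<in> carrier_vec (n + m)" for z
  proof (rule eq_vecI)
    fix i assume "i < dim_vec (vec_last z m)"
    hence i: "i < m" by simp
    have "(pr *\<^sub>v z) $ i = (\<Sum>t = 0..<n + m. pr $$ (i, t) * z $ t)" by (rule index_mult_vec_sum[OF pr(1) z i])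
    also have "\<dots> = (\<Sum>t = 0..<n + m. if t = n + i then z $ (n + i) else 0)"
      using i by (intro sum.cong) (auto simp: pr_def)
    also have "\<dots> = vec_last z m $ i" using i z by (simp add: vec_last_def)
    finally show "(pr *\<^sub>v z) $ i = vec_last z m $ i" .
  qed (use pr in simp)
  have prS: "pr *\<^sub>v (S *\<^sub>v y) = y" if y: "y \<in> carrier_vec m" for y
  proof -
    have "S *\<^sub>v y \<in> carrier_vec (n + m)" using S y by simp
    hence "pr *\<^sub>v (S *\<^sub>v y) = vec_last (S *\<^sub>v y) m" by (rule prv)
    also have "\<dots> = y" unfolding Sv[OF y] using y T by (intro eq_vecI) (auto simp: vec_last_def)
    finally show ?thesis .
  qed
  have toL: "?L *\<^sub>v (S *\<^sub>v y) = 0\<^sub>v (n + q)" if y: "y \<in> carrier_vec m" "?G *\<^sub>v y = 0\<^sub>v q" for y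
  proof -
    have "?L *\<^sub>v (S *\<^sub>v y) = (- (Bf *\<^sub>v y) + Bf *\<^sub>v y) @\<^sub>v (?G *\<^sub>v y)"
      unfolding Sv[OF y(1)] ATv[OF y(1), symmetric] Gv[OF y(1), symmetric] using T y by (intro Lv) auto
    also have "- (Bf *\<^sub>v y) + Bf *\<^sub>v y = 0\<^sub>v n" using c y by (intro uminus_l_inv_vec) auto
    also have "0\<^sub>v n @\<^sub>v (?G *\<^sub>v y) = 0\<^sub>v (n + q)" unfolding y(2) by (intro eq_vecI) auto
    finally show ?thesis .
  qed
  have toG: "?G *\<^sub>v (pr *\<^sub>v z) = 0\<^sub>v q \<and> S *\<^sub>v (pr *\<^sub>v z) = z"
    if z: "z \<in> carrier_vec (n + m)" "?L *\<^sub>v z = 0\<^sub>v (n + q)" for z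
  proof -
    define x y where "x = vec_first z n" and "y = vec_last z m"
    have xy: "x \<in> carrier_vec n" "y \<in> carrier_vec m" "z = x @\<^sub>v y" using z by (auto simp: x_def y_def)
    have "(Af *\<^sub>v x + Bf *\<^sub>v y) @\<^sub>v (- Cf *\<^sub>v x + Df *\<^sub>v y) = 0\<^sub>v n @\<^sub>v 0\<^sub>v q"
      using z(2) Lv[OF xy(1,2)] xy(3) by (auto intro!: eq_vecI)
    hence e: "Af *\<^sub>v x + Bf *\<^sub>v y = 0\<^sub>v n" "- Cf *\<^sub>v x + Df *\<^sub>v y = 0\<^sub>v q"
      using append_vec_eq[of "Af *\<^sub>v x + Bf *\<^sub>v y" n "0\<^sub>v n"] c xy by auto
    have "Af *\<^sub>v x = - (Bf *\<^sub>v y)"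
    proof (rule eq_vecI)
      fix i assume i: "i < dim_vec (- (Bf *\<^sub>v y))"
      hence "(Af *\<^sub>v x + Bf *\<^sub>v y) $ i = 0" using e(1) c by simp
      thus "(Af *\<^sub>v x) $ i = (- (Bf *\<^sub>v y)) $ i" using i c by (simp add: eq_neg_iff_add_eq_0)
    qed (use c in simp)
    hence "Af *\<^sub>v x = Af *\<^sub>v (T *\<^sub>v y)" using ATv[OF xy(2)] by simp
    hence "Ai *\<^sub>v (Af *\<^sub>v x) = Ai *\<^sub>v (Af *\<^sub>v (T *\<^sub>v y))" by simp
    hence xT: "x = T *\<^sub>v y"
      using assoc_mult_mat_vec[OF Ai(1) c(1) xy(1)] assoc_mult_mat_vec[OF Ai(1) c(1), of "T *\<^sub>v y"] Ai(3) xy T by simp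
    have "pr *\<^sub>v z = y" using prv[OF z(1)] by (simp add: y_def)
    thus ?thesis using e(2) Gv[OF xy(2)] xT Sv[OF xy(2)] xy(3) by simp
  qed
  have "right_min_indices_sum ?L \<le> right_min_indices_sum ?G"
  proof (rule right_min_indices_sum_le[OF G L S Sp, where f = "\<lambda>z. pr *\<^sub>v z"])
    fix y assume y: "y \<in> carrier_vec m" "?G *\<^sub>v y = 0\<^sub>v q"
    show "?L *\<^sub>v (S *\<^sub>v y) = 0\<^sub>v (n + q) \<and> pr *\<^sub>v (S *\<^sub>v y) = y" using toL y prS by blast
    assume yp: "vec_over (range to_fract) y"
    have By: "vec_over (range to_fract) (Bf *\<^sub>v y)"
      by (rule pol.vec_over_mult_mat_vec) (use yp y c in \<open>auto simp: Bf_def\<close>)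
    have Dy: "vec_over (range to_fract) (Df *\<^sub>v y)"
      by (rule pol.vec_over_mult_mat_vec) (use yp y c in \<open>auto simp: Df_def\<close>)
    \<comment> \<open>On the null space the second block row turns \<open>C T y\<close> into
      \<open>D y\<close>, and \<open>ATv\<close> turns \<open>A T y\<close> into
      \<open>- B y\<close>. Both are polynomial, as \<open>right_coprime\<close> requires of
      \<open>T y\<close>.\<close>
    have CT: "Cf *\<^sub>v (T *\<^sub>v y) = Df *\<^sub>v y"
    proof (rule eq_vecI)
      fix i assume i: "i < dim_vec (Df *\<^sub>v y)"
      have "(- Cf *\<^sub>v (T *\<^sub>v y) + Df *\<^sub>v y) $ i = 0" using Gv[OF y(1)] y(2) i c by simp
      thus "(Cf *\<^sub>v (T *\<^sub>v y)) $ i = (Df *\<^sub>v y) $ i" using i c T by simp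
    qed (use c in simp)
    have "vec_over (range to_fract) (T *\<^sub>v y)"
    proof (rule right_coprime[OF A C minimal])
      show "vec_over (range to_fract) (map_mat to_fract A *\<^sub>v (T *\<^sub>v y))"
        using ATv[OF y(1)] pol.vec_over_uminus[OF By] by (simp add: Af_def)
      show "vec_over (range to_fract) (map_mat to_fract C *\<^sub>v (T *\<^sub>v y))"
        using CT Dy by (simp add: Cf_def)
    qed (use T y in auto)
    thus "vec_over (range to_fract) (S *\<^sub>v y)" unfolding Sv[OF y(1)] using yp by (rule vec_over_append)
  next
    fix z assume z: "z \<in> carrier_vec (n + m)" "?L *\<^sub>v z = 0\<^sub>v (n + q)"
    show "pr *\<^sub>v z \<in> carrier_vec m \<and> ?G *\<^sub>v (pr *\<^sub>v z) = 0\<^sub>v q \<and> S *\<^sub>v (pr *\<^sub>v z) = z"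
      using toG[OF z] pr z by simp
  qed
  moreover have "right_min_indices_sum ?G \<le> right_min_indices_sum ?L"
  proof (rule right_min_indices_sum_le[OF L G pr, where f = "\<lambda>y. S *\<^sub>v y"])
    fix z assume z: "z \<in> carrier_vec (n + m)" "?L *\<^sub>v z = 0\<^sub>v (n + q)"
    show "?G *\<^sub>v (pr *\<^sub>v z) = 0\<^sub>v q \<and> S *\<^sub>v (pr *\<^sub>v z) = z" using toG[OF z] .
    assume "vec_over (range to_fract) z"
    thus "vec_over (range to_fract) (pr *\<^sub>v z)"
      unfolding prv[OF z(1)] using z by (auto simp: vec_over_def vec_last_def)
  next
    fix y assume y: "y \<in> carrier_vec m" "?G *\<^sub>v y = 0\<^sub>v q"
    show "S *\<^sub>v y \<in> carrier_vec (n + m) \<and> ?L *\<^sub>v (S *\<^sub>v y) = 0\<^sub>v (n + q) \<and> pr *\<^sub>v (S *\<^sub>v y) = y"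
      using toL[OF y] prS y S by simp
  qed
  ultimately show ?thesis by simp
qed

text \<open>The left indices are the right indices of the transposed system, with
  \<open>- C\<^sup>T\<close> in the place of \<open>B\<close> and \<open>- B\<^sup>T\<close> in that
  of \<open>C\<close>; the signs restore the shape of a system matrix. Least order thus excludes
  common divisors on both sides.\<close>

lemma mu_system:
  fixes A B C D :: "'a::field poly mat"
  assumes A: "A \<in> carrier_mat n n" "det A \<noteq> 0" and B: "B \<in> carrier_mat n m" and C: "C \<in> carrier_mat q n"
    and D: "D \<in> carrier_mat q m"
  defines "Af \<equiv> map_mat to_fract A" and "Bf \<equiv> map_mat to_fract B"
    and "Cf \<equiv> map_mat to_fract C" and "Df \<equiv> map_mat to_fract D"
  defines "G \<equiv> Df + Cf * mat_inv_sq Af * Bf"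
  assumes minimal: "\<And>A' B' C' D'. is_realization G A' B' C' D' \<Longrightarrow> degree (det A) \<le> degree (det A')"
    and proper: "mat_over {x. proper_rf x} (mat_inv_sq Af * Bf)" "mat_over {x. proper_rf x} (Cf * mat_inv_sq Af)"
  shows "mu (four_block_mat Af Bf (- Cf) Df) = mu G"
proof -
  have c: "Af \<in> carrier_mat n n" "Bf \<in> carrier_mat n m" "Cf \<in> carrier_mat q n" "Df \<in> carrier_mat q m"
    using A B C D by (auto simp: Af_def Bf_def Cf_def Df_def)
  have dA: "det Af \<noteq> 0" using A by (simp add: Af_def)
  note inv = mat_inv_sq[OF c(1) dA]
  have G: "G \<in> carrier_mat q m" using c inv by (simp add: G_def)
  have right: "right_min_indices_sum (four_block_mat Af Bf (- Cf) Df) = right_min_indices_sum G"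
    unfolding Af_def Bf_def Cf_def Df_def G_def
  proof (rule right_min_indices_sum_system[OF A B C D])
    fix A' C' assume A': "A' \<in> carrier_mat n n" "C' \<in> carrier_mat q n" "det A' \<noteq> 0"
      "map_mat to_fract C' * mat_inv_sq (map_mat to_fract A') = map_mat to_fract C * mat_inv_sq (map_mat to_fract A)"
    have "is_realization G A' B C' D"
      unfolding is_realization_def
    proof (intro exI[of _ n] conjI)
      show "G = map_mat to_fract D + map_mat to_fract C' * mat_inv_sq (map_mat to_fract A') * map_mat to_fract B"
        unfolding A'(4) G_def Af_def Bf_def Cf_def Df_def ..
    qed (use A' G B D in auto)
    thus "degree (det A) \<le> degree (det A')" by (rule minimal)
  qed (use proper(1) in \<open>simp add: Af_def Bf_def\<close>)
  let ?A = "A\<^sup>T" and ?B = "- C\<^sup>T" and ?C = "- B\<^sup>T" and ?D = "D\<^sup>T"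
  have mt: "map_mat to_fract ?A = Af\<^sup>T" "map_mat to_fract ?B = - Cf\<^sup>T"
    "map_mat to_fract ?C = - Bf\<^sup>T" "map_mat to_fract ?D = Df\<^sup>T"
    by (auto simp: Af_def Bf_def Cf_def Df_def intro!: eq_matI)
  have invt: "mat_inv_sq (Af\<^sup>T) = transpose_mat (mat_inv_sq Af)" by (rule mat_inv_sq_transpose[OF c(1) dA])
  have Gt: "Df\<^sup>T + - Bf\<^sup>T * mat_inv_sq (Af\<^sup>T) * - Cf\<^sup>T = G\<^sup>T"
  proof -
    have "transpose_mat (Cf * mat_inv_sq Af * Bf) = Bf\<^sup>T * (transpose_mat (mat_inv_sq Af) * Cf\<^sup>T)"
      using transpose_mult[of "Cf * mat_inv_sq Af" q n Bf m] transpose_mult[of Cf q n "mat_inv_sq Af" n] c inv by simp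
    thus ?thesis unfolding G_def invt using c inv
      by (simp add: transpose_add[of _ q m] mat_assoc)
  qed
  have Lt: "transpose_mat (four_block_mat Af Bf (- Cf) Df)
      = four_block_mat (Af\<^sup>T) (- Cf\<^sup>T) (- (- Bf\<^sup>T)) (Df\<^sup>T)"
    using transpose_four_block_mat[of Af n n Bf m "- Cf" q Df] c by (simp add: transpose_uminus uminus_uminus_mat)
  have left: "right_min_indices_sum (transpose_mat (four_block_mat Af Bf (- Cf) Df)) = right_min_indices_sum (G\<^sup>T)"
    unfolding Lt Gt[symmetric] mt[symmetric]
  proof (rule right_min_indices_sum_system)
    show "?A \<in> carrier_mat n n" "?B \<in> carrier_mat n q" "?C \<in> carrier_mat m n" "?D \<in> carrier_mat m q" "det ?A \<noteq> 0"
      using A B C D det_transpose[OF A(1)] by auto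
  next
    \<comment> \<open>A competing factorization of the transposed system, transposed back, realizes
      \<open>G\<close> with the same \<open>C\<close> and \<open>D\<close>, so least order applies
      to it.\<close>
    fix A' C' :: "'a poly mat" assume A': "A' \<in> carrier_mat n n" "C' \<in> carrier_mat m n" "det A' \<noteq> 0"
      "map_mat to_fract C' * mat_inv_sq (map_mat to_fract A') = map_mat to_fract ?C * mat_inv_sq (map_mat to_fract ?A)"
    define A'f C'f where "A'f = map_mat to_fract A'" and "C'f = map_mat to_fract C'"
    have c': "A'f \<in> carrier_mat n n" "C'f \<in> carrier_mat m n" using A' by (auto simp: A'f_def C'f_def)
    have dA': "det A'f \<noteq> 0" using A' by (simp add: A'f_def)
    note inv' = mat_inv_sq[OF c'(1) dA']
    have "transpose_mat (C'f * mat_inv_sq A'f) = transpose_mat (- Bf\<^sup>T * transpose_mat (mat_inv_sq Af))"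
      using A'(4) unfolding mt invt A'f_def C'f_def by simp
    hence e: "mat_inv_sq (transpose_mat A'f) * transpose_mat C'f = - (mat_inv_sq Af * Bf)"
      using transpose_mult[of C'f m n "mat_inv_sq A'f" n] c' inv' c inv mat_inv_sq_transpose[OF c'(1) dA']
        transpose_mult[of "- Bf\<^sup>T" m n "transpose_mat (mat_inv_sq Af)" n]
      by (simp add: transpose_uminus)
    have "is_realization G (A'\<^sup>T) (- C'\<^sup>T) C D"
      unfolding is_realization_def
    proof (intro exI[of _ n] conjI)
      have m': "map_mat to_fract (A'\<^sup>T) = transpose_mat A'f"
        "map_mat to_fract (- C'\<^sup>T) = - transpose_mat C'f"
        by (auto simp: A'f_def C'f_def intro!: eq_matI)
      have it: "mat_inv_sq (transpose_mat A'f) \<in> carrier_mat n n"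
        using mat_inv_sq_transpose[OF c'(1) dA'] inv' by simp
      have "Cf * mat_inv_sq (transpose_mat A'f) * - transpose_mat C'f = - (Cf * (mat_inv_sq (transpose_mat A'f) * transpose_mat C'f))"
        using c it c' by (simp add: mat_assoc)
      also have "\<dots> = Cf * mat_inv_sq Af * Bf" unfolding e using c inv by (simp add: mat_assoc uminus_uminus_mat)
      finally show "G = map_mat to_fract D + map_mat to_fract C * mat_inv_sq (map_mat to_fract (A'\<^sup>T)) *
          map_mat to_fract (- C'\<^sup>T)"
        unfolding m' G_def Cf_def[symmetric] Df_def[symmetric] by simp
    qed (use A' C D G det_transpose[OF A'(1)] in auto)
    hence "degree (det A) \<le> degree (det (A'\<^sup>T))" by (rule minimal)
    thus "degree (det ?A) \<le> degree (det A')" using det_transpose[OF A'(1)] det_transpose[OF A(1)] by simp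
  next
    have "transpose_mat (mat_inv_sq Af) * Cf\<^sup>T = transpose_mat (Cf * mat_inv_sq Af)"
      using c inv by (simp add: transpose_mult[of Cf q n _ n])
    moreover have "mat_over {x. proper_rf x} (- transpose_mat (Cf * mat_inv_sq Af))"
      using proper(2) prp.uminus_in by (auto simp: mat_over_def simp del: index_mult_mat(1))
    ultimately show "mat_over {x. proper_rf x} (mat_inv_sq (map_mat to_fract ?A) * map_mat to_fract ?B)"
      unfolding mt invt using c inv by simp
  qed
  show ?thesis unfolding mu_def using left right by simp
qed

section \<open>Strong linearizations\<close>

definition poly_pencil :: "'a::field mat \<Rightarrow> 'a mat \<Rightarrow> 'a poly mat" where
  "poly_pencil X1 X0 = mat (dim_row X1) (dim_col X1) (\<lambda>(i, j). [:X0 $$ (i, j), X1 $$ (i, j):])"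

lemma poly_pencil_carrier: "X1 \<in> carrier_mat m n \<Longrightarrow> poly_pencil X1 X0 \<in> carrier_mat m n"
  by (auto simp: poly_pencil_def)

lemma pencil_eq_map: "pencil X1 X0 = map_mat to_fract (poly_pencil X1 X0)"
  by (intro eq_matI) (auto simp: pencil_def poly_pencil_def)

lemma to_fract_linear: "to_fract [:a, b:] = to_fract [:a:] + lam * to_fract [:b:]"
proof -
  have "[:a, b:] = [:a:] + [:0, 1:] * [:b:]" by simp
  thus ?thesis unfolding lam_def by (metis to_fract_add to_fract_mult)
qed

lemma strictly_proper_inverse_lam: "strictly_proper_rf (inverse lam * to_fract [:c:])"
proof -
  have "rdeg (inverse (lam :: 'a poly fract)) = - 1" using rdeg_lam_powi[of "-1"] by simp
  hence "strictly_proper_rf (inverse (lam :: 'a poly fract))" by (simp add: strictly_proper_iff)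
  thus ?thesis using strictly_proper_mult[of "to_fract [:c:]" "inverse lam"] by (simp add: mult.commute)
qed

lemma pencil_at_inf:
  assumes "X1 \<in> carrier_mat m n"
  shows "mat_at_inf (inverse lam \<cdot>\<^sub>m pencil X1 X0) X1"
proof -
  have "inverse lam * to_fract [:a, b:] - to_fract [:b:] = inverse lam * to_fract [:a:]" for a b :: 'a
    unfolding to_fract_linear by (simp add: algebra_simps)
  thus ?thesis using assms
    by (simp add: mat_at_inf_def pencil_def at_inf_def strictly_proper_inverse_lam)
qed

lemma mat_at_inf_unique:
  assumes "mat_at_inf X C" "mat_at_inf X D"
  shows "C = D"
proof (rule eq_matI)
  fix i j assume "i < dim_row D" "j < dim_col D"
  hence "at_inf (X $$ (i, j)) (C $$ (i, j))" "at_inf (X $$ (i, j)) (D $$ (i, j))"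
    using assms by (auto simp: mat_at_inf_def)
  thus "C $$ (i, j) = D $$ (i, j)" by (rule at_inf_unique)
qed (use assms in \<open>auto simp: mat_at_inf_def\<close>)

lemma mat_at_inf_one: "mat_at_inf (1\<^sub>m n) (1\<^sub>m n)"
  using at_inf_0 at_inf_1 by (auto simp: mat_at_inf_def simp del: at_inf_0_iff)

lemma mat_at_inf_proper: "mat_at_inf X C \<Longrightarrow> mat_over {x. proper_rf x} X"
  by (auto simp: mat_at_inf_def mat_over_def intro: at_inf_proper)

lemma mat_first_rows:
  assumes "M \<in> carrier_mat q n" "p \<le> q" "i < p" "j < n"
  shows "(mat p q (\<lambda>(i, j). if i = j then 1 else 0) * M) $$ (i, j) = (M $$ (i, j) :: 'b::comm_ring_1)"
proof -
  have "(mat p q (\<lambda>(i, j). if i = j then 1 else 0) * M) $$ (i, j)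
      = (\<Sum>t = 0..<q. mat p q (\<lambda>(i, j). if i = j then 1 else 0) $$ (i, t) * M $$ (t, j))"
    by (rule index_mult_mat_sum[OF mat_carrier assms(1,3,4)])
  also have "\<dots> = (\<Sum>t = 0..<q. if t = i then M $$ (i, j) else 0)"
    using assms by (intro sum.cong) auto
  finally show ?thesis using assms by simp
qed

lemma mat_first_cols:
  assumes "M \<in> carrier_mat m q" "n \<le> q" "i < m" "j < n"
  shows "(M * mat q n (\<lambda>(i, j). if i = j then 1 else 0)) $$ (i, j) = (M $$ (i, j) :: 'b::comm_ring_1)"
proof -
  have "(M * mat q n (\<lambda>(i, j). if i = j then 1 else 0)) $$ (i, j)
      = (\<Sum>t = 0..<q. M $$ (i, t) * mat q n (\<lambda>(i, j). if i = j then 1 else 0) $$ (t, j))"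
    by (rule index_mult_mat_sum[OF assms(1) mat_carrier assms(3,4)])
  also have "\<dots> = (\<Sum>t = 0..<q. if t = j then M $$ (i, j) else 0)"
    using assms by (intro sum.cong) auto
  finally show ?thesis using assms by simp
qed

text \<open>\<open>G\<close> is a corner of \<open>V1 * Gh * V2\<close> with unimodular
  \<open>V1\<close> and \<open>V2\<close>, so \<open>G = X * Gh * Y\<close> with polynomial
  \<open>X\<close> and \<open>Y\<close>. These are absorbed into \<open>B\<close>, \<open>C\<close>
  and \<open>D\<close>, and \<open>A\<close> is kept. Hence no realization of \<open>Gh\<close> has
  order below \<open>nu G\<close>.\<close>

lemma realization_of_dsum:
  fixes G Gh :: "'a::field poly fract mat"
  assumes G: "G \<in> carrier_mat p m" and eqv: "pol.eqv (dsum G (1\<^sub>m s)) Gh"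
    and real: "is_realization Gh A B C D"
  shows "\<exists>B' C' D'. is_realization G A B' C' D'"
proof -
  have dG: "dsum G (1\<^sub>m s) \<in> carrier_mat (p + s) (m + s)" using G by simp
  have Gh: "Gh \<in> carrier_mat (p + s) (m + s)" by (rule pol.eqv_carrier[OF eqv dG])
  obtain V1 V2 where V: "pol.gl (p + s) V1" "pol.gl (m + s) V2" "dsum G (1\<^sub>m s) = V1 * Gh * V2"
    using pol.eqvE[OF pol.eqv_sym[OF eqv] Gh] .
  have Vc: "V1 \<in> carrier_mat (p + s) (p + s)" "V2 \<in> carrier_mat (m + s) (m + s)" using V pol.gl_carrier by auto
  define J1 J2 where "J1 = (mat p (p + s) (\<lambda>(i, j). if i = j then 1 else 0) :: 'a poly fract mat)"
    and "J2 = (mat (m + s) m (\<lambda>(i, j). if i = j then 1 else 0) :: 'a poly fract mat)"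
  have J: "J1 \<in> carrier_mat p (p + s)" "J2 \<in> carrier_mat (m + s) m" 
    "mat_over (range to_fract) J1" "mat_over (range to_fract) J2"
    using pol.zero_in pol.one_in unfolding J1_def J2_def mat_over_def by auto
  have GJ: "G = J1 * dsum G (1\<^sub>m s) * J2"
  proof (rule eq_matI)
    fix i j assume "i < dim_row (J1 * dsum G (1\<^sub>m s) * J2)" "j < dim_col (J1 * dsum G (1\<^sub>m s) * J2)"
    hence ij: "i < p" "j < m" using J by auto
    have "(J1 * dsum G (1\<^sub>m s) * J2) $$ (i, j) = (J1 * dsum G (1\<^sub>m s)) $$ (i, j)"
      unfolding J2_def using ij J dG by (intro mat_first_cols[of _ p]) auto
    also have "\<dots> = dsum G (1\<^sub>m s) $$ (i, j)"
      unfolding J1_def using ij by (intro mat_first_rows[OF dG]) auto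
    also have "\<dots> = G $$ (i, j)" using ij G by (simp add: dsum_index)
    finally show "G $$ (i, j) = (J1 * dsum G (1\<^sub>m s) * J2) $$ (i, j)" ..
  qed (use G J in auto)
  have "mat_over (range to_fract) (J1 * V1)" "mat_over (range to_fract) (V2 * J2)"
    using J V(1,2) Vc by (auto simp: pol.gl_def intro!: pol.mat_over_mult)
  note XY = mat_over_to_fractD[OF this(1) mult_carrier_mat[OF J(1) Vc(1)]]
    mat_over_to_fractD[OF this(2) mult_carrier_mat[OF Vc(2) J(2)]]
  obtain X where X: "X \<in> carrier_mat p (p + s)" "J1 * V1 = map_mat to_fract X"
    using XY(1) by blast
  obtain Y where Y: "Y \<in> carrier_mat (m + s) m" "V2 * J2 = map_mat to_fract Y"
    using XY(2) by blast
  obtain n where r: "A \<in> carrier_mat n n" "B \<in> carrier_mat n (m + s)" "C \<in> carrier_mat (p + s) n"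
    "D \<in> carrier_mat (p + s) (m + s)" "det A \<noteq> 0"
    "Gh = map_mat to_fract D + map_mat to_fract C * mat_inv_sq (map_mat to_fract A) * map_mat to_fract B"
    using real Gh unfolding is_realization_def by auto
  define Ai where "Ai = mat_inv_sq (map_mat to_fract A)"
  have Ai: "Ai \<in> carrier_mat n n" unfolding Ai_def using r mat_inv_sq(1)[of "map_mat to_fract A" n] by simp
  have c: "map_mat to_fract A \<in> carrier_mat n n" "map_mat to_fract B \<in> carrier_mat n (m + s)"
    "map_mat to_fract C \<in> carrier_mat (p + s) n" "map_mat to_fract D \<in> carrier_mat (p + s) (m + s)"
    "map_mat to_fract X \<in> carrier_mat p (p + s)" "map_mat to_fract Y \<in> carrier_mat (m + s) m"
    using r X Y by auto
  have "G = (J1 * V1) * Gh * (V2 * J2)" using GJ V(3) J Vc Gh by (simp add: mat_assoc)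
  also have "\<dots> = map_mat to_fract X * (map_mat to_fract D + map_mat to_fract C * Ai * map_mat to_fract B) * map_mat to_fract Y"
    unfolding X Y r(6) Ai_def ..
  also have "\<dots> = map_mat to_fract X * map_mat to_fract D * map_mat to_fract Y
      + map_mat to_fract X * (map_mat to_fract C * Ai * map_mat to_fract B) * map_mat to_fract Y"
    using c Ai by (subst mult_add_distrib_mat[of _ p "p + s" _ "m + s"], simp_all)
      (subst add_mult_distrib_mat[of _ p "m + s" _ _ m], auto)
  also have "map_mat to_fract X * (map_mat to_fract C * Ai * map_mat to_fract B) * map_mat to_fract Y
      = (map_mat to_fract X * map_mat to_fract C) * Ai * (map_mat to_fract B * map_mat to_fract Y)"
    using c Ai by (simp add: mat_assoc)
  finally have "G = map_mat to_fract (X * D * Y) + map_mat to_fract (X * C) * Ai * map_mat to_fract (B * Y)"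
    using X Y r by (simp add: to_fract_hom.mat_hom_mult[of _ p "p + s" _ m] to_fract_hom.mat_hom_mult[of _ p "p + s" _ n]
        to_fract_hom.mat_hom_mult[of _ n "m + s" _ m] to_fract_hom.mat_hom_mult[of _ "p + s" "m + s" _ m])
  hence "is_realization G A (B * Y) (X * C) (X * D * Y)"
    unfolding is_realization_def Ai_def using r X Y G by (intro exI[of _ n]) auto
  thus ?thesis by blast
qed

lemma nu_le: "is_realization G A B C D \<Longrightarrow> nu G \<le> degree (det A)"
  unfolding nu_def by (rule Least_le) blast

text \<open>With the whole field as the subring, \<open>compression\<close> becomes Gaussian
  elimination over the constants.\<close>

lemma euclidean_subring_field: "euclidean_subring (UNIV :: 'b::field set) (\<lambda>_. 0)"
proof
  fix a b :: 'b assume "b \<noteq> 0"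
  thus "\<exists>q\<in>UNIV. a - q * b = 0 \<or> (0::int) < 0" by (intro bexI[of _ "a / b"]) auto
qed (auto intro: exI[of _ 1])

interpretation const_hom: comm_ring_hom "\<lambda>c :: 'a::field. to_fract [:c:]"
proof
  show "to_fract [:1 :: 'a:] = 1" by (simp flip: one_pCons)
qed (simp_all flip: to_fract_add to_fract_mult)

text \<open>Invertible constant matrices are both unimodular and biproper, so elimination over the
  constants yields one core for both rings, and the two degrees cancel.\<close>

lemma mu_constant:
  fixes X :: "'a::field mat"
  assumes X: "X \<in> carrier_mat m n"
  shows "mu (map_mat (\<lambda>c. to_fract [:c:]) X) = 0"
proof -
  interpret triv: euclidean_subring "UNIV :: 'a set" "\<lambda>_. 0" by (rule euclidean_subring_field)
  let ?f = "map_mat (\<lambda>c :: 'a. to_fract [:c:])"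
  obtain r C where C: "r \<le> m" "r \<le> n" "C \<in> carrier_mat r r" "det C \<noteq> 0"
    "triv.eqv X (dsum (0\<^sub>m (m - r) (n - r)) C)" using triv.compression[OF X] .
  obtain P Q where PQ: "triv.gl m P" "triv.gl n Q" "dsum (0\<^sub>m (m - r) (n - r)) C = P * X * Q"
    using triv.eqvE[OF C(5) X] .
  have gl: "pol.gl k (?f U) \<and> prp.gl k (?f U)" if U: "triv.gl k U" for k U
  proof -
    obtain V where V: "triv.gl k V" "U * V = 1\<^sub>m k" "V * U = 1\<^sub>m k" using triv.gl_inverse[OF U] .
    have c: "U \<in> carrier_mat k k" "V \<in> carrier_mat k k" using U V triv.gl_carrier by auto
    have "?f U * ?f V = 1\<^sub>m k" "?f V * ?f U = 1\<^sub>m k"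
      using V c by (simp_all flip: const_hom.mat_hom_mult[of _ k k _ k] add: const_hom.mat_hom_one)
    thus ?thesis unfolding pol.gl_def prp.gl_def
      using c by (intro conjI bexI[of _ "?f V"]) (auto simp: mat_over_def)
  qed
  have c: "P \<in> carrier_mat m m" "Q \<in> carrier_mat n n" using PQ triv.gl_carrier by auto
  have "?f (dsum (0\<^sub>m (m - r) (n - r)) C) = dsum (0\<^sub>m (m - r) (n - r)) (?f C)"
    by (rule eq_matI) (auto simp: dsum_index)
  hence e: "dsum (0\<^sub>m (m - r) (n - r)) (?f C) = ?f P * ?f X * ?f Q"
    unfolding PQ(3) using c X by (simp add: const_hom.mat_hom_mult[of _ m n _ n] const_hom.mat_hom_mult[of _ m m _ n])
  have fX: "?f X \<in> carrier_mat m n" using X by simp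
  have "pol.eqv (?f X) (dsum (0\<^sub>m (m - r) (n - r)) (?f C))" "prp.eqv (?f X) (dsum (0\<^sub>m (m - r) (n - r)) (?f C))"
    using pol.eqvI[OF fX _ _ e] prp.eqvI[OF fX _ _ e] gl PQ by auto
  hence "int (mu (?f X)) = rdeg (det (?f C)) - rdeg (det (?f C))"
    using C by (intro mu_eq[OF fX, of r]) auto
  thus ?thesis by simp
qed

lemma diag_I_eq_dsum: "diag_I G s = dsum G (1\<^sub>m s)"
  by (simp add: diag_I_def dsum_def)

text \<open>The first two cases come from \<open>mu_equivalence\<close> and \<open>mu_system\<close>
  and differ only in the exponent of the transfer function, which is -1 or 0. In the last case the
  transfer function is constant, so its index sum is 0.\<close>

theorem theorem5p9:
  fixes G :: "'a::field poly fract mat" and s :: nat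
    and A1 A0 B1 B0 C1 C0 D1 D0 :: "'a mat"
  assumes "strong_lin G s A1 A0 B1 B0 C1 C0 D1 D0"
  shows "let n = nu G; r = rf_rank G; d = mat_degree (poly_part_mat G);
             L = lin_pencil A1 A0 B1 B0 C1 C0 D1 D0;
             E = D1 + C1 * mat_inv_sq A1 * B1;
             Z = 0\<^sub>m (dim_row D1) (dim_col D1) in
         (E \<noteq> Z \<longrightarrow> int (mu G) = int (mu L) + int d * int r - int (r + s)) \<and>
         (n > 0 \<and> E = Z \<longrightarrow> mu G = mu L + d * r) \<and>
         (n = 0 \<and> D1 = Z \<longrightarrow> mu G = d * r)"
proof -
  define n p m where "n = nu G" and "p = dim_row G" and "m = dim_col G"
  define Gh where "Gh = transfer A1 A0 B1 B0 C1 C0 D1 D0"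
  have G: "G \<in> carrier_mat p m" by (simp add: p_def m_def)
  note sl = assms[unfolded strong_lin_def Let_def, folded n_def p_def m_def Gh_def, unfolded diag_I_eq_dsum]
  have c: "A1 \<in> carrier_mat n n" "A0 \<in> carrier_mat n n" "B1 \<in> carrier_mat n (m + s)" "B0 \<in> carrier_mat n (m + s)"
    "C1 \<in> carrier_mat (p + s) n" "C0 \<in> carrier_mat (p + s) n" "D1 \<in> carrier_mat (p + s) (m + s)" "D0 \<in> carrier_mat (p + s) (m + s)"
    using sl by auto
  obtain U1 U2 where U: "unimodular U1" "unimodular U2" "U1 \<in> carrier_mat (p + s) (p + s)" "U2 \<in> carrier_mat (m + s) (m + s)"
    "U1 * dsum G (1\<^sub>m s) * U2 = Gh" using sl by blast
  obtain E1 E2 where E: "biproper E1" "biproper E2" "E1 \<in> carrier_mat (p + s) (p + s)" "E2 \<in> carrier_mat (m + s) (m + s)"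
    "E1 * dsum ((lam powi gexp G) \<cdot>\<^sub>m G) (1\<^sub>m s) * E2 = (lam powi gexp Gh) \<cdot>\<^sub>m Gh" using sl by blast
  have fin: "pol.eqv (dsum G (1\<^sub>m s)) Gh"
    using U G unimodular_iff by (intro pol.eqvI[of _ "p + s" "m + s" U1 U2]) auto
  have inf: "prp.eqv (dsum ((lam powi gexp G) \<cdot>\<^sub>m G) (1\<^sub>m s)) ((lam powi gexp Gh) \<cdot>\<^sub>m Gh)"
    using E G biproper_iff by (intro prp.eqvI[of _ "p + s" "m + s" E1 E2]) auto
  define r where "r = rf_rank G"
  have muGh: "int (mu Gh) = int (mu G) + gexp G * int r - gexp Gh * int (r + s)"
    unfolding r_def by (rule mu_equivalence[OF G fin inf])
  define d where "d = mat_degree (poly_part_mat G)"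
  \<comment> \<open>For \<open>G = 0\<close> the value of \<open>gexp G\<close> is unknown, but it
    is multiplied by \<open>r = 0\<close>.\<close>
  have gr: "gexp G * int r = - (int d * int r)"
  proof (cases "G = 0\<^sub>m p m")
    case True
    hence "r = 0" unfolding r_def rf_rank_def by (simp add: vec_space.rank_0I)
    thus ?thesis by simp
  next
    case False
    thus ?thesis using gexp_eq_poly_part[OF G] by (simp add: d_def)
  qed
  have Ghc: "Gh \<in> carrier_mat (p + s) (m + s)" using pol.eqv_carrier[OF fin] G by simp
  \<comment> \<open>Likewise, if \<open>Gh\<close> vanishes, so does the factor \<open>r + s\<close>
    that accompanies its unknown \<open>gexp\<close>.\<close>
  have Gh0: "r = 0 \<and> s = 0" if "Gh = 0\<^sub>m (p + s) (m + s)"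
  proof -
    obtain V1 V2 where V: "pol.gl (p + s) V1" "pol.gl (m + s) V2" "dsum G (1\<^sub>m s) = V1 * Gh * V2"
      using pol.eqvE[OF pol.eqv_sym[OF fin] Ghc] .
    hence z: "dsum G (1\<^sub>m s) = 0\<^sub>m (p + s) (m + s)"
      using that pol.gl_carrier[OF V(1)] pol.gl_carrier[OF V(2)] by simp
    have "s = 0"
    proof (rule ccontr)
      assume "s \<noteq> 0"
      hence "dsum G (1\<^sub>m s) $$ (p, m) = 1" using G by (simp add: dsum_index)
      thus False using z \<open>s \<noteq> 0\<close> by simp
    qed
    moreover have "G = 0\<^sub>m p m"
    proof (rule eq_matI)
      fix i j assume "i < dim_row (0\<^sub>m p m :: 'a poly fract mat)" "j < dim_col (0\<^sub>m p m :: 'a poly fract mat)"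
      hence ij: "i < p" "j < m" by auto
      hence "dsum G (1\<^sub>m s) $$ (i, j) = G $$ (i, j)" using G by (simp add: dsum_index)
      thus "G $$ (i, j) = 0\<^sub>m p m $$ (i, j)" using z ij by simp
    qed (use G in auto)
    hence "r = 0" unfolding r_def rf_rank_def by (simp add: vec_space.rank_0I)
    ultimately show ?thesis by simp
  qed
  define A B C D where "A = poly_pencil A1 A0" and "B = poly_pencil B1 B0"
    and "C = poly_pencil C1 C0" and "D = poly_pencil D1 D0"
  have pc: "A \<in> carrier_mat n n" "B \<in> carrier_mat n (m + s)" "C \<in> carrier_mat (p + s) n" "D \<in> carrier_mat (p + s) (m + s)"
    using c poly_pencil_carrier unfolding A_def B_def C_def D_def by blast+
  have pm: "pencil A1 A0 = map_mat to_fract A" "pencil B1 B0 = map_mat to_fract B"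
    "pencil C1 C0 = map_mat to_fract C" "pencil D1 D0 = map_mat to_fract D"
    by (simp_all add: A_def B_def C_def D_def pencil_eq_map)
  define Af Bf Cf Df where "Af = map_mat to_fract A" and "Bf = map_mat to_fract B"
    and "Cf = map_mat to_fract C" and "Df = map_mat to_fract D"
  have fc: "Af \<in> carrier_mat n n" "Bf \<in> carrier_mat n (m + s)" "Cf \<in> carrier_mat (p + s) n" "Df \<in> carrier_mat (p + s) (m + s)"
    using pc by (auto simp: Af_def Bf_def Cf_def Df_def)
  \<comment> \<open>For \<open>n = 0\<close> the determinant of the empty matrix is 1, in agreement
    with the condition in \<open>strong_lin\<close> being restricted to
    \<open>n > 0\<close>.\<close>
  have dAf: "det Af \<noteq> 0"
  proof (cases "n = 0")
    case True thus ?thesis using fc by simp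
  next
    case False thus ?thesis using sl unfolding Af_def pm[symmetric] by simp
  qed
  hence dA: "det A \<noteq> 0" by (auto simp: Af_def)
  have GhE: "Gh = Df + Cf * mat_inv_sq Af * Bf"
    unfolding Gh_def transfer_def pm Af_def Bf_def Cf_def Df_def ..
  have minimal: "n \<le> degree (det A')" if real: "is_realization Gh A' B' C' D'" for A' B' C' D'
  proof -
    obtain B'' C'' D'' where "is_realization G A' B'' C'' D''" using realization_of_dsum[OF G fin real] by blast
    thus ?thesis unfolding n_def by (rule nu_le)
  qed
  have "is_realization Gh A B C D"
    unfolding is_realization_def
    using pc dA Ghc GhE by (intro exI[of _ n]) (simp add: Af_def Bf_def Cf_def Df_def)
  hence degA: "n \<le> degree (det A)" by (rule minimal)
  define l where "l = (inverse lam :: 'a poly fract)"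
  have l: "l \<noteq> 0" "rdeg l = - 1" "l * lam = 1" using rdeg_lam_powi[of "-1"] by (auto simp: l_def)
  have at: "mat_at_inf (l \<cdot>\<^sub>m Af) A1" "mat_at_inf (l \<cdot>\<^sub>m Bf) B1" "mat_at_inf (l \<cdot>\<^sub>m Cf) C1" "mat_at_inf (l \<cdot>\<^sub>m Df) D1"
    using pencil_at_inf[OF c(1), of A0] pencil_at_inf[OF c(3), of B0] pencil_at_inf[OF c(5), of C0] pencil_at_inf[OF c(7), of D0]
    unfolding l_def pm Af_def Bf_def Cf_def Df_def by simp_all
  have lAc: "l \<cdot>\<^sub>m Af \<in> carrier_mat n n" using fc by simp
  have detlA: "det (l \<cdot>\<^sub>m Af) = l ^ n * det Af" using fc by (simp add: det_smult)
  note det_smult [simp del]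
  have nzlA: "det (l \<cdot>\<^sub>m Af) \<noteq> 0" using detlA l dAf by simp
  have rlA: "rdeg (det (l \<cdot>\<^sub>m Af)) = int (degree (det A)) - int n"
    unfolding detlA using l dAf dA by (simp add: rdeg_mult rdeg_power) (simp add: Af_def rdeg_to_fract)
  have ptA: "at_inf (det (l \<cdot>\<^sub>m Af)) (det A1)" by (rule det_at_inf[OF at(1) lAc])
  \<comment> \<open>Properness means \<open>degree (det A) \<le> n\<close>. With \<open>degA\<close>
    equality holds, and then the value \<open>det A1\<close> at infinity cannot vanish.\<close>
  have "rdeg (det (l \<cdot>\<^sub>m Af)) \<le> 0" using at_inf_proper[OF ptA] nzlA by (simp add: proper_iff)
  hence rlA0: "rdeg (det (l \<cdot>\<^sub>m Af)) = 0" and degA': "degree (det A) = n" using rlA degA by linarith+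
  have dA1: "det A1 \<noteq> 0"
  proof
    assume "det A1 = 0"
    hence "strictly_proper_rf (det (l \<cdot>\<^sub>m Af))" using ptA by simp
    thus False using nzlA rlA0 by (simp add: strictly_proper_iff)
  qed
  \<comment> \<open>The inverse of \<open>Af\<close> is \<open>l\<close> times a biproper
    \<open>W\<close> with value \<open>mat_inv_sq A1\<close> at infinity. This makes its products
    with \<open>Bf\<close> and \<open>Cf\<close> proper and identifies the leading coefficient of
    \<open>Gh\<close>.\<close>
  have "prp.gl n (l \<cdot>\<^sub>m Af)"
    using prp.gl_of_det[OF lAc mat_at_inf_proper[OF at(1)] nzlA] rlA0 by simp
  then obtain W where W: "prp.gl n W" "(l \<cdot>\<^sub>m Af) * W = 1\<^sub>m n" "W * (l \<cdot>\<^sub>m Af) = 1\<^sub>m n" using prp.gl_inverse by metis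
  have Wc: "W \<in> carrier_mat n n" "mat_over {x. proper_rf x} W" using W by (auto simp: prp.gl_def)
  have invA: "mat_inv_sq Af = l \<cdot>\<^sub>m W"
  proof (rule mat_inv_sq_eqI[OF fc(1)])
    show "l \<cdot>\<^sub>m W * Af = 1\<^sub>m n"
      using W(3) mult_smult_distrib[OF Wc(1) fc(1), of l] mult_smult_assoc_mat[OF Wc(1) fc(1), of l] by simp
  qed (use Wc in simp)
  obtain W0 where W0: "W0 \<in> carrier_mat n n" "mat_at_inf W W0" using proper_at_inf_mat[OF Wc(2,1)] .
  have "mat_at_inf (1\<^sub>m n) (W0 * A1)"
    using mat_at_inf_mult[OF W0(2) at(1)] W0(1) c(1) W(3) by simp
  hence "W0 * A1 = 1\<^sub>m n" using mat_at_inf_unique mat_at_inf_one by blast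
  hence invA1: "mat_inv_sq A1 = W0" using c(1) W0(1) by (intro mat_inv_sq_eqI)
  have AB: "mat_inv_sq Af * Bf = W * (l \<cdot>\<^sub>m Bf)" and CA: "Cf * mat_inv_sq Af = (l \<cdot>\<^sub>m Cf) * W"
    unfolding invA using Wc fc by (simp_all add: mult_smult_distrib[of _ n n _ "m + s"] mult_smult_assoc_mat[of _ n n _ "m + s"]
      mult_smult_distrib[of _ "p + s" n _ n] mult_smult_assoc_mat[of _ "p + s" n _ n])
  have prAB: "mat_over {x. proper_rf x} (mat_inv_sq Af * Bf)" and prCA: "mat_over {x. proper_rf x} (Cf * mat_inv_sq Af)"
    unfolding AB CA using Wc fc at mat_at_inf_proper by (auto intro!: prp.mat_over_mult)
  have muL: "mu (lin_pencil A1 A0 B1 B0 C1 C0 D1 D0) = mu Gh"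
    unfolding lin_pencil_def pm GhE unfolding Af_def Bf_def Cf_def Df_def
  proof (rule mu_system[OF pc(1) dA pc(2,3,4)])
    fix A' B' C' D'
    assume "is_realization (map_mat to_fract D + map_mat to_fract C * mat_inv_sq (map_mat to_fract A) * map_mat to_fract B) A' B' C' D'"
    hence "is_realization Gh A' B' C' D'" using GhE by (simp add: Af_def Bf_def Cf_def Df_def)
    thus "degree (det A) \<le> degree (det A')" using minimal degA' by simp
  qed (use prAB prCA in \<open>simp_all add: Af_def Bf_def Cf_def\<close>)
  define EE where "EE = D1 + C1 * mat_inv_sq A1 * B1"
  have EEc: "EE \<in> carrier_mat (p + s) (m + s)" using c W0 by (simp add: EE_def invA1)
  have Ghat: "mat_at_inf (l \<cdot>\<^sub>m Gh) EE"
  proof -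
    have "l \<cdot>\<^sub>m Gh = l \<cdot>\<^sub>m Df + l \<cdot>\<^sub>m (Cf * mat_inv_sq Af * Bf)"
      unfolding GhE invA using fc Wc by (intro add_smult_distrib_left_mat) auto
    also have "l \<cdot>\<^sub>m (Cf * mat_inv_sq Af * Bf) = (l \<cdot>\<^sub>m Cf) * W * (l \<cdot>\<^sub>m Bf)"
      unfolding CA by (rule mult_smult_distrib[symmetric, OF mult_carrier_mat[of _ "p + s", OF _ Wc(1)] fc(2)]) (use fc in simp)
    finally have "l \<cdot>\<^sub>m Gh = l \<cdot>\<^sub>m Df + (l \<cdot>\<^sub>m Cf) * W * (l \<cdot>\<^sub>m Bf)" .
    moreover have "mat_at_inf (l \<cdot>\<^sub>m Df + (l \<cdot>\<^sub>m Cf) * W * (l \<cdot>\<^sub>m Bf)) (D1 + C1 * W0 * B1)"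
      using c W0 at by (intro mat_at_inf_add mat_at_inf_mult) auto
    ultimately show ?thesis by (simp add: EE_def invA1)
  qed
  have Ghij: "at_inf (l * Gh $$ (i, j)) (EE $$ (i, j))" if "i < p + s" "j < m + s" for i j
    using Ghat Ghc EEc that by (auto simp: mat_at_inf_def)
  have le1: "mat_over {x. rdeg_le 1 x} Gh"
  proof -
    have "rdeg_le 1 (Gh $$ (i, j))" if "i < p + s" "j < m + s" for i j
      using at_inf_proper[OF Ghij[OF that]] l
      by (cases "Gh $$ (i, j) = 0") (auto simp: rdeg_le_def proper_iff rdeg_mult)
    thus ?thesis using Ghc by (auto simp: mat_over_def)
  qed
  \<comment> \<open>Degrees are integers, so an entry has degree at most 0 exactly if
    \<open>l\<close> times it is strictly proper, that is, has value 0 at infinity.\<close>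
  have le0: "mat_over {x. rdeg_le 0 x} Gh \<longleftrightarrow> EE = 0\<^sub>m (p + s) (m + s)"
  proof -
    have "rdeg_le 0 (Gh $$ (i, j)) \<longleftrightarrow> EE $$ (i, j) = 0" if ij: "i < p + s" "j < m + s" for i j
    proof -
      have "rdeg_le 0 (Gh $$ (i, j)) \<longleftrightarrow> strictly_proper_rf (l * Gh $$ (i, j))"
        using l by (cases "Gh $$ (i, j) = 0") (auto simp: rdeg_le_def strictly_proper_iff rdeg_mult)
      also have "\<dots> \<longleftrightarrow> EE $$ (i, j) = 0"
        using at_inf_unique[OF Ghij[OF ij], of 0] Ghij[OF ij] by auto
      finally show ?thesis .
    qed
    thus ?thesis using Ghc EEc by (auto simp: mat_over_def mat_eq_iff)
  qed
  have caseE: "int (mu G) = int (mu Gh) + int d * int r - int (r + s)" if "EE \<noteq> 0\<^sub>m (p + s) (m + s)"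
  proof -
    have "Gh \<noteq> 0\<^sub>m (p + s) (m + s)"
    proof
      assume "Gh = 0\<^sub>m (p + s) (m + s)"
      hence "mat_over {x. rdeg_le 0 x} Gh" by (simp add: mat_over_def rdeg_le_def)
      thus False using le0 that by simp
    qed
    hence "gexp Gh = - int 1" using gexp_eq[OF Ghc, of 1] le1 le0 that by simp
    thus ?thesis using muGh gr by simp
  qed
  have case0: "mu G = mu Gh + d * r" if "EE = 0\<^sub>m (p + s) (m + s)"
  proof -
    have "gexp Gh * int (r + s) = 0"
    proof (cases "Gh = 0\<^sub>m (p + s) (m + s)")
      case False
      hence "gexp Gh = - int 0" using gexp_eq[OF Ghc, of 0] le0 that by simp
      thus ?thesis by simp
    qed (use Gh0 in simp)
    hence "int (mu G) = int (mu Gh) + int d * int r" using muGh gr by linarith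
    thus ?thesis by (metis of_nat_add of_nat_eq_iff of_nat_mult)
  qed
  \<comment> \<open>With no states and \<open>D1 = 0\<close>, the transfer function is the constant
    matrix \<open>D0\<close>.\<close>
  have casen: "mu G = d * r" if n0: "n = 0" and D1: "D1 = 0\<^sub>m (p + s) (m + s)"
  proof -
    have "C1 * mat_inv_sq A1 * B1 = 0\<^sub>m (p + s) (m + s)"
      using c n0 by (intro eq_matI) (auto simp: scalar_prod_def)
    hence "EE = 0\<^sub>m (p + s) (m + s)" using D1 by (simp add: EE_def)
    moreover have "Gh = map_mat (\<lambda>c. to_fract [:c:]) D0"
    proof -
      have "Cf * mat_inv_sq Af * Bf = 0\<^sub>m (p + s) (m + s)"
        using fc n0 by (intro eq_matI) (auto simp: scalar_prod_def)
      hence "Gh = pencil D1 D0" unfolding GhE using fc by (simp add: pm Df_def)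
      also have "\<dots> = map_mat (\<lambda>c. to_fract [:c:]) D0"
        using c(8) D1 by (intro eq_matI) (auto simp: pencil_def)
      finally show ?thesis .
    qed
    ultimately show ?thesis using case0 mu_constant[OF c(8)] by simp
  qed
  have dims: "dim_row D1 = p + s" "dim_col D1 = m + s" using c(7) by auto
  show ?thesis
    unfolding Let_def dims n_def[symmetric] r_def[symmetric] d_def[symmetric] EE_def[symmetric] muL
    using caseE case0 casen by blast
qed

end
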